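(* Let $T$ be an $\mathrm{NSOP}_{3}$ theory, and assume that Conant-independence $\downarrow^{K^{*}}$ is symmetric in $T$. Let $M$ be a model of $T$, and suppose $p$ and $q$ are global types finitely satisfiable over $M$ with $p^{(\omega)}|_{M}=q^{(\omega)}|_{M}$. Let $a,b\supseteq M$ be small supersets of $M$ with $a\downarrow^{K}_{M}b$. Then there is $c\models p(x)|_{a}\cup q(x)|_{b}$ with $c\downarrow^{K^{*}}_{M}ab$.
   Context: $T$ is a complete first-order theory, $\mathbb{M}$ a sufficiently saturated model of $T$, and $M\prec\mathbb{M}$ is small. For $n\ge 3$, a theory has $\mathrm{SOP}_{n}$ if there is a definable relation $R(x_{1},x_{2})$ (on tuples) with no $n$-cycles, but with tuples $\{a_{i}\}_{i\in\omega}$ such that $\models R(a_{i},a_{j})$ for all $i<j$. Otherwise it is $\mathrm{NSOP}_{n}$. A global type is a complete type over $\mathbb{M}$. A global type $p(x)$ is $M$-invariant if $\varphi(x,b)\in p$ and $b'\equiv_{M}b$ imply $\varphi(x,b')\in p$; it is finitely satisfiable over $M$ (hence $M$-invariant) if every formula in it is satisfied by a tuple from $M$. For an $M$-invariant type $p$, $p^{(\omega)}$ is the $M$-invariant type such that, for $A\supseteq M$, $\{a_{i}\}_{i\in\omega}\models p^{(\omega)}|_{A}$ iff $a_{i}\models p|_{A\{a_{j}\}_{j<i}}$ for all $i$. An invariant Morley sequence over $M$ is a sequence $\{b_{i}\}_{i\in\omega}$ such that, for some fixed global $M$-invariant type $p$, $b_{i}\models p|_{M\{b_{j}\}_{j<i}}$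 for all $i$. A formula $\varphi(x,b)$ Kim-divides over $M$ if there is an invariant Morley sequence $\{b_{i}\}_{i\in\omega}$ over $M$ with $b_{0}=b$ such that $\{\varphi(x,b_{i})\}_{i\in\omega}$ is inconsistent; it Kim-forks over $M$ if it implies a finite disjunction of formulas Kim-dividing over $M$. $a\downarrow^{K}_{M}b$ means $\mathrm{tp}(a/Mb)$ contains no formula Kim-forking over $M$. A formula $\varphi(x,b)$ Conant-divides over $M$ if for every invariant Morley sequence $\{b_{i}\}_{i\in\omega}$ over $M$ with $b_{0}=b$, $\{\varphi(x,b_{i})\}_{i\in\omega}$ is inconsistent; it Conant-forks over $M$ if it implies a (finite) disjunction of formulas Conant-dividing over $M$. $a\downarrow^{K^{*}}_{M}b$ means $\mathrm{tp}(a/Mb)$ contains no formula Conant-forking over $M$. The relation $\downarrow^{K^{*}}$ is symmetric if for all $M,a,b$, $a\downarrow^{K^{*}}_{M}b$ implies $b\downarrow^{K^{*}}_{M}a$. *)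

theory Defs
  imports Main
begin

unbundle cardinal_syntax

section \<open>First-order languages, formulas and structures\<close>

record ('f, 'r) lang =
  fun_syms :: "'f set"
  fun_ar :: "'f \<Rightarrow> nat"
  rel_syms :: "'r set"
  rel_ar :: "'r \<Rightarrow> nat"

text \<open>A structure carries its language; its universe is the whole (nonempty) type \<open>'m\<close>.
  Elementary submodels are subsets of \<open>'m\<close>.\<close>

record ('f, 'r, 'm) struct = "('f, 'r) lang" +
  fun_int :: "'f \<Rightarrow> 'm list \<Rightarrow> 'm"
  rel_int :: "'r \<Rightarrow> 'm list \<Rightarrow> bool"

text \<open>Free variables are labelled by an arbitrary type \<open>'v\<close>, so that a tuple of variables can have
  any length; the variables that quantifiers bind are the separate \<open>Bound n\<close>, whence substitution
  for free variables (\<open>map_fm\<close>) never captures. \<open>fm_vars\<close> is the set of free variable labels.\<close>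

datatype ('f, tm_vars: 'v) tm = Free 'v | Bound nat | App 'f "('f, 'v) tm list"

datatype ('f, 'r, fm_vars: 'v) fm =
    Equal "('f, 'v) tm" "('f, 'v) tm"
  | Rel 'r "('f, 'v) tm list"
  | Neg "('f, 'r, 'v) fm"
  | Conj "('f, 'r, 'v) fm" "('f, 'r, 'v) fm"
  | Ex nat "('f, 'r, 'v) fm"

primrec wf_tm :: "('f, 'r, 'z) lang_scheme \<Rightarrow> ('f, 'v) tm \<Rightarrow> bool" where
  "wf_tm L (Free v) \<longleftrightarrow> True"
| "wf_tm L (Bound n) \<longleftrightarrow> True"
| "wf_tm L (App f ts) \<longleftrightarrow> f \<in> fun_syms L \<and> length ts = fun_ar L f \<and> list_all (wf_tm L) ts"

primrec wf_fm :: "('f, 'r, 'z) lang_scheme \<Rightarrow> ('f, 'r, 'v) fm \<Rightarrow> bool" where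
  "wf_fm L (Equal s t) \<longleftrightarrow> wf_tm L s \<and> wf_tm L t"
| "wf_fm L (Rel r ts) \<longleftrightarrow> r \<in> rel_syms L \<and> length ts = rel_ar L r \<and> list_all (wf_tm L) ts"
| "wf_fm L (Neg \<phi>) \<longleftrightarrow> wf_fm L \<phi>"
| "wf_fm L (Conj \<phi> \<psi>) \<longleftrightarrow> wf_fm L \<phi> \<and> wf_fm L \<psi>"
| "wf_fm L (Ex n \<phi>) \<longleftrightarrow> wf_fm L \<phi>"

primrec tm_bounds :: "('f, 'v) tm \<Rightarrow> nat set" where
  "tm_bounds (Free v) = {}"
| "tm_bounds (Bound n) = {n}"
| "tm_bounds (App f ts) = \<Union> (set (map tm_bounds ts))"

text \<open>The \<open>Bound\<close> variables not captured by any quantifier.\<close>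

primrec dangling :: "('f, 'r, 'v) fm \<Rightarrow> nat set" where
  "dangling (Equal s t) = tm_bounds s \<union> tm_bounds t"
| "dangling (Rel r ts) = \<Union> (set (map tm_bounds ts))"
| "dangling (Neg \<phi>) = dangling \<phi>"
| "dangling (Conj \<phi> \<psi>) = dangling \<phi> \<union> dangling \<psi>"
| "dangling (Ex n \<phi>) = dangling \<phi> - {n}"

definition formula :: "('f, 'r, 'z) lang_scheme \<Rightarrow> ('f, 'r, 'v) fm \<Rightarrow> bool" where
  "formula L \<phi> \<longleftrightarrow> wf_fm L \<phi> \<and> dangling \<phi> = {}"

primrec eval :: "('f, 'r, 'm) struct \<Rightarrow> ('v \<Rightarrow> 'm) \<Rightarrow> (nat \<Rightarrow> 'm) \<Rightarrow> ('f, 'v) tm \<Rightarrow> 'm" where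
  "eval S e s (Free v) = e v"
| "eval S e s (Bound n) = s n"
| "eval S e s (App f ts) = fun_int S f (map (eval S e s) ts)"

text \<open>Satisfaction with quantifiers ranging over the subset \<open>U\<close>.\<close>

primrec sat :: "('f, 'r, 'm) struct \<Rightarrow> 'm set \<Rightarrow> ('v \<Rightarrow> 'm) \<Rightarrow> (nat \<Rightarrow> 'm) \<Rightarrow> ('f, 'r, 'v) fm \<Rightarrow> bool" where
  "sat S U e s (Equal t u) \<longleftrightarrow> eval S e s t = eval S e s u"
| "sat S U e s (Rel r ts) \<longleftrightarrow> rel_int S r (map (eval S e s) ts)"
| "sat S U e s (Neg \<phi>) \<longleftrightarrow> \<not> sat S U e s \<phi>"
| "sat S U e s (Conj \<phi> \<psi>) \<longleftrightarrow> sat S U e s \<phi> \<and> sat S U e s \<psi>"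
| "sat S U e s (Ex n \<phi>) \<longleftrightarrow> (\<exists>m\<in>U. sat S U e (s(n := m)) \<phi>)"

text \<open>Only used for formulas without dangling \<open>Bound\<close> variables, for which the value given to
  these is irrelevant.\<close>

definition holds_in :: "('f, 'r, 'm) struct \<Rightarrow> 'm set \<Rightarrow> ('v \<Rightarrow> 'm) \<Rightarrow> ('f, 'r, 'v) fm \<Rightarrow> bool" where
  "holds_in S U e \<phi> \<longleftrightarrow> sat S U e (\<lambda>_. undefined) \<phi>"

abbreviation holds :: "('f, 'r, 'm) struct \<Rightarrow> ('v \<Rightarrow> 'm) \<Rightarrow> ('f, 'r, 'v) fm \<Rightarrow> bool" where
  "holds S \<equiv> holds_in S UNIV"

definition sentences :: "('f, 'r, 'z) lang_scheme \<Rightarrow> ('f, 'r, nat) fm set" where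
  "sentences L = {\<phi>. formula L \<phi> \<and> fm_vars \<phi> = {}}"

text \<open>Theories are deductively closed; consistency of a complete theory is provided by a model.\<close>

definition complete_theory :: "('f, 'r, 'z) lang_scheme \<Rightarrow> ('f, 'r, nat) fm set \<Rightarrow> bool" where
  "complete_theory L T \<longleftrightarrow> T \<subseteq> sentences L \<and> (\<forall>\<phi>\<in>sentences L. \<phi> \<in> T \<or> Neg \<phi> \<in> T)"

definition is_model :: "('f, 'r, 'm) struct \<Rightarrow> ('f, 'r, nat) fm set \<Rightarrow> bool" where
  "is_model S T \<longleftrightarrow> (\<forall>\<phi>\<in>T. holds S (\<lambda>_. undefined) \<phi>)"

text \<open>Elements of \<open>M\<close> serve as labels for themselves.\<close>

definition elem_submodel :: "'m set \<Rightarrow> ('f, 'r, 'm) struct \<Rightarrow> bool" where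
  "elem_submodel M S \<longleftrightarrow> M \<noteq> {} \<and>
    (\<forall>f\<in>fun_syms S. \<forall>xs. length xs = fun_ar S f \<and> set xs \<subseteq> M \<longrightarrow> fun_int S f xs \<in> M) \<and>
    (\<forall>\<phi>::('f, 'r, 'm) fm. formula S \<phi> \<and> fm_vars \<phi> \<subseteq> M \<longrightarrow> (holds_in S M id \<phi> \<longleftrightarrow> holds S id \<phi>))"


section \<open>Types\<close>

text \<open>A tuple indexed by a set \<open>V :: 'v set\<close> is a function \<open>a :: 'v \<Rightarrow> 'm\<close>, of which only the values
  on \<open>V\<close> matter; a finite tuple of length \<open>n\<close> has \<open>V = {..<n}\<close>.

  \<open>fms L V W\<close> consists of the formulas in two groups of variables, labelled by \<open>V\<close> and \<open>W\<close>.
  With \<open>W\<close> a set of elements of a structure (evaluated to themselves) these are the formulas with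
  parameters from \<open>W\<close> in the variables \<open>V\<close>.\<close>

definition fms :: "('f, 'r, 'z) lang_scheme \<Rightarrow> 'v set \<Rightarrow> 'w set \<Rightarrow> ('f, 'r, 'v + 'w) fm set" where
  "fms L V W = {\<phi>. formula L \<phi> \<and> fm_vars \<phi> \<subseteq> V <+> W}"

text \<open>From \<open>\<phi>(x,y)\<close> and \<open>b\<close> to the formula with parameters \<open>\<phi>(x,b)\<close>.\<close>

definition inst :: "('f, 'r, 'v + 'w) fm \<Rightarrow> ('w \<Rightarrow> 'm) \<Rightarrow> ('f, 'r, 'v + 'm) fm" where
  "inst \<phi> b = map_fm id id (map_sum id b) \<phi>"

abbreviation satisfies :: "('f, 'r, 'm) struct \<Rightarrow> ('v \<Rightarrow> 'm) \<Rightarrow> ('f, 'r, 'v + 'm) fm \<Rightarrow> bool" where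
  "satisfies S c \<phi> \<equiv> holds S (case_sum c id) \<phi>"

definition realizes :: "('f, 'r, 'm) struct \<Rightarrow> ('v \<Rightarrow> 'm) \<Rightarrow> ('f, 'r, 'v + 'm) fm set \<Rightarrow> bool" where
  "realizes S c \<Gamma> \<longleftrightarrow> (\<forall>\<phi>\<in>\<Gamma>. satisfies S c \<phi>)"

definition consistent :: "('f, 'r, 'm) struct \<Rightarrow> ('f, 'r, 'v + 'm) fm set \<Rightarrow> bool" where
  "consistent S \<Gamma> \<longleftrightarrow> (\<forall>\<Delta>\<subseteq>\<Gamma>. finite \<Delta> \<longrightarrow> (\<exists>c. realizes S c \<Delta>))"

definition tp :: "('f, 'r, 'm) struct \<Rightarrow> 'v set \<Rightarrow> ('v \<Rightarrow> 'm) \<Rightarrow> 'm set \<Rightarrow> ('f, 'r, 'v + 'm) fm set" where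
  "tp S V a A = {\<phi>\<in>fms S V A. satisfies S a \<phi>}"

definition complete_type ::
  "('f, 'r, 'm) struct \<Rightarrow> 'v set \<Rightarrow> 'm set \<Rightarrow> ('f, 'r, 'v + 'm) fm set \<Rightarrow> bool" where
  "complete_type S V A p \<longleftrightarrow>
    p \<subseteq> fms S V A \<and> consistent S p \<and> (\<forall>\<phi>\<in>fms S V A. \<phi> \<in> p \<or> Neg \<phi> \<in> p)"

abbreviation global_type :: "('f, 'r, 'm) struct \<Rightarrow> 'v set \<Rightarrow> ('f, 'r, 'v + 'm) fm set \<Rightarrow> bool" where
  "global_type S V p \<equiv> complete_type S V UNIV p"

definition params :: "('f, 'r, 'v + 'm) fm \<Rightarrow> 'm set" where
  "params \<phi> = {m. Inr m \<in> fm_vars \<phi>}"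

definition restr :: "('f, 'r, 'v + 'm) fm set \<Rightarrow> 'm set \<Rightarrow> ('f, 'r, 'v + 'm) fm set" where
  "restr p A = {\<phi>\<in>p. params \<phi> \<subseteq> A}"

definition invariant_type ::
  "('f, 'r, 'm) struct \<Rightarrow> 'v set \<Rightarrow> 'm set \<Rightarrow> ('f, 'r, 'v + 'm) fm set \<Rightarrow> bool" where
  "invariant_type S V M p \<longleftrightarrow>
    (\<forall>n. \<forall>\<phi>\<in>fms S V {..<n::nat}. \<forall>b b'.
      inst \<phi> b \<in> p \<and> tp S {..<n} b' M = tp S {..<n} b M \<longrightarrow> inst \<phi> b' \<in> p)"

definition fin_sat_over ::
  "('f, 'r, 'm) struct \<Rightarrow> 'm set \<Rightarrow> ('f, 'r, 'v + 'm) fm set \<Rightarrow> bool" where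
  "fin_sat_over S M p \<longleftrightarrow> (\<forall>\<phi>\<in>p. \<exists>c. range c \<subseteq> M \<and> satisfies S c \<phi>)"


section \<open>Morley sequences\<close>

text \<open>\<open>a\<^sub>i\<close> realizes the restriction of \<open>p\<close> to \<open>A\<close> and all \<open>a\<^sub>j\<close> with \<open>j < i\<close>, for every \<open>i\<close>.\<close>

definition morley_seq ::
  "('f, 'r, 'm) struct \<Rightarrow> 'v set \<Rightarrow> ('f, 'r, 'v + 'm) fm set \<Rightarrow> 'm set \<Rightarrow> (nat \<Rightarrow> 'v \<Rightarrow> 'm) \<Rightarrow> bool" where
  "morley_seq S V p A a \<longleftrightarrow> (\<forall>i. realizes S (a i) (restr p (A \<union> (\<Union>j<i. a j ` V))))"

text \<open>The global type \<open>p\<^sup>(\<^sup>\<omega>\<^sup>)\<close> of an \<open>M\<close>-invariant \<open>p\<close>, in the variables labelled by \<open>UNIV \<times> V\<close>: a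
  formula belongs to it iff it is satisfied by a Morley sequence of \<open>p\<close> over \<open>M\<close> and the parameters
  of the formula. All such sequences have the same type over these parameters.\<close>

definition morley_power ::
  "('f, 'r, 'm) struct \<Rightarrow> 'v set \<Rightarrow> 'm set \<Rightarrow> ('f, 'r, 'v + 'm) fm set \<Rightarrow> ('f, 'r, (nat \<times> 'v) + 'm) fm set" where
  "morley_power S V M p =
    {\<phi>\<in>fms S (UNIV \<times> V) UNIV.
      \<exists>a. morley_seq S V p (M \<union> params \<phi>) a \<and> satisfies S (case_prod a) \<phi>}"

definition invariant_morley_seq ::
  "('f, 'r, 'm) struct \<Rightarrow> 'v set \<Rightarrow> 'm set \<Rightarrow> (nat \<Rightarrow> 'v \<Rightarrow> 'm) \<Rightarrow> bool" where
  "invariant_morley_seq S V M b \<longleftrightarrow>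
    (\<exists>p. global_type S V p \<and> invariant_type S V M p \<and> morley_seq S V p M b)"


section \<open>Kim- and Conant-independence\<close>

text \<open>Dividing is a property of \<open>\<phi>(x,y)\<close> and a finite tuple \<open>b\<close> of length \<open>n\<close>; as usual,
  \<open>y\<close> may contain variables that do not occur in \<open>\<phi>\<close>.
  Elements of \<open>M\<close> used as parameters are part of \<open>b\<close>.\<close>

definition kim_divides ::
  "('f, 'r, 'm) struct \<Rightarrow> 'm set \<Rightarrow> ('f, 'r, 'v + nat) fm \<Rightarrow> nat \<Rightarrow> (nat \<Rightarrow> 'm) \<Rightarrow> bool" where
  "kim_divides S M \<phi> n b \<longleftrightarrow>
    (\<exists>bs. invariant_morley_seq S {..<n} M bs \<and> (\<forall>k<n. bs 0 k = b k) \<and>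
      \<not> consistent S (range (\<lambda>i. inst \<phi> (bs i))))"

definition conant_divides ::
  "('f, 'r, 'm) struct \<Rightarrow> 'm set \<Rightarrow> ('f, 'r, 'v + nat) fm \<Rightarrow> nat \<Rightarrow> (nat \<Rightarrow> 'm) \<Rightarrow> bool" where
  "conant_divides S M \<phi> n b \<longleftrightarrow>
    (\<forall>bs. invariant_morley_seq S {..<n} M bs \<and> (\<forall>k<n. bs 0 k = b k) \<longrightarrow>
      \<not> consistent S (range (\<lambda>i. inst \<phi> (bs i))))"

text \<open>\<open>\<theta>\<close>, in variables labelled by \<open>V\<close>, implies the disjunction of finitely many \<open>\<psi>(x,b)\<close> each
  of which divides in the sense of \<open>D\<close>.\<close>

definition implies_dividing ::
  "(('f, 'r, 'v + nat) fm \<Rightarrow> nat \<Rightarrow> (nat \<Rightarrow> 'm) \<Rightarrow> bool) \<Rightarrow>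
    ('f, 'r, 'm) struct \<Rightarrow> 'v set \<Rightarrow> ('f, 'r, 'v + 'm) fm \<Rightarrow> bool" where
  "implies_dividing D S V \<theta> \<longleftrightarrow>
    (\<exists>F. finite F \<and>
      (\<forall>(\<psi>, n, b)\<in>F. \<psi> \<in> fms S V {..<n} \<and> D \<psi> n b) \<and>
      (\<forall>c. satisfies S c \<theta> \<longrightarrow> (\<exists>(\<psi>, n, b)\<in>F. satisfies S c (inst \<psi> b))))"

definition kim_forks ::
  "('f, 'r, 'm) struct \<Rightarrow> 'v set \<Rightarrow> 'm set \<Rightarrow> ('f, 'r, 'v + 'm) fm \<Rightarrow> bool" where
  "kim_forks S V M = implies_dividing (kim_divides S M) S V"

definition conant_forks ::
  "('f, 'r, 'm) struct \<Rightarrow> 'v set \<Rightarrow> 'm set \<Rightarrow> ('f, 'r, 'v + 'm) fm \<Rightarrow> bool" where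
  "conant_forks S V M = implies_dividing (conant_divides S M) S V"

text \<open>Independence over \<open>M\<close> of a tuple \<open>a\<close> indexed by \<open>V\<close> from a set \<open>B\<close>.\<close>

definition kim_indep ::
  "('f, 'r, 'm) struct \<Rightarrow> 'm set \<Rightarrow> 'v set \<Rightarrow> ('v \<Rightarrow> 'm) \<Rightarrow> 'm set \<Rightarrow> bool" where
  "kim_indep S M V a B \<longleftrightarrow> (\<forall>\<theta>\<in>tp S V a (M \<union> B). \<not> kim_forks S V M \<theta>)"

definition conant_indep ::
  "('f, 'r, 'm) struct \<Rightarrow> 'm set \<Rightarrow> 'v set \<Rightarrow> ('v \<Rightarrow> 'm) \<Rightarrow> 'm set \<Rightarrow> bool" where
  "conant_indep S M V a B \<longleftrightarrow> (\<forall>\<theta>\<in>tp S V a (M \<union> B). \<not> conant_forks S V M \<theta>)"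

text \<open>A set \<open>A\<close> is regarded as the tuple of its elements, indexed by themselves.\<close>

abbreviation kim_indep_set :: "('f, 'r, 'm) struct \<Rightarrow> 'm set \<Rightarrow> 'm set \<Rightarrow> 'm set \<Rightarrow> bool" where
  "kim_indep_set S M A B \<equiv> kim_indep S M A id B"

abbreviation conant_indep_set :: "('f, 'r, 'm) struct \<Rightarrow> 'm set \<Rightarrow> 'm set \<Rightarrow> 'm set \<Rightarrow> bool" where
  "conant_indep_set S M A B \<equiv> conant_indep S M A id B"


section \<open>Saturation, smallness and the hypotheses on the theory\<close>

definition small :: "'k rel \<Rightarrow> 'a set \<Rightarrow> bool" where
  "small \<kappa> A \<longleftrightarrow> |A| <o \<kappa>"

definition saturated :: "'k rel \<Rightarrow> ('f, 'r, 'm) struct \<Rightarrow> bool" where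
  "saturated \<kappa> S \<longleftrightarrow>
    (\<forall>A. \<forall>\<Gamma>\<subseteq>fms S {0::nat} A. small \<kappa> A \<and> consistent S \<Gamma> \<longrightarrow> (\<exists>c. realizes S c \<Gamma>))"

text \<open>\<open>S\<close> is \<open>\<kappa>\<close>-saturated for an uncountable cardinal \<open>\<kappa>\<close> larger than its language.\<close>

definition monster :: "'k rel \<Rightarrow> ('f, 'r, 'm) struct \<Rightarrow> bool" where
  "monster \<kappa> S \<longleftrightarrow> Card_order \<kappa> \<and> natLeq <o \<kappa> \<and>
    small \<kappa> (fun_syms S) \<and> small \<kappa> (rel_syms S) \<and> saturated \<kappa> S"

text \<open>\<open>R(x,y)\<close> relates tuples of length \<open>k\<close>. The property is one of the theory of \<open>S\<close> when \<open>S\<close> is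
  sufficiently saturated.\<close>

definition SOP :: "nat \<Rightarrow> ('f, 'r, 'm) struct \<Rightarrow> bool" where
  "SOP n S \<longleftrightarrow>
    (\<exists>k. \<exists>R\<in>fms S {..<k::nat} {..<k::nat}.
      (\<nexists>c. \<forall>i<n. holds S (case_sum (c i) (c (Suc i mod n))) R) \<and>
      (\<exists>a. \<forall>i j. i < j \<longrightarrow> holds S (case_sum (a i) (a (j::nat))) R))"

abbreviation NSOP :: "nat \<Rightarrow> ('f, 'r, 'm) struct \<Rightarrow> bool" where
  "NSOP n S \<equiv> \<not> SOP n S"

definition conant_symmetric :: "'k rel \<Rightarrow> ('f, 'r, 'm) struct \<Rightarrow> bool" where
  "conant_symmetric \<kappa> S \<longleftrightarrow>
    (\<forall>M A B. elem_submodel M S \<and> small \<kappa> M \<and> small \<kappa> A \<and> small \<kappa> B \<longrightarrow>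
      conant_indep_set S M A B \<longrightarrow> conant_indep_set S M B A)"

end

theory Submission
  imports Defs "HOL-Library.Infinite_Set"
begin

text \<open>Realize \<open>p\<close> and \<open>q\<close> by ultrafilters \<open>U\<close>, \<open>V\<close> on tuples from \<open>M\<close>, and let \<open>r\<close> be a type
  finitely satisfiable in \<open>M\<close> that extends \<open>tp(b/M)\<close>. Since \<open>a\<close> is Kim-independent from \<open>b\<close>, for
  every Morley sequence \<open>(B\<^sub>i)\<close> of \<open>r\<close> some \<open>A\<close> satisfies \<open>A B\<^sub>i \<equiv>\<^sub>M a b\<close> for all \<open>i\<close>. The failure
  of an amalgamation property of three tuples \<open>A\<close>, \<open>B\<close>, \<open>C\<close> with prescribed types of the pairs
  gives three jointly inconsistent formulas \<open>G(A,B)\<close>, \<open>F(C,A)\<close>, \<open>H(C,B)\<close>, hence a relation between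
  triples without 3-cycles, and \<open>NSOP\<^sub>3\<close> forbids an infinite chain. This is used twice. First
  with \<open>C\<close> a Morley sequence of \<open>p\<close> over \<open>A\<close> and \<open>B\<close> a Morley sequence of \<open>r\<close> over \<open>M C\<close>, and
  then, the first case providing the tuples \<open>A\<close> because Morley sequences of \<open>p\<close> and \<open>q\<close> have the
  same type over \<open>M\<close>, with \<open>C\<close> a Morley sequence of \<open>p\<close> over \<open>A\<close> and of \<open>q\<close> over \<open>B\<close>. So a single
  sequence \<open>(C\<^sub>i)\<close> is Morley in \<open>p\<close> over \<open>a\<close> and in \<open>q\<close> over \<open>b\<close>. A limit \<open>c\<close> of the types of the
  \<open>C\<^sub>i\<close> over \<open>a b\<close> realizes \<open>p\<close> over \<open>a\<close> and \<open>q\<close> over \<open>b\<close>; each formula of \<open>tp(a b/M c)\<close> holds for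
  infinitely many \<open>C\<^sub>i\<close>, whence \<open>a b\<close> is Conant-independent from \<open>c\<close>, and symmetry applies.\<close>

subsection \<open>Definable predicates\<close>

text \<open>In the first, \<open>A\<close> can be put after \<open>B\<close> by Kim-independence,
  \<open>C\<close> after \<open>A\<close> and \<open>B\<close> after \<open>C\<close> as
  realizations of coheirs. In the second, \<open>C\<close> comes after \<open>B\<close>, so
  \<open>A\<close> has to come after the earlier \<open>C\<close> and before the later
  \<open>B\<close>. Such an \<open>A\<close> cannot be chosen outright: over it the earlier
  \<open>C\<close> must be Morley in \<open>p\<close>, and with each later \<open>B\<close> it must
  have the type of \<open>a b\<close>. The triple produced by the first use has just this shape and
  is copied onto the chain. There the \<open>C\<close> are Morley in \<open>q\<close>, and many of
  them are matched with one \<open>A\<close> at once; hence \<open>p\<close> and \<open>q\<close>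
  must agree on whole Morley sequences over \<open>M\<close>, not only on single realizations. A
  3-cycle then picks \<open>A\<close>, \<open>B\<close> and \<open>C\<close> from three different
  members of the chain. Finite satisfiability, beyond invariance, allows a type to be extended to
  further variables without leaving the class of types considered.\<close>

lemma eval_map: "eval S e s (map_tm id f t) = eval S (e \<circ> f) s t"
  by (induction t) (auto simp: o_def cong: map_cong)

lemma sat_map: "sat S U e s (map_fm id id f \<phi>) \<longleftrightarrow> sat S U (e \<circ> f) s \<phi>"
  by (induction \<phi> arbitrary: s) (auto simp: eval_map o_def cong: map_cong)

lemma wf_tm_map: "wf_tm L (map_tm id f t) \<longleftrightarrow> wf_tm L t"
  by (induction t) (auto simp: list_all_iff)

lemma tm_bounds_map: "tm_bounds (map_tm id f t) = tm_bounds t"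
  by (induction t) auto

lemma formula_map: "formula L (map_fm id id f \<phi>) \<longleftrightarrow> formula L \<phi>"
proof -
  have "wf_fm L (map_fm id id f \<phi>) \<longleftrightarrow> wf_fm L \<phi>"
    by (induction \<phi>) (auto simp: list_all_iff wf_tm_map[unfolded id_def] id_def)
  moreover have "dangling (map_fm id id f \<phi>) = dangling \<phi>"
    by (induction \<phi>) (auto simp: tm_bounds_map[unfolded id_def] id_def)
  ultimately show ?thesis
    by (simp add: formula_def)
qed

lemma holds_map: "holds_in S U e (map_fm id id f \<phi>) \<longleftrightarrow> holds_in S U (e \<circ> f) \<phi>"
  by (simp add: holds_in_def sat_map)

lemma eval_cong:
  "\<lbrakk>\<And>v. v \<in> tm_vars t \<Longrightarrow> e v = e' v; \<And>n. n \<in> tm_bounds t \<Longrightarrow> s n = s' n\<rbrakk>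
    \<Longrightarrow> eval S e s t = eval S e' s' t"
proof (induction t)
  case (App f ts)
  have "eval S e s t = eval S e' s' t" if "t \<in> set ts" for t
    by (rule App.IH[OF that]; rule App.prems; use that in auto)
  then have "map (eval S e s) ts = map (eval S e' s') ts" by simp
  then show ?case by (simp only: eval.simps)
qed auto

lemma sat_cong:
  "\<lbrakk>\<And>v. v \<in> fm_vars \<phi> \<Longrightarrow> e v = e' v; \<And>n. n \<in> dangling \<phi> \<Longrightarrow> s n = s' n\<rbrakk>
    \<Longrightarrow> sat S U e s \<phi> \<longleftrightarrow> sat S U e' s' \<phi>"
proof (induction \<phi> arbitrary: s s')
  case (Equal t u)
  then show ?case using eval_cong[of t e e' s s' S] eval_cong[of u e e' s s' S] by auto
next
  case (Rel r ts)
  then have "map (eval S e s) ts = map (eval S e' s') ts"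
    by (intro map_cong eval_cong) auto
  then show ?case by (simp only: sat.simps)
next
  case (Neg \<phi>)
  have "sat S U e s \<phi> \<longleftrightarrow> sat S U e' s' \<phi>" by (rule Neg.IH) (use Neg.prems in auto)
  then show ?case by simp
next
  case (Conj \<phi> \<psi>)
  have "sat S U e s \<phi> \<longleftrightarrow> sat S U e' s' \<phi>" "sat S U e s \<psi> \<longleftrightarrow> sat S U e' s' \<psi>"
    by (rule Conj.IH; use Conj.prems in auto)+
  then show ?case by simp
next
  case (Ex n \<phi>)
  have "sat S U e (s(n := m)) \<phi> \<longleftrightarrow> sat S U e' (s'(n := m)) \<phi>" for m
    by (rule Ex.IH) (use Ex.prems in auto)
  then show ?case by simp
qed

lemma sat_any: "formula L \<phi> \<Longrightarrow> sat S U e s \<phi> \<longleftrightarrow> holds_in S U e \<phi>"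
  unfolding holds_in_def by (rule sat_cong) (auto simp: formula_def)

lemma holds_cong: "\<lbrakk>formula L \<phi>; \<And>v. v \<in> fm_vars \<phi> \<Longrightarrow> e v = e' v\<rbrakk> \<Longrightarrow> holds_in S U e \<phi> \<longleftrightarrow>
    holds_in S U e' \<phi>"
  unfolding holds_in_def by (rule sat_cong) (auto simp: formula_def)

text \<open>Quantification over a free variable: it is first turned into a bound variable \<open>n\<close> which
  occurs nowhere in the formula.\<close>

primrec bind_tm :: "'v \<Rightarrow> nat \<Rightarrow> ('f, 'v) tm \<Rightarrow> ('f, 'v) tm" where
  "bind_tm v n (Free w) = (if w = v then Bound n else Free w)"
| "bind_tm v n (Bound k) = Bound k"
| "bind_tm v n (App f ts) = App f (map (bind_tm v n) ts)"

primrec bind_fm :: "'v \<Rightarrow> nat \<Rightarrow> ('f, 'r, 'v) fm \<Rightarrow> ('f, 'r, 'v) fm" where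
  "bind_fm v n (Equal s t) = Equal (bind_tm v n s) (bind_tm v n t)"
| "bind_fm v n (Rel r ts) = Rel r (map (bind_tm v n) ts)"
| "bind_fm v n (Neg \<phi>) = Neg (bind_fm v n \<phi>)"
| "bind_fm v n (Conj \<phi> \<psi>) = Conj (bind_fm v n \<phi>) (bind_fm v n \<psi>)"
| "bind_fm v n (Ex k \<phi>) = Ex k (bind_fm v n \<phi>)"

primrec all_bounds :: "('f, 'r, 'v) fm \<Rightarrow> nat set" where
  "all_bounds (Equal s t) = tm_bounds s \<union> tm_bounds t"
| "all_bounds (Rel r ts) = \<Union> (set (map tm_bounds ts))"
| "all_bounds (Neg \<phi>) = all_bounds \<phi>"
| "all_bounds (Conj \<phi> \<psi>) = all_bounds \<phi> \<union> all_bounds \<psi>"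
| "all_bounds (Ex n \<phi>) = insert n (all_bounds \<phi>)"

lemma finite_all_bounds: "finite (all_bounds (\<phi> :: ('f, 'r, 'v) fm))"
proof -
  have "finite (tm_bounds t)" for t :: "('f, 'v) tm"
    by (induction t) auto
  then show ?thesis by (induction \<phi>) auto
qed

lemma finite_fm_vars: "finite (fm_vars (\<phi> :: ('f, 'r, 'v) fm))"
proof -
  have "finite (tm_vars t)" for t :: "('f, 'v) tm"
    by (induction t) auto
  then show ?thesis by (induction \<phi>) auto
qed

lemma bind_tm_facts:
  "eval S e s (bind_tm v n t) = eval S (e(v := s n)) s t"
  "wf_tm L (bind_tm v n t) \<longleftrightarrow> wf_tm L t"
  "tm_vars (bind_tm v n t) = tm_vars t - {v}"
  by (induction t) (auto simp: list_all_iff o_def cong: map_cong)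

lemma tm_bounds_bind: "k \<in> tm_bounds (bind_tm v n t) \<Longrightarrow> k = n \<or> k \<in> tm_bounds t"
  by (induction t) (auto split: if_splits)

text \<open>The index must avoid every quantifier of the formula, not just its dangling variables:
  an inner \<open>Ex n\<close> would capture the new \<open>Bound n\<close>. This is why
  \<open>all_bounds\<close> also collects the indices of quantifiers.\<close>

lemma sat_bind:
  "n \<notin> all_bounds \<phi> \<Longrightarrow> sat S U e s (bind_fm v n \<phi>) \<longleftrightarrow> sat S U (e(v := s n)) s \<phi>"
  by (induction \<phi> arbitrary: s) (auto simp: bind_tm_facts o_def)

lemma bind_fm_facts:
  "wf_fm L (bind_fm v n \<phi>) \<longleftrightarrow> wf_fm L \<phi>"
  "fm_vars (bind_fm v n \<phi>) = fm_vars \<phi> - {v}"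
  by (induction \<phi>) (auto simp: bind_tm_facts list_all_iff)

lemma dangling_bind: "k \<in> dangling (bind_fm v n \<phi>) \<Longrightarrow> k = n \<or> k \<in> dangling \<phi>"
  by (induction \<phi>) (auto dest: tm_bounds_bind)

text \<open>Predicates on assignments stand in for formulas from here on: closure under connectives,
  quantifiers and substitution replaces the manipulation of syntax.\<close>

definition definable0 :: "('f, 'r, 'm) struct \<Rightarrow> 'l set \<Rightarrow> (('l \<Rightarrow> 'm) \<Rightarrow> bool) \<Rightarrow> bool" where
  "definable0 S V P \<longleftrightarrow> (\<exists>\<phi>. formula S \<phi> \<and> fm_vars \<phi> \<subseteq> V \<and> (\<forall>e. P e \<longleftrightarrow> holds S e \<phi>))"

section \<open>Closure properties of parameter-free definable predicates\<close>

lemma definable0_true: "definable0 S V (\<lambda>e. True)"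
  unfolding definable0_def
  by (rule exI[of _ "Ex 0 (Equal (Bound 0) (Bound 0))"]) (simp add: formula_def holds_in_def)

lemma definable0_eq: "\<lbrakk>v \<in> V; w \<in> V\<rbrakk> \<Longrightarrow> definable0 S V (\<lambda>e. e v = e w)"
  unfolding definable0_def
  by (rule exI[of _ "Equal (Free v) (Free w)"]) (simp add: formula_def holds_in_def)

lemma definable0_not: "definable0 S V P \<Longrightarrow> definable0 S V (\<lambda>e. \<not> P e)"
  unfolding definable0_def
  by (elim exE, rule_tac x = "Neg \<phi>" in exI) (auto simp: formula_def holds_in_def)

lemma definable0_conj:
  assumes "definable0 S V P" "definable0 S V Q" shows "definable0 S V (\<lambda>e. P e \<and> Q e)"
proof -
  from assms obtain \<phi> \<psi> where
    "formula S \<phi>" "fm_vars \<phi> \<subseteq> V" "\<forall>e. P e \<longleftrightarrow> holds S e \<phi>"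
    "formula S \<psi>" "fm_vars \<psi> \<subseteq> V" "\<forall>e. Q e \<longleftrightarrow> holds S e \<psi>"
    unfolding definable0_def by metis
  then show ?thesis
    unfolding definable0_def by (intro exI[of _ "Conj \<phi> \<psi>"]) (auto simp: formula_def holds_in_def)
qed

lemma definable0_cong: "\<lbrakk>definable0 S V P; \<And>v. v \<in> V \<Longrightarrow> e v = e' v\<rbrakk> \<Longrightarrow> P e \<longleftrightarrow> P e'"
  unfolding definable0_def by (metis holds_cong subsetD)

lemma definable0_map: "definable0 S V P \<Longrightarrow> f ` V \<subseteq> W \<Longrightarrow> definable0 S W (\<lambda>e. P (e \<circ> f))"
  unfolding definable0_def
  by (elim exE, rule_tac x = "map_fm id id f \<phi>" in exI)
    (auto simp: formula_map holds_map fm.set_map)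

lemma definable0_support: "definable0 S V P \<Longrightarrow> \<exists>V0\<subseteq>V. finite V0 \<and> definable0 S V0 P"
  unfolding definable0_def using finite_fm_vars by blast

lemma definable0_ex1:
  assumes "definable0 S V P" shows "definable0 S (V - {v}) (\<lambda>e. \<exists>m. P (e(v := m)))"
proof -
  from assms obtain \<phi> where \<phi>: "formula S \<phi>" "fm_vars \<phi> \<subseteq> V" "\<forall>e. P e \<longleftrightarrow> holds S e \<phi>"
    unfolding definable0_def by metis
  obtain n where n: "n \<notin> all_bounds \<phi>"
    using ex_new_if_finite[OF infinite_UNIV_nat finite_all_bounds] by metis
  have "formula S (Ex n (bind_fm v n \<phi>))"
    using \<phi>(1) dangling_bind[of _ v n \<phi>] by (auto simp: formula_def bind_fm_facts)
  moreover have "holds S e (Ex n (bind_fm v n \<phi>)) \<longleftrightarrow> (\<exists>m. P (e(v := m)))" for e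
  proof -
    have "sat S UNIV e' s \<phi> \<longleftrightarrow> P e'" for e' s using sat_any[OF \<phi>(1)] \<phi>(3) by blast
    then show ?thesis using n by (simp add: holds_in_def sat_bind)
  qed
  ultimately show ?thesis
    unfolding definable0_def using \<phi>(2)
    by (intro exI[of _ "Ex n (bind_fm v n \<phi>)"]) (auto simp: bind_fm_facts)
qed

lemma definable0_ex_set:
  assumes "finite D" "definable0 S V P"
  shows "definable0 S (V - D) (\<lambda>e. \<exists>c. (\<forall>l. l \<notin> D \<longrightarrow> c l = e l) \<and> P c)"
  using assms(1)
proof (induction D)
  case empty
  have "(\<exists>c. (\<forall>l. l \<notin> {} \<longrightarrow> c l = e l) \<and> P c) \<longleftrightarrow> P e" for e
    by (auto simp: fun_eq_iff[symmetric])
  then show ?case using assms(2) by simp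
next
  case (insert v D)
  have "(\<exists>m c. (\<forall>l. l \<notin> D \<longrightarrow> c l = (e(v := m)) l) \<and> P c) \<longleftrightarrow>
      (\<exists>c. (\<forall>l. l \<notin> insert v D \<longrightarrow> c l = e l) \<and> P c)" (is "?L \<longleftrightarrow> ?R") for e
  proof
    assume ?L then show ?R by (metis fun_upd_other insertCI)
  next
    assume ?R
    then obtain c where "\<forall>l. l \<notin> insert v D \<longrightarrow> c l = e l" "P c" by blast
    then show ?L using insert.hyps by (intro exI[of _ "c v"] exI[of _ c]) auto
  qed
  moreover have "V - insert v D = V - D - {v}" by auto
  ultimately show ?case using definable0_ex1[OF insert.IH, of v] by presburger
qed

text \<open>Infinitely many variables, those outside \<open>W\<close>, are quantified at once; only
  the finitely many that occur in the formula matter, and these are handled by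
  \<open>definable0_ex_set\<close>.\<close>

lemma definable0_ex:
  assumes "definable0 S V P"
  shows "definable0 S (V \<inter> W) (\<lambda>e. \<exists>c. (\<forall>l\<in>W. c l = e l) \<and> P c)"
proof -
  obtain V0 where V0: "V0 \<subseteq> V" "finite V0" "definable0 S V0 P" using definable0_support[OF assms]
      by blast
  let ?Q = "\<lambda>e. \<exists>c. (\<forall>l. l \<notin> V0 - W \<longrightarrow> c l = e l) \<and> P c"
  have "definable0 S (V0 - (V0 - W)) ?Q" by (rule definable0_ex_set) (use V0 in auto)
  moreover have "?Q e \<longleftrightarrow> (\<exists>c. (\<forall>l\<in>W. c l = e l) \<and> P c)" for e
  proof
    assume "?Q e" then show "\<exists>c. (\<forall>l\<in>W. c l = e l) \<and> P c" by auto
  next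
    assume "\<exists>c. (\<forall>l\<in>W. c l = e l) \<and> P c"
    then obtain c where c: "\<forall>l\<in>W. c l = e l" "P c" by blast
    \<comment> \<open>\<open>c\<close> may differ from \<open>e\<close> anywhere outside
      \<open>W\<close>, while the finite quantification lets only labels in \<open>V0 - W\<close>
      change; \<open>P\<close> does not see the other corrections.\<close>
    let ?c = "\<lambda>l. if l \<in> V0 - W then c l else e l"
    have "P ?c" using definable0_cong[OF V0(3), of c ?c] c by auto
    then show "?Q e" by (intro exI[of _ ?c]) auto
  qed
  ultimately have "definable0 S (V0 \<inter> W) (\<lambda>e. \<exists>c. (\<forall>l\<in>W. c l = e l) \<and> P c)"
    by (simp add: Diff_Diff_Int)
  then show ?thesis using V0(1) unfolding definable0_def by blast
qed

section \<open>Definable predicates on tuples, with parameters\<close>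

definition definable :: "('f, 'r, 'm) struct \<Rightarrow> 'v set \<Rightarrow> 'm set \<Rightarrow> (('v \<Rightarrow> 'm) \<Rightarrow> bool) \<Rightarrow> bool" where
  "definable S V A G \<longleftrightarrow> (\<exists>\<phi>\<in>fms S V A. \<forall>c. G c \<longleftrightarrow> satisfies S c \<phi>)"

lemma definable_iff_definable0: "definable S V A G \<longleftrightarrow> (\<exists>P. definable0 S (V <+> A) P \<and>
    G = (\<lambda>c. P (case_sum c id)))"
  (is "?L \<longleftrightarrow> ?R")
proof
  assume ?L
  then obtain \<phi> where "\<phi> \<in> fms S V A" "\<forall>c. G c \<longleftrightarrow> satisfies S c \<phi>"
    unfolding definable_def by blast
  then show ?R
    unfolding definable0_def fms_def by (intro exI[of _ "\<lambda>e. holds S e \<phi>"]) auto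
next
  assume ?R then show ?L unfolding definable_def definable0_def fms_def by auto
qed

lemma definable_true: "definable S V A (\<lambda>c. True)"
  unfolding definable_iff_definable0 using definable0_true by fastforce

lemma definable_not: "definable S V A G \<Longrightarrow> definable S V A (\<lambda>c. \<not> G c)"
  unfolding definable_iff_definable0 using definable0_not by fastforce

lemma definable_conj: "\<lbrakk>definable S V A G; definable S V A H\<rbrakk> \<Longrightarrow> definable S V A (\<lambda>c. G c \<and> H c)"
  unfolding definable_iff_definable0 using definable0_conj by fastforce

lemma definable_imp: "\<lbrakk>definable S V A G; definable S V A H\<rbrakk> \<Longrightarrow> definable S V A (\<lambda>c. G c \<longrightarrow> H c)"
  using definable_not[OF definable_conj[OF _ definable_not]] by fastforce

lemma definable_ball:
  "\<lbrakk>finite I; \<And>i. i \<in> I \<Longrightarrow> definable S V A (\<lambda>c. G i c)\<rbrakk> \<Longrightarrow> definable S V A (\<lambda>c. \<forall>i\<in>I. G i c)"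
  by (induction I rule: finite_induct) (auto intro: definable_true definable_conj)

lemma definable_bex:
  "\<lbrakk>finite I; \<And>i. i \<in> I \<Longrightarrow> definable S V A (\<lambda>c. G i c)\<rbrakk> \<Longrightarrow> definable S V A (\<lambda>c. \<exists>i\<in>I. G i c)"
  using definable_not[OF definable_ball[of I S V A "\<lambda>i c. \<not> G i c"]] definable_not by fastforce

lemma definable_cong: "\<lbrakk>definable S V A G; \<And>v. v \<in> V \<Longrightarrow> c v = c' v\<rbrakk> \<Longrightarrow> G c \<longleftrightarrow> G c'"
proof -
  assume "definable S V A G" and eq: "\<And>v. v \<in> V \<Longrightarrow> c v = c' v"
  then obtain P where P: "definable0 S (V <+> A) P" "G = (\<lambda>c. P (case_sum c id))"
    unfolding definable_iff_definable0 by blast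
  show "G c \<longleftrightarrow> G c'" unfolding P(2) by (rule definable0_cong[OF P(1)]) (auto simp: eq)
qed

text \<open>The substitutions that introduce no terms: a new entry is one fixed variable or one
  fixed parameter, uniformly in the tuple.\<close>

definition coordinate :: "'v set \<Rightarrow> 'm set \<Rightarrow> (('v \<Rightarrow> 'm) \<Rightarrow> 'm) \<Rightarrow> bool" where
  "coordinate V A f \<longleftrightarrow> (\<exists>v\<in>V. \<forall>c. f c = c v) \<or> (\<exists>m\<in>A. \<forall>c. f c = m)"

lemma coordinate_intros:
  "v \<in> V \<Longrightarrow> coordinate V A (\<lambda>c. c v)"
  "m \<in> A \<Longrightarrow> coordinate V A (\<lambda>c. m)"
  "h w \<in> V \<Longrightarrow> coordinate V A (\<lambda>c. (c \<circ> h) w)"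
  "\<lbrakk>Q \<Longrightarrow> coordinate V A f; \<not> Q \<Longrightarrow> coordinate V A g\<rbrakk> \<Longrightarrow> coordinate V A (\<lambda>c. if Q then f c else g c)"
  by (auto simp: coordinate_def) (cases Q; auto)

text \<open>This covers renaming of variables and replacing variables by parameters.\<close>

lemma definable_subst:
  assumes "definable S W A P" "A \<subseteq> A'"
    and h: "\<And>w. w \<in> W \<Longrightarrow> coordinate V A' (\<lambda>c. h c w)"
  shows "definable S V A' (\<lambda>c. P (h c))"
proof -
  obtain Q where Q: "definable0 S (W <+> A) Q" "P = (\<lambda>c. Q (case_sum c id))"
    using assms(1) unfolding definable_iff_definable0 by blast
  have "\<exists>l\<in>V <+> A'. \<forall>c. h c w = case_sum c id l" if "w \<in> W" for w
    using h[OF that] unfolding coordinate_def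
  proof (elim disjE bexE)
    fix v assume "v \<in> V" "\<forall>c. h c w = c v"
    then show ?thesis by (intro bexI[of _ "Inl v"]) auto
  next
    fix m assume "m \<in> A'" "\<forall>c. h c w = m"
    then show ?thesis by (intro bexI[of _ "Inr m"]) auto
  qed
  then obtain g where g: "\<And>w. w \<in> W \<Longrightarrow> g w \<in> V <+> A' \<and> (\<forall>c. h c w = case_sum c id (g w))"
    by metis
  let ?f = "case_sum g Inr"
  have "definable0 S (V <+> A') (\<lambda>e. Q (e \<circ> ?f))"
    by (rule definable0_map[OF Q(1)]) (use g assms(2) in auto)
  moreover have "P (h c) \<longleftrightarrow> Q (case_sum c id \<circ> ?f)" for c
    unfolding Q(2) by (rule definable0_cong[OF Q(1)]) (use g in auto)
  ultimately show ?thesis unfolding definable_iff_definable0 by auto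
qed

lemma definable_mono: "\<lbrakk>definable S V A G; V \<subseteq> V'; A \<subseteq> A'\<rbrakk> \<Longrightarrow> definable S V' A' G"
  by (rule definable_subst[where h = "\<lambda>c. c"]) (auto intro: coordinate_intros(1))

lemma definable_eq_param: "\<lbrakk>v \<in> V; m \<in> A\<rbrakk> \<Longrightarrow> definable S V A (\<lambda>c. c v = m)"
  unfolding definable_iff_definable0 by (rule exI[of _ "\<lambda>e. e (Inl v) = e
      (Inr m)"]) (auto intro: definable0_eq)

lemma definable_eq: "\<lbrakk>v \<in> V; w \<in> V\<rbrakk> \<Longrightarrow> definable S V A (\<lambda>c. c v = c w)"
  unfolding definable_iff_definable0 by (rule exI[of _ "\<lambda>e. e (Inl v) = e
      (Inl w)"]) (auto intro: definable0_eq)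

lemma definable_ex:
  assumes "definable S (V <+> W) A (\<lambda>e. Q (e \<circ> Inl) (e \<circ> Inr))"
  shows "definable S V A (\<lambda>c. \<exists>z. Q c z)"
proof -
  obtain P where P: "definable0 S ((V <+> W) <+> A) P"
    "(\<lambda>e. Q (e \<circ> Inl) (e \<circ> Inr)) = (\<lambda>c. P (case_sum c id))"
    using assms unfolding definable_iff_definable0 by blast
  let ?W = "range (Inl \<circ> Inl) \<union> range Inr"
  let ?R = "\<lambda>e. \<exists>c. (\<forall>l\<in>?W. c l = e l) \<and> P c"
  have R: "definable0 S (((V <+> W) <+> A) \<inter> ?W) ?R" by (rule definable0_ex[OF P(1)])
  \<comment> \<open>The quantified labels \<open>Inl (Inr w)\<close> lie outside \<open>?W\<close>,
    so their image under the renaming is arbitrary.\<close>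
  let ?f = "\<lambda>l. case l of Inl (Inl v) \<Rightarrow> Inl v | Inl (Inr w) \<Rightarrow> undefined | Inr m \<Rightarrow> Inr m"
  have "definable0 S (V <+> A) (\<lambda>e. ?R (e \<circ> ?f))"
    by (rule definable0_map[OF R]) auto
  moreover have "(\<exists>z. Q c z) \<longleftrightarrow> ?R (case_sum c id \<circ> ?f)" for c
  proof
    assume "\<exists>z. Q c z"
    then obtain z where "Q c z" by blast
    then have "P (case_sum (case_sum c z) id)"
      using fun_cong[OF P(2), of "case_sum c z"] by (simp add: comp_def)
    then show "?R (case_sum c id \<circ> ?f)"
      by (intro exI[of _ "case_sum (case_sum c z) id"]) auto
  next
    assume "?R (case_sum c id \<circ> ?f)"
    then obtain d where d: "\<forall>l\<in>?W. d l = (case_sum c id \<circ> ?f) l" "P d" by blast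
    have "d = case_sum (case_sum c (\<lambda>w. d (Inl (Inr w)))) id"
      using d(1) by (intro ext) (auto simp: image_iff split: sum.split)
    with d(2) have "P (case_sum (case_sum c (\<lambda>w. d (Inl (Inr w)))) id)" by simp
    then show "\<exists>z. Q c z"
      using fun_cong[OF P(2), of "case_sum c (\<lambda>w. d (Inl (Inr w)))"] by (auto simp: comp_def)
  qed
  ultimately show ?thesis unfolding definable_iff_definable0 by auto
qed

lemma definable_all:
  assumes "definable S (V <+> W) A (\<lambda>e. Q (e \<circ> Inl) (e \<circ> Inr))"
  shows "definable S V A (\<lambda>c. \<forall>z. Q c z)"
  using definable_not[OF definable_ex[where Q = "\<lambda>c z. \<not> Q c z", OF definable_not[OF assms]]]
      by simp

lemma definable_support: "definable S V A G \<Longrightarrow> \<exists>V0 A0. V0 \<subseteq> V \<and> A0 \<subseteq> A \<and> finite V0 \<and> finite A0 \<and>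
    definable S V0 A0 G"
proof -
  assume "definable S V A G"
  then obtain P where P: "definable0 S (V <+> A) P" "G = (\<lambda>c. P (case_sum c id))"
    unfolding definable_iff_definable0 by blast
  obtain L where L: "L \<subseteq> V <+> A" "finite L" "definable0 S L P" using definable0_support[OF P(1)]
      by blast
  let ?V = "Inl -` L" and ?A = "Inr -` L"
  have "?V <+> ?A = L" using L(1) by auto
  then have "definable S ?V ?A G" unfolding definable_iff_definable0 using P(2) L(3) by metis
  moreover have "finite ?V" "finite ?A" using L(2) by (auto intro: finite_vimageI)
  moreover have "?V \<subseteq> V" "?A \<subseteq> A" using L(1) by auto
  ultimately show ?thesis by blast
qed

text \<open>Parameters that are entries of a tuple \<open>d\<close> become variables, so that they
  can be quantified or replaced by the entries of another tuple. A parameter that is repeated in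
  \<open>d\<close>, or lies in \<open>A\<close> as well, is given any one of its labels.\<close>

lemma definable_abs:
  fixes d :: "'w \<Rightarrow> 'm" and V :: "'v set"
  assumes "definable S V (A \<union> d ` W) G"
  shows "\<exists>H. definable S (V <+> W) A H \<and> (\<forall>c. G c \<longleftrightarrow> H (case_sum c d))"
proof -
  obtain P where P: "definable0 S (V <+> (A \<union> d ` W)) P" "G = (\<lambda>c. P (case_sum c id))"
    using assms unfolding definable_iff_definable0 by blast
  have "\<forall>m\<in>A \<union> d ` W. \<exists>l. l \<in> (V <+> W) <+> A \<and> (\<forall>c. case_sum (case_sum c d) id l = m)"
  proof
    fix m assume "m \<in> A \<union> d ` W"
    then consider "m \<in> A" | w where "w \<in> W" "m = d w" by blast
    then show "\<exists>l. l \<in> (V <+> W) <+> A \<and> (\<forall>c. case_sum (case_sum c d) id l = m)"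
    proof cases
      case 1 then show ?thesis by (intro exI[of _ "Inr m"]) auto
    next
      case 2 then show ?thesis by (intro exI[of _ "Inl (Inr w)"]) auto
    qed
  qed
  from bchoice[OF this] obtain g where
    g1: "\<And>m. m \<in> A \<union> d ` W \<Longrightarrow> g m \<in> (V <+> W) <+> A"
    and g2: "\<And>m c. m \<in> A \<union> d ` W \<Longrightarrow> case_sum (case_sum c d) id (g m) = m"
    by blast
  let ?f = "case_sum (Inl \<circ> (Inl :: 'v \<Rightarrow> 'v + 'w)) g"
  have *: "definable0 S ((V <+> W) <+> A) (\<lambda>e. P (e \<circ> ?f))"
  proof (rule definable0_map[OF P(1)], rule image_subsetI)
    fix l assume "l \<in> V <+> (A \<union> d ` W)"
    then show "?f l \<in> (V <+> W) <+> A" using g1 by (cases l) auto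
  qed
  have "G c \<longleftrightarrow> P (case_sum (case_sum c d) id \<circ> ?f)" for c
    unfolding P(2)
  proof (rule definable0_cong[OF P(1)])
    fix l assume "l \<in> V <+> (A \<union> d ` W)"
    then show "case_sum c id l = (case_sum (case_sum c d) id \<circ> ?f) l"
      using g2 by (cases l) auto
  qed
  with * show ?thesis
    unfolding definable_iff_definable0 by (intro exI[of _ "\<lambda>e. P (case_sum e id \<circ> ?f)"]) auto
qed

section \<open>Witnesses in an elementary submodel\<close>

lemma elem_witness1:
  fixes v :: 'v and S :: "('f, 'r, 'm) struct"
  assumes M: "elem_submodel M S" and G: "definable S {v} M G" "G c"
  shows "\<exists>m\<in>M. G (\<lambda>_. m)"
proof -
  obtain \<phi> where \<phi>: "formula S \<phi>" "fm_vars \<phi> \<subseteq> {v} <+> M" "\<forall>c. G c \<longleftrightarrow> satisfies S c \<phi>"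
    using G(1) unfolding definable_def fms_def by auto
  obtain n where n: "n \<notin> all_bounds \<phi>"
    using ex_new_if_finite[OF infinite_UNIV_nat finite_all_bounds] by metis
  \<comment> \<open>Elementarity is about formulas whose labels are elements of \<open>M\<close>, so
    the two kinds of labels are merged into one. Once \<open>v\<close> is bound no label
    \<open>Inl\<close> is left, and the value \<open>undefined\<close> has no effect.\<close>
  define g :: "'v + 'm \<Rightarrow> 'm" where "g = case_sum (\<lambda>_. undefined) id"
  let ?\<chi> = "map_fm id id g (Ex n (bind_fm (Inl v) n \<phi>))"
  have f\<chi>: "formula S ?\<chi>"
    using \<phi>(1) dangling_bind[of _ "Inl v" n \<phi>]
    by (simp only: formula_map) (auto simp: formula_def bind_fm_facts)
  have v\<chi>: "fm_vars ?\<chi> \<subseteq> M"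
    using \<phi>(2) by (auto simp: fm.set_map bind_fm_facts g_def)
  have s\<chi>: "holds_in S U id ?\<chi> \<longleftrightarrow> (\<exists>m\<in>U. holds_in S U ((id \<circ> g)(Inl v := m)) \<phi>)" for U
  proof -
    have "sat S U e s \<phi> \<longleftrightarrow> holds_in S U e \<phi>" for e s using sat_any[OF \<phi>(1)] by blast
    moreover have "holds_in S U id ?\<chi> \<longleftrightarrow> sat S U (id \<circ> g) (\<lambda>_. undefined) (Ex n (bind_fm
        (Inl v) n \<phi>))"
      by (subst holds_map) (simp only: holds_in_def)
    ultimately show ?thesis using n by (simp add: sat_bind)
  qed
  \<comment> \<open>The existential statement is transferred down to \<open>M\<close>, where it
    yields a witness; the instance at that witness is transferred back up.\<close>
  have "holds S id ?\<chi>"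
  proof -
    have "holds S (case_sum c id) \<phi> \<longleftrightarrow> holds S ((id \<circ> g)(Inl v := c v)) \<phi>"
    proof (rule holds_cong[OF \<phi>(1)])
      fix l assume "l \<in> fm_vars \<phi>"
      then have "l \<in> {v} <+> M" using \<phi>(2) by blast
      then show "case_sum c id l = ((id \<circ> g)(Inl v := c v)) l" by (auto simp: g_def)
    qed
    then have "holds S ((id \<circ> g)(Inl v := c v)) \<phi>" using G(2) \<phi>(3) by blast
    then show ?thesis unfolding s\<chi> by blast
  qed
  then have "holds_in S M id ?\<chi>" using M f\<chi> v\<chi> unfolding elem_submodel_def by blast
  then obtain m where m: "m \<in> M" "holds_in S M ((id \<circ> g)(Inl v := m)) \<phi>" unfolding s\<chi> by blast
  let ?\<psi> = "map_fm id id (case_sum (\<lambda>_. m) id) \<phi>"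
  have eq: "holds_in S U id ?\<psi> \<longleftrightarrow> holds_in S U ((id \<circ> g)(Inl v := m)) \<phi>" for U
    unfolding holds_map
  proof (rule holds_cong[OF \<phi>(1)])
    fix l assume "l \<in> fm_vars \<phi>"
    then have "l \<in> {v} <+> M" using \<phi>(2) by blast
    then show "(id \<circ> case_sum (\<lambda>_. m) id) l = ((id \<circ> g)(Inl v := m)) l" by (auto simp: g_def)
  qed
  have "formula S ?\<psi>" using \<phi>(1) by (simp only: formula_map)
  moreover have "fm_vars ?\<psi> \<subseteq> M"
    using \<phi>(2) m(1) by (auto simp: fm.set_map)
  moreover have "holds_in S M id ?\<psi>" using m(2) eq by blast
  ultimately have "holds S id ?\<psi>" using M unfolding elem_submodel_def by blast
  then have "G (\<lambda>_. m)" using \<phi>(3) by (simp only: holds_map id_o)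
  with m show ?thesis by blast
qed

text \<open>The variables in the support receive values in \<open>M\<close> one at a time. Values
  already found serve as parameters from \<open>M\<close> and the variables still untreated are
  quantified away, so each step is a problem in one variable.\<close>

lemma elem_witness:
  assumes M: "elem_submodel M S" and G: "definable S V M G" "G c"
  shows "\<exists>c. range c \<subseteq> M \<and> G c"
proof -
  obtain V0 A0 where V0: "V0 \<subseteq> V" "A0 \<subseteq> M" "finite V0" "definable S V0 A0 G"
    using definable_support[OF G(1)] by blast
  have G0: "definable S V0 M G" by (rule definable_mono[OF V0(4) order_refl V0(2)])
  have "D \<subseteq> V0 \<Longrightarrow> \<exists>c. c ` D \<subseteq> M \<and> G c" if "finite D" for D
    using that
  proof (induction D)
    case empty then show ?case using G(2) by blast
  next
    case (insert v D)
    from insert.IH insert.prems obtain d where d: "d ` D \<subseteq> M" "G d" by blast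
    define H where "H x \<longleftrightarrow> (\<exists>z. G (\<lambda>l. if l = v then x v else if l \<in> D then d l else z l))" for x
    have "definable S {v} M H"
      unfolding H_def
    proof (rule definable_ex[where W = UNIV], rule definable_subst[OF G0 order_refl], goal_cases)
      case (1 w)
      then show ?case using d(1) by (intro coordinate_intros) auto
    qed
    moreover have "H d"
    proof -
      have "(\<lambda>l. if l = v then d v else if l \<in> D then d l else d l) = d" by auto
      then show ?thesis unfolding H_def using d(2) by (intro exI[of _ d]) simp
    qed
    ultimately have "\<exists>m\<in>M. H (\<lambda>_. m)" by (rule elem_witness1[OF M])
    then obtain m where m: "m \<in> M" "H (\<lambda>_. m)" by blast
    from m(2) obtain z where z: "G (\<lambda>l. if l = v then m else if l \<in> D then d l else z l)"
        unfolding H_def by blast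
    have "(\<lambda>l. if l = v then m else if l \<in> D then d l else z l) ` insert v D \<subseteq> M"
      using m(1) d(1) by auto
    with z show ?case by blast
  qed
  from this[OF V0(3) order_refl] obtain d where d: "d ` V0 \<subseteq> M" "G d" by blast
  have "M \<noteq> {}" using M unfolding elem_submodel_def by (rule conjunct1)
  then obtain m0 where "m0 \<in> M" by blast
  let ?d = "\<lambda>l. if l \<in> V0 then d l else m0"
  have "G d \<longleftrightarrow> G ?d" by (rule definable_cong[OF V0(4)]) simp
  then have "G ?d" using d(2) by simp
  moreover have "range ?d \<subseteq> M" using d \<open>m0 \<in> M\<close> by auto
  ultimately show ?thesis by blast
qed

section \<open>Equality of types\<close>

definition same_type :: "('f, 'r, 'm) struct \<Rightarrow> 'v set \<Rightarrow> 'm set \<Rightarrow> ('v \<Rightarrow> 'm) \<Rightarrow> ('v \<Rightarrow> 'm) \<Rightarrow> bool" where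
  "same_type S V A c c' \<longleftrightarrow> (\<forall>G. definable S V A G \<longrightarrow> (G c \<longleftrightarrow> G c'))"

lemma same_typeI: "(\<And>G. definable S V A G \<Longrightarrow> G c \<Longrightarrow> G c') \<Longrightarrow> same_type S V A c c'"
  unfolding same_type_def using definable_not by blast

lemma same_typeD: "\<lbrakk>same_type S V A c c'; definable S V A G\<rbrakk> \<Longrightarrow> G c \<longleftrightarrow> G c'"
  unfolding same_type_def by blast

lemma same_type_refl: "same_type S V A c c"
  and same_type_sym: "same_type S V A c c' \<Longrightarrow> same_type S V A c' c"
  and same_type_trans: "\<lbrakk>same_type S V A c c'; same_type S V A c' c''\<rbrakk> \<Longrightarrow> same_type S V A c c''"
  unfolding same_type_def by blast+

text \<open>One rule for passing to subtuples, permuting entries and repeating them; the choice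
  \<open>g\<close> of old labels is the same for both tuples.\<close>

lemma same_type_map:
  assumes "same_type S V A c c'" and "\<And>w. w \<in> W \<Longrightarrow> \<exists>v\<in>V. d w = c v \<and> d' w = c' v"
  shows "same_type S W A d d'"
proof -
  from assms(2) obtain g where g: "\<And>w. w \<in> W \<Longrightarrow> g w \<in> V \<and> d w = c (g w) \<and> d' w = c' (g w)"
    by metis
  show ?thesis
  proof (rule same_typeI)
    fix G assume G: "definable S W A G" "G d"
    have "definable S V A (\<lambda>c. G (\<lambda>w. c (g w)))"
      by (rule definable_subst[OF G(1) order_refl]) (use g in \<open>auto intro: coordinate_intros(1)\<close>)
    from same_typeD[OF assms(1) this] have "G (\<lambda>w. c (g w)) \<longleftrightarrow> G (\<lambda>w. c' (g w))" .
    moreover have "G d \<longleftrightarrow> G (\<lambda>w. c (g w))" by (rule definable_cong[OF G(1)]) (use g in blast)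
    moreover have "G d' \<longleftrightarrow> G (\<lambda>w. c' (g w))" by (rule definable_cong[OF G(1)]) (use g in blast)
    ultimately show "G d'" using G(2) by blast
  qed
qed

lemma same_type_mono: "\<lbrakk>same_type S V A c c'; W \<subseteq> V; B \<subseteq> A\<rbrakk> \<Longrightarrow> same_type S W B c c'"
  unfolding same_type_def using definable_mono by blast

lemma same_type_finite:
  assumes "\<And>V0. \<lbrakk>V0 \<subseteq> V; finite V0\<rbrakk> \<Longrightarrow> same_type S V0 A c c'" shows "same_type S V A c c'"
proof (rule same_typeI)
  fix G assume G: "definable S V A G" "G c"
  obtain V0 A0 where V0: "V0 \<subseteq> V" "A0 \<subseteq> A" "finite V0" "definable S V0 A0 G"
    using definable_support[OF G(1)] by blast
  have "definable S V0 A G" by (rule definable_mono[OF V0(4) order_refl V0(2)])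
  from same_typeD[OF assms[OF V0(1) V0(3)] this] show "G c'" using G(2) by blast
qed

subsection \<open>Ultrafilters\<close>

definition ultrafilter :: "'a set set \<Rightarrow> bool" where
  "ultrafilter U \<longleftrightarrow> {} \<notin> U \<and> (\<forall>X\<in>U. \<forall>Y\<in>U. X \<inter> Y \<in> U) \<and> (\<forall>X. X \<in> U \<or> - X \<in> U)"

text \<open>Otherwise \<open>- Y\<close> would belong to \<open>U\<close>, and it is disjoint from
  \<open>X\<close>.\<close>

lemma ultrafilter_mono: "\<lbrakk>ultrafilter U; X \<in> U; X \<subseteq> Y\<rbrakk> \<Longrightarrow> Y \<in> U"
  unfolding ultrafilter_def by (metis Diff_eq Diff_eq_empty_iff)

lemma ultrafilter_int: "\<lbrakk>ultrafilter U; X \<in> U; Y \<in> U\<rbrakk> \<Longrightarrow> X \<inter> Y \<in> U"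
  unfolding ultrafilter_def by blast

lemma ultrafilter_compl: "ultrafilter U \<Longrightarrow> {x. \<not> P x} \<in> U \<longleftrightarrow> {x. P x} \<notin> U"
  unfolding ultrafilter_def
  by (metis Collect_neg_eq Compl_disjoint)

lemma ultrafilter_UNIV: "ultrafilter U \<Longrightarrow> UNIV \<in> U"
  unfolding ultrafilter_def by (metis Compl_UNIV_eq)

lemma ultrafilter_ex: "\<lbrakk>ultrafilter U; X \<in> U\<rbrakk> \<Longrightarrow> \<exists>x. x \<in> X"
  unfolding ultrafilter_def by (metis ex_in_conv)

lemma ultrafilter_ball:
  assumes "ultrafilter U" "finite I" "\<And>i. i \<in> I \<Longrightarrow> {x. P i x} \<in> U"
  shows "{x. \<forall>i\<in>I. P i x} \<in> U"
  using assms(2,3)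
proof (induction I)
  case empty then show ?case using ultrafilter_UNIV[OF assms(1)] by simp
next
  case (insert i I)
  have "{x. \<forall>i\<in>insert i I. P i x} = {x. P i x} \<inter> {x. \<forall>i\<in>I. P i x}" by auto
  then show ?case using ultrafilter_int[OF assms(1)] insert by simp
qed

text \<open>A maximal filter base above \<open>F\<close>, from Zorn's lemma, absorbs every set that
  meets all its members (\<open>ext\<close>); from this follow closure under intersection and the
  decision between each set and its complement.\<close>

lemma ultrafilter_base:
  assumes F: "{} \<notin> F" "\<And>X Y. \<lbrakk>X \<in> F; Y \<in> F\<rbrakk> \<Longrightarrow> \<exists>Z\<in>F. Z \<subseteq> X \<inter> Y"
  shows "\<exists>U. ultrafilter U \<and> F \<subseteq> U"
proof (cases "F = {}")
  case True
  \<comment> \<open>The extension argument needs a member of the base, so the empty \<open>F\<close>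
    is treated separately, by a principal ultrafilter.\<close>
  have "ultrafilter {X :: 'a set. undefined \<in> X}" unfolding ultrafilter_def by auto
  then show ?thesis using True by blast
next
  case False
  define fil where "fil B \<longleftrightarrow> {} \<notin> B \<and> (\<forall>X\<in>B. \<forall>Y\<in>B. \<exists>Z\<in>B. Z \<subseteq> X \<inter> Y)" for B :: "'a set set"
  have filI: "fil B" if "{} \<notin> B" "\<And>X Y. \<lbrakk>X \<in> B; Y \<in> B\<rbrakk> \<Longrightarrow> \<exists>Z\<in>B. Z \<subseteq> X \<inter> Y" for B
    using that unfolding fil_def by simp
  have fil_ne: "{} \<notin> B" and fil_int: "\<lbrakk>X \<in> B; Y \<in> B\<rbrakk> \<Longrightarrow> \<exists>Z\<in>B. Z \<subseteq> X \<inter> Y" if "fil B" for B X Y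
    using that unfolding fil_def by simp_all
  have filF: "fil F" by (rule filI[OF F])
  define A where "A = {B. F \<subseteq> B \<and> fil B}"
  have "\<exists>B\<in>A. \<forall>B'\<in>A. B \<subseteq> B' \<longrightarrow> B' = B"
  proof (rule subset_Zorn_nonempty)
    show "A \<noteq> {}" using filF unfolding A_def by blast
    fix C assume C: "C \<noteq> {}" "subset.chain A C"
    have CA: "C \<subseteq> A" and Cc: "\<And>X Y. \<lbrakk>X \<in> C; Y \<in> C\<rbrakk> \<Longrightarrow> X \<subseteq> Y \<or> Y \<subseteq> X"
      using C(2) unfolding subset_chain_def by blast+
    have "fil (\<Union>C)"
    proof (rule filI)
      show "{} \<notin> \<Union>C" using CA fil_ne unfolding A_def by blast
      fix X Y assume "X \<in> \<Union>C" "Y \<in> \<Union>C"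
      then obtain B1 B2 where B12: "B1 \<in> C" "X \<in> B1" "B2 \<in> C" "Y \<in> B2" by blast
      obtain B where B: "B \<in> C" "X \<in> B" "Y \<in> B"
      proof (cases "B1 \<subseteq> B2")
        case True then show ?thesis using B12 that[of B2] by blast
      next
        case False then show ?thesis using Cc[OF B12(1,3)] B12 that[of B1] by blast
      qed
      have "fil B" using B(1) CA unfolding A_def by blast
      from fil_int[OF this B(2,3)] show "\<exists>Z\<in>\<Union>C. Z \<subseteq> X \<inter> Y" using B(1) by blast
    qed
    moreover have "F \<subseteq> \<Union>C" using C(1) CA unfolding A_def by blast
    ultimately show "\<Union>C \<in> A" unfolding A_def by blast
  qed
  then obtain B where B: "B \<in> A" and max': "\<forall>B'\<in>A. B \<subseteq> B' \<longrightarrow> B' = B" ..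
  have FB: "F \<subseteq> B" and filB: "fil B" using B unfolding A_def by blast+
  have ext: "Y \<in> B" if Y: "\<And>X. X \<in> B \<Longrightarrow> X \<inter> Y \<noteq> {}" for Y
  proof -
    obtain b0 where b0: "b0 \<in> B" using False FB by blast
    define B' where "B' = B \<union> {X. \<exists>W\<in>B. X = W \<inter> Y} \<union> {Y}"
    have lo: "\<exists>W\<in>B. W \<inter> Y \<subseteq> X" if "X \<in> B'" for X
      using that b0 unfolding B'_def by blast
    have "fil B'"
    proof (rule filI)
      show "{} \<notin> B'"
      proof
        assume "{} \<in> B'"
        then obtain W where "W \<in> B" "W \<inter> Y \<subseteq> {}" using lo by blast
        then show False using Y by blast
      qed
      fix X X' assume "X \<in> B'" "X' \<in> B'"
      then obtain W W' where W: "W \<in> B" "W' \<in> B" "W \<inter> Y \<subseteq> X" "W' \<inter> Y \<subseteq> X'" using lo by meson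
      obtain Z where Z: "Z \<in> B" "Z \<subseteq> W \<inter> W'" using fil_int[OF filB W(1,2)] ..
      have "Z \<inter> Y \<in> B'" using Z(1) unfolding B'_def by blast
      moreover have "Z \<inter> Y \<subseteq> X \<inter> X'" using Z(2) W(3,4) by blast
      ultimately show "\<exists>Z\<in>B'. Z \<subseteq> X \<inter> X'" ..
    qed
    moreover have "B \<subseteq> B'" "Y \<in> B'" unfolding B'_def by blast+
    ultimately have "B' \<in> A" using FB unfolding A_def by simp
    then show ?thesis using max' \<open>B \<subseteq> B'\<close> \<open>Y \<in> B'\<close> by blast
  qed
  have "ultrafilter B" unfolding ultrafilter_def
  proof (intro conjI ballI allI)
    show "{} \<notin> B" by (rule fil_ne[OF filB])
    show "X \<inter> Y \<in> B" if XY: "X \<in> B" "Y \<in> B" for X Y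
    proof (rule ext)
      fix W assume W: "W \<in> B"
      obtain Z where Z: "Z \<in> B" "Z \<subseteq> X \<inter> Y" using fil_int[OF filB XY] ..
      obtain Z' where Z': "Z' \<in> B" "Z' \<subseteq> W \<inter> Z" using fil_int[OF filB W Z(1)] ..
      have "Z' \<noteq> {}" using fil_ne[OF filB] Z'(1) by auto
      then show "W \<inter> (X \<inter> Y) \<noteq> {}" using Z(2) Z'(2) by blast
    qed
    show "X \<in> B \<or> - X \<in> B" for X
    proof (rule ccontr)
      assume c: "\<not> (X \<in> B \<or> - X \<in> B)"
      obtain Y where Y: "Y \<in> B" "Y \<inter> X = {}" using ext[of X] c by blast
      obtain Y' where Y': "Y' \<in> B" "Y' \<inter> - X = {}" using ext[of "- X"] c by blast
      obtain Z where Z: "Z \<in> B" "Z \<subseteq> Y \<inter> Y'" using fil_int[OF filB Y(1) Y'(1)] ..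
      have "Z = {}" using Z(2) Y(2) Y'(2) by blast
      then show False using Z(1) fil_ne[OF filB] by simp
    qed
  qed
  with FB show ?thesis by blast
qed

subsection \<open>Saturation\<close>

locale monster_model =
  fixes \<kappa> :: "'k rel" and S :: "('f, 'r, 'm) struct" and M :: "'m set"
  assumes monster: "monster \<kappa> S" and elemM: "elem_submodel M S" and smallM: "small \<kappa> M"
begin

section \<open>Small sets\<close>

lemma card_facts: "Card_order \<kappa>" "natLeq <o \<kappa>" "\<not> finite (Field \<kappa>)"
proof -
  show k: "Card_order \<kappa>" "natLeq <o \<kappa>" using monster unfolding monster_def by blast+
  have "natLeq \<le>o |Field \<kappa>|"
    using k by (meson card_of_Field_ordIso ordIso_symmetric ordLeq_ordIso_trans ordLess_imp_ordLeq)
  then show "\<not> finite (Field \<kappa>)" using infinite_iff_natLeq_ordLeq by blast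
qed

lemma small_image_le: "small \<kappa> A \<Longrightarrow> B \<subseteq> f ` A \<Longrightarrow> small \<kappa> B"
  unfolding small_def by (meson card_of_image card_of_mono1 ordLeq_ordLess_trans)

lemma small_image: "small \<kappa> A \<Longrightarrow> small \<kappa> (f ` A)"
  by (rule small_image_le) auto

lemma small_subset: "\<lbrakk>small \<kappa> A; B \<subseteq> A\<rbrakk> \<Longrightarrow> small \<kappa> B"
  by (rule small_image_le[where f = id]) auto

lemma small_Un: "\<lbrakk>small \<kappa> A; small \<kappa> B\<rbrakk> \<Longrightarrow> small \<kappa> (A \<union> B)"
  unfolding small_def using card_of_Un_ordLess_infinite_Field card_facts by blast

lemma small_Plus: "\<lbrakk>small \<kappa> A; small \<kappa> B\<rbrakk> \<Longrightarrow> small \<kappa> (A <+> B)"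
  unfolding small_def using card_of_Plus_ordLess_infinite_Field card_facts by blast

lemma small_nat: "small \<kappa> (N :: nat set)"
  unfolding small_def using card_facts(2)
  by (meson card_of_nat card_of_mono1 subset_UNIV ordIso_ordLess_trans ordLeq_ordLess_trans)

lemma small_finite: "finite A \<Longrightarrow> small \<kappa> A"
  unfolding small_def using card_facts
  by (meson finite_iff_ordLess_natLeq ordLess_transitive)

lemma small_nat_Times: "small \<kappa> V \<Longrightarrow> small \<kappa> ((UNIV :: nat set) \<times> V)"
proof (cases "finite V")
  case True
  have "|V| \<le>o |UNIV :: nat set|"
    using True by (intro ordLess_imp_ordLeq finite_ordLess_infinite) (simp_all add: Field_card_of
        card_of_well_order_on)
  then have "|(UNIV :: nat set) \<times> V| \<le>o |UNIV :: nat set|"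
    by (intro card_of_Times_ordLeq_infinite_Field) (auto simp: Field_card_of card_of_card_order_on
        intro: card_of_refl card_of_Card_order ordIso_imp_ordLeq)
  then show ?thesis using small_nat unfolding small_def by (meson ordLeq_ordLess_trans)
next
  case False
  assume V: "small \<kappa> V"
  have "|UNIV :: nat set| \<le>o |V|"
    using False infinite_iff_card_of_nat by blast
  then have "|(UNIV :: nat set) \<times> V| \<le>o |V|"
    using False
    by (intro card_of_Times_ordLeq_infinite_Field) (auto simp: Field_card_of card_of_card_order_on
        intro: card_of_refl card_of_Card_order ordIso_imp_ordLeq)
  then show ?thesis using V unfolding small_def by (meson ordLeq_ordLess_trans)
qed

lemma saturation1:
  fixes \<Gamma> :: "((nat \<Rightarrow> 'm) \<Rightarrow> bool) set"
  assumes A: "small \<kappa> A" and \<Gamma>: "\<And>G. G \<in> \<Gamma> \<Longrightarrow> definable S {0} A G"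
    and fin: "\<And>\<Delta>. \<lbrakk>\<Delta> \<subseteq> \<Gamma>; finite \<Delta>\<rbrakk> \<Longrightarrow> \<exists>c. \<forall>G\<in>\<Delta>. G c"
  shows "\<exists>c. \<forall>G\<in>\<Gamma>. G c"
proof -
  let ?def = "\<lambda>\<phi> G. \<forall>c. G c \<longleftrightarrow> satisfies S c \<phi>"
  let ?\<Gamma> = "{\<phi>\<in>fms S {0} A. \<exists>G\<in>\<Gamma>. ?def \<phi> G}"
  have "consistent S ?\<Gamma>" unfolding consistent_def
  proof (intro allI impI)
    fix \<Delta> assume \<Delta>: "\<Delta> \<subseteq> ?\<Gamma>" "finite \<Delta>"
    then have "\<forall>\<phi>\<in>\<Delta>. \<exists>G. G \<in> \<Gamma> \<and> ?def \<phi> G" by blast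
    from bchoice[OF this] obtain g where g: "\<forall>\<phi>\<in>\<Delta>. g \<phi> \<in> \<Gamma> \<and> ?def \<phi> (g \<phi>)" by blast
    then have "g ` \<Delta> \<subseteq> \<Gamma>" by blast
    from fin[OF this] \<Delta>(2) obtain c where "\<forall>G\<in>g ` \<Delta>. G c" by blast
    then show "\<exists>c. realizes S c \<Delta>" unfolding realizes_def using g by blast
  qed
  moreover have "saturated \<kappa> S" using monster unfolding monster_def by blast
  moreover have "?\<Gamma> \<subseteq> fms S {0} A" by blast
  ultimately obtain c where c: "realizes S c ?\<Gamma>"
    using A unfolding saturated_def by meson
  have "G c" if G: "G \<in> \<Gamma>" for G
  proof -
    obtain \<phi> where "\<phi> \<in> fms S {0} A" "?def \<phi> G" using \<Gamma>[OF G] unfolding definable_def by blast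
    then show ?thesis using c G unfolding realizes_def by blast
  qed
  then show ?thesis by blast
qed

text \<open>Saturation supplies one coordinate at a time. Zorn's lemma yields a maximal graph
  \<open>E\<close> of a partial assignment that stays finitely consistent with
  \<open>\<Gamma>\<close>; its values form a small set, so saturation over them provides one more
  coordinate, and maximality makes \<open>E\<close> total on \<open>V\<close>.\<close>

lemma realize:
  fixes \<Gamma> :: "(('v \<Rightarrow> 'm) \<Rightarrow> bool) set"
  assumes V: "small \<kappa> V" and A: "small \<kappa> A" and \<Gamma>: "\<And>G. G \<in> \<Gamma> \<Longrightarrow> definable S V A G"
    and fin: "\<And>\<Delta>. \<lbrakk>\<Delta> \<subseteq> \<Gamma>; finite \<Delta>\<rbrakk> \<Longrightarrow> \<exists>c. \<forall>G\<in>\<Delta>. G c"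
  shows "\<exists>c. \<forall>G\<in>\<Gamma>. G c"
proof -
  define ok where "ok \<Delta> E c \<longleftrightarrow> (\<forall>G\<in>\<Delta>. G c) \<and> (\<forall>z\<in>E. c (fst z) = snd z)"
    for \<Delta> :: "(('v \<Rightarrow> 'm) \<Rightarrow> bool) set" and E and c :: "'v \<Rightarrow> 'm"
  define fs where "fs E \<longleftrightarrow> (\<forall>\<Delta> E0. \<Delta> \<subseteq> \<Gamma> \<and> finite \<Delta> \<and> E0 \<subseteq> E \<and> finite E0 \<longrightarrow> (\<exists>c. ok \<Delta> E0 c))"
    for E :: "('v \<times> 'm) set"
  define \<Omega> where "\<Omega> = {E. E \<subseteq> V \<times> UNIV \<and> fs E}"
  have "\<exists>E\<in>\<Omega>. \<forall>E'\<in>\<Omega>. E \<subseteq> E' \<longrightarrow> E' = E"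
  proof (rule subset_Zorn_nonempty)
    have "fs {}" unfolding fs_def ok_def using fin by (metis empty_iff subset_empty)
    then show "\<Omega> \<noteq> {}" unfolding \<Omega>_def by blast
    fix \<C> assume C: "\<C> \<noteq> {}" "subset.chain \<Omega> \<C>"
    have "fs (\<Union>\<C>)" unfolding fs_def
    proof (intro allI impI, elim conjE)
      fix \<Delta> E0 assume *: "\<Delta> \<subseteq> \<Gamma>" "finite \<Delta>" "E0 \<subseteq> \<Union>\<C>" "finite E0"
      obtain E where "E \<in> \<C>" "E0 \<subseteq> E"
        using finite_subset_Union_chain[OF *(4) *(3) C] by blast
      moreover from this C(2) have "fs E" unfolding subset_chain_def \<Omega>_def by blast
      ultimately show "\<exists>c. ok \<Delta> E0 c" using * unfolding fs_def by blast
    qed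
    then show "\<Union>\<C> \<in> \<Omega>" using C(2) unfolding subset_chain_def \<Omega>_def by blast
  qed
  then obtain E where "E \<in> \<Omega>" and max': "\<forall>E'\<in>\<Omega>. E \<subseteq> E' \<longrightarrow> E' = E" ..
  then have E: "E \<subseteq> V \<times> UNIV" "fs E" unfolding \<Omega>_def by simp_all
  have max: "E' = E" if "E' \<subseteq> V \<times> UNIV" "fs E'" "E \<subseteq> E'" for E'
    using max' that unfolding \<Omega>_def by simp
  \<comment> \<open>\<open>\<Omega>\<close> does not demand single-valuedness; consistency of the
    two pairs already forces it.\<close>
  have sv: "m = m'" if "(v, m) \<in> E" "(v, m') \<in> E" for v m m'
  proof -
    have "\<exists>c. ok {} {(v, m), (v, m')} c" using E(2) that unfolding fs_def by simp
    then show ?thesis unfolding ok_def by auto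
  qed
  have smE: "small \<kappa> (snd ` E)"
  proof (rule small_image_le[OF V])
    show "snd ` E \<subseteq> (\<lambda>v. THE m. (v, m) \<in> E) ` V"
    proof
      fix m assume "m \<in> snd ` E"
      then obtain v where v: "(v, m) \<in> E" by auto
      then have "(THE m. (v, m) \<in> E) = m" using sv by blast
      then show "m \<in> (\<lambda>v. THE m. (v, m) \<in> E) ` V" using v E(1) by blast
    qed
  qed
  have tot: "\<exists>m. (v, m) \<in> E" if v: "v \<in> V" for v
  proof -
    \<comment> \<open>\<open>x 0\<close> is the candidate for the value at \<open>v\<close>; the
      other coordinates are quantified, and \<open>E0\<close> supplies the values already fixed as
      parameters.\<close>
    define H where "H \<Delta> E0 x \<longleftrightarrow> (\<exists>c. c v = x (0::nat) \<and> ok \<Delta> E0 c)" for \<Delta> E0 x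
    let ?\<Gamma>1 = "{H \<Delta> E0 | \<Delta> E0. \<Delta> \<subseteq> \<Gamma> \<and> finite \<Delta> \<and> E0 \<subseteq> E \<and> finite E0}"
    have "\<exists>x. \<forall>K\<in>?\<Gamma>1. K x"
    proof (rule saturation1[where A = "A \<union> snd ` E"])
      show "small \<kappa> (A \<union> snd ` E)" using A smE by (rule small_Un)
      show "definable S {0} (A \<union> snd ` E) K" if "K \<in> ?\<Gamma>1" for K
      proof -
        from that obtain \<Delta> E0 where K: "K = H \<Delta> E0" and *: "\<Delta> \<subseteq> \<Gamma>" "finite \<Delta>" "E0 \<subseteq> E" "finite E0"
          by blast
        show ?thesis unfolding K H_def ok_def
        proof (rule definable_ex[where W = V], intro definable_conj definable_ball)
          show "definable S ({0} <+> V) (A \<union> snd ` E) (\<lambda>e. (e \<circ> Inr) v = (e \<circ> Inl) 0)"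
            unfolding comp_def by (rule definable_eq) (use v in auto)
          show "definable S ({0} <+> V) (A \<union> snd ` E) (\<lambda>e. G (e \<circ> Inr))" if "G \<in> \<Delta>" for G
          proof (rule definable_subst)
            show "definable S V A G" using \<Gamma> * that by blast
          qed (auto intro!: coordinate_intros)
          show "definable S ({0} <+> V) (A \<union> snd ` E) (\<lambda>e. (e \<circ> Inr) (fst z) = snd z)" if "z \<in> E0"
              for z
            unfolding comp_def by (rule definable_eq_param) (use that * E(1) in auto)
        qed (use * in auto)
      qed
      fix \<D> assume D: "\<D> \<subseteq> ?\<Gamma>1" "finite \<D>"
      then have "\<forall>K\<in>\<D>. \<exists>z. K = H (fst z) (snd z) \<and> fst z \<subseteq> \<Gamma> \<and> finite (fst z) \<and> snd z \<subseteq> E \<and>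
          finite (snd z)"
        by fastforce
      from bchoice[OF this] obtain z where z: "\<And>K. K \<in> \<D> \<Longrightarrow> K = H (fst (z K)) (snd (z K)) \<and>
          fst (z K) \<subseteq> \<Gamma> \<and> finite (fst (z K)) \<and> snd (z K) \<subseteq> E \<and> finite (snd (z K))" by blast
      let ?\<Delta> = "\<Union>K\<in>\<D>. fst (z K)" and ?E = "\<Union>K\<in>\<D>. snd (z K)"
      have "?\<Delta> \<subseteq> \<Gamma>" "finite ?\<Delta>" "?E \<subseteq> E" "finite ?E" using z D(2) by blast+
      then obtain c where c: "ok ?\<Delta> ?E c" using E(2) unfolding fs_def by meson
      have "K (\<lambda>_. c v)" if "K \<in> \<D>" for K
      proof -
        have "ok (fst (z K)) (snd (z K)) c" using c that unfolding ok_def by blast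
        then have "H (fst (z K)) (snd (z K)) (\<lambda>_. c v)" unfolding H_def by blast
        then show ?thesis using z[OF that] by simp
      qed
      then show "\<exists>c. \<forall>G\<in>\<D>. G c" by blast
    qed
    then obtain x where x: "\<And>\<Delta> E0. \<lbrakk>\<Delta> \<subseteq> \<Gamma>; finite \<Delta>; E0 \<subseteq> E; finite E0\<rbrakk> \<Longrightarrow> H \<Delta> E0 x" by blast
    have "fs (insert (v, x 0) E)" unfolding fs_def
    proof (intro allI impI, elim conjE)
      fix \<Delta> E0 assume *: "\<Delta> \<subseteq> \<Gamma>" "finite \<Delta>" "E0 \<subseteq> insert (v, x 0) E" "finite E0"
      have "H \<Delta> (E0 - {(v, x 0)}) x" using * by (intro x) auto
      then obtain c where c: "c v = x 0" "ok \<Delta> (E0 - {(v, x 0)}) c" unfolding H_def by blast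
      have "c (fst z) = snd z" if "z \<in> E0" for z
        using c that unfolding ok_def by (cases "z = (v, x 0)") simp_all
      then have "ok \<Delta> E0 c" using c(2) unfolding ok_def by simp
      then show "\<exists>c. ok \<Delta> E0 c" by (intro exI[of _ c])
    qed
    then have "insert (v, x 0) E = E" using E(1) v by (intro max) auto
    then show ?thesis by blast
  qed
  define c where "c v = (THE m. (v, m) \<in> E)" for v
  have c: "(v, c v) \<in> E" if "v \<in> V" for v
    unfolding c_def using tot[OF that] sv by (metis the_equality)
  have "G c" if G: "G \<in> \<Gamma>" for G
  proof -
    obtain V0 A0 where V0: "V0 \<subseteq> V" "finite V0" "definable S V0 A0 G"
      using definable_support[OF \<Gamma>[OF G]] by blast
    have "(\<lambda>v. (v, c v)) ` V0 \<subseteq> E" using c V0(1) by blast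
    then obtain d where d: "ok {G} ((\<lambda>v. (v, c v)) ` V0) d"
      using E(2) G V0(2) unfolding fs_def
          by (metis empty_subsetI finite.emptyI finite.insertI finite_imageI insert_subset)
    have "G c \<longleftrightarrow> G d" by (rule definable_cong[OF V0(3)]) (use d in \<open>auto simp: ok_def\<close>)
    then show ?thesis using d unfolding ok_def by simp
  qed
  then show ?thesis by blast
qed

lemma realize_indexed:
  assumes V: "small \<kappa> V" and A: "small \<kappa> A" and G: "\<And>i. i \<in> I \<Longrightarrow> definable S V A (G i)"
    and fin: "\<And>J. \<lbrakk>J \<subseteq> I; finite J\<rbrakk> \<Longrightarrow> \<exists>c. \<forall>i\<in>J. G i c"
  shows "\<exists>c. \<forall>i\<in>I. G i c"
proof -
  have "\<exists>c. \<forall>H\<in>G ` I. H c"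
  proof (rule realize[OF V A])
    show "definable S V A H" if "H \<in> G ` I" for H using that G by blast
    fix \<Delta> assume "\<Delta> \<subseteq> G ` I" "finite \<Delta>"
    then obtain J where J: "J \<subseteq> I" "finite J" "\<Delta> = G ` J" using finite_subset_image by metis
    obtain c where "\<forall>i\<in>J. G i c" using fin[OF J(1,2)] by (rule exE)
    then have "\<forall>H\<in>\<Delta>. H c" unfolding J(3) by simp
    then show "\<exists>c. \<forall>H\<in>\<Delta>. H c" by (intro exI[of _ c])
  qed
  then show ?thesis by simp
qed

text \<open>No automorphism is used: the type of \<open>w\<close> over \<open>u\<close> is rewritten
  with \<open>u'\<close> in place of \<open>u\<close> and realized. A finite part of it is
  consistent since its existential closure \<open>Q\<close> is a property of \<open>u\<close> over
  \<open>A\<close>.\<close>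

lemma homogeneous:
  assumes sm: "small \<kappa> V" "small \<kappa> W" "small \<kappa> A" and eq: "same_type S V A u u'"
  shows "\<exists>w'. same_type S (V <+> W) A (case_sum u w) (case_sum u' w')"
proof -
  define I where "I = {G. definable S (V <+> W) A G \<and> G (case_sum u w)}"
  have "\<exists>z. \<forall>G\<in>I. G (case_sum u' z)"
  proof (rule realize_indexed[OF sm(2)])
    show "small \<kappa> (A \<union> u' ` V)" using sm by (intro small_Un small_image)
    show "definable S W (A \<union> u' ` V) (\<lambda>z. G (case_sum u' z))" if "G \<in> I" for G
    proof (rule definable_subst)
      show "definable S (V <+> W) A G" using that unfolding I_def by simp
    qed (auto intro!: coordinate_intros)
    fix J assume J: "J \<subseteq> I" "finite J"
    define Q where "Q x \<longleftrightarrow> (\<exists>z. \<forall>G\<in>J. G (case_sum x z))" for x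
    have "definable S V A Q"
      unfolding Q_def
    proof (rule definable_ex[where W = W], intro definable_ball J(2))
      fix G assume "G \<in> J"
      then have "definable S (V <+> W) A G" using J(1) unfolding I_def by blast
      then show "definable S (V <+> W) A (\<lambda>e. G (case_sum (e \<circ> Inl) (e \<circ> Inr)))"
        by (rule definable_subst) (auto intro!: coordinate_intros)
    qed
    moreover have "Q u" unfolding Q_def using J(1) unfolding I_def by blast
    ultimately have "Q u'" using same_typeD[OF eq, of Q] by simp
    then show "\<exists>z. \<forall>G\<in>J. G (case_sum u' z)" unfolding Q_def .
  qed
  then obtain z where z: "\<And>G. G \<in> I \<Longrightarrow> G (case_sum u' z)" by auto
  have "same_type S (V <+> W) A (case_sum u w) (case_sum u' z)"
    by (rule same_typeI, rule z) (simp add: I_def)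
  then show ?thesis by (intro exI[of _ z])
qed

end

subsection \<open>Types finitely satisfiable over a model, as ultrafilters\<close>

text \<open>An ultrafilter \<open>U\<close> on tuples stands for the global type of all formulas whose set of
  realizations belongs to \<open>U\<close>; finite satisfiability in \<open>M\<close> means that \<open>U\<close> can be chosen to
  concentrate on tuples from \<open>M\<close>.\<close>

definition coheir :: "'m set \<Rightarrow> ('v \<Rightarrow> 'm) set set \<Rightarrow> bool" where
  "coheir M U \<longleftrightarrow> ultrafilter U \<and> {c. range c \<subseteq> M} \<in> U"

definition realizes_uf :: "('f, 'r, 'm) struct \<Rightarrow> 'v set \<Rightarrow> ('v \<Rightarrow> 'm) set set \<Rightarrow> 'm set \<Rightarrow>
    ('v \<Rightarrow> 'm) \<Rightarrow> bool" where
  "realizes_uf S V U A c \<longleftrightarrow> (\<forall>G. definable S V A G \<longrightarrow> {x. G x} \<in> U \<longrightarrow> G c)"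

definition morley_uf ::
  "('f, 'r, 'm) struct \<Rightarrow> 'v set \<Rightarrow> ('v \<Rightarrow> 'm) set set \<Rightarrow> 'm set \<Rightarrow> (nat \<Rightarrow> 'v \<Rightarrow> 'm) \<Rightarrow> bool" where
  "morley_uf S V U A c \<longleftrightarrow> (\<forall>i. realizes_uf S V U (A \<union> (\<Union>j<i. c j ` V)) (c i))"

text \<open>The image of \<open>U\<close> under composition with \<open>h\<close>: the type of the
  subtuple that \<open>h\<close> selects, with repetitions allowed.\<close>

definition pushforward :: "('w \<Rightarrow> 'v) \<Rightarrow> ('v \<Rightarrow> 'm) set set \<Rightarrow> ('w \<Rightarrow> 'm) set set" where
  "pushforward h U = {X. {e. e \<circ> h \<in> X} \<in> U}"

definition ultra_type :: "('f, 'r, 'm) struct \<Rightarrow> 'v set \<Rightarrow> ('v \<Rightarrow> 'm) set set \<Rightarrow>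
    ('f, 'r, 'v + 'm) fm set" where
  "ultra_type S V U = {\<phi>\<in>fms S V UNIV. {c. satisfies S c \<phi>} \<in> U}"

section \<open>Realizations and Morley sequences of ultrafilters\<close>

lemma coheir_ultra: "coheir M U \<Longrightarrow> ultrafilter U"
  unfolding coheir_def by simp

lemma realizes_ufD: "\<lbrakk>realizes_uf S V U A c; definable S V A G; {x. G x} \<in> U\<rbrakk> \<Longrightarrow> G c"
  unfolding realizes_uf_def by blast

lemma realizes_uf_iff: "\<lbrakk>ultrafilter U; realizes_uf S V U A c; definable S V A G\<rbrakk> \<Longrightarrow> G c \<longleftrightarrow>
    {x. G x} \<in> U"
proof -
  assume U: "ultrafilter U" and c: "realizes_uf S V U A c" and G: "definable S V A G"
  have "G c" if "{x. G x} \<in> U" by (rule realizes_ufD[OF c G that])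
  moreover have "\<not> G c" if "{x. G x} \<notin> U"
    using realizes_ufD[OF c definable_not[OF G]] that ultrafilter_compl[OF U, of G] by blast
  ultimately show ?thesis by blast
qed

lemma realizes_uf_mono: "\<lbrakk>realizes_uf S V U A c; W \<subseteq> V; B \<subseteq> A\<rbrakk> \<Longrightarrow> realizes_uf S W U B c"
  unfolding realizes_uf_def using definable_mono by blast

lemma realizes_uf_push:
  assumes "realizes_uf S V U A c" "h ` W \<subseteq> V" shows "realizes_uf S W (pushforward h U) A (c \<circ> h)"
  unfolding realizes_uf_def
proof (intro allI impI)
  fix G assume G: "definable S W A G" "{x. G x} \<in> pushforward h U"
  have "definable S V A (\<lambda>e. G (e \<circ> h))"
    by (rule definable_subst[OF G(1) order_refl]) (use assms(2) in \<open>auto intro!: coordinate_intros\<close>)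
  from realizes_ufD[OF assms(1) this] show "G (c \<circ> h)" using G(2) unfolding pushforward_def by simp
qed

lemma ultra_push:
  fixes h :: "'w \<Rightarrow> 'v" and U :: "('v \<Rightarrow> 'm) set set"
  assumes U: "ultrafilter U" shows "ultrafilter (pushforward h U)"
proof -
  have "{e. e \<circ> h \<in> X \<inter> Y} = {e. e \<circ> h \<in> X} \<inter> {e. e \<circ> h \<in> Y}"
    and "{e. e \<circ> h \<in> - X} = - {e. e \<circ> h \<in> X}" for X Y :: "('w \<Rightarrow> 'm) set"
    by auto
  then show ?thesis using U unfolding ultrafilter_def pushforward_def by simp
qed

lemma coheir_push: "coheir M U \<Longrightarrow> coheir M (pushforward h U)"
  unfolding coheir_def
proof (intro conjI ultra_push; elim conjE)
  assume U: "ultrafilter U" "{c. range c \<subseteq> M} \<in> U"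
  have "{c. range c \<subseteq> M} \<subseteq> {e. e \<circ> h \<in> {c. range c \<subseteq> M}}" by auto
  from ultrafilter_mono[OF U this] show "{c. range c \<subseteq> M} \<in> pushforward h U"
      unfolding pushforward_def by simp
qed

lemma morley_uf_mono: "\<lbrakk>morley_uf S V U A c; B \<subseteq> A\<rbrakk> \<Longrightarrow> morley_uf S V U B c"
  unfolding morley_uf_def by (meson Un_mono order_refl realizes_uf_mono)

lemma morley_uf_subseq:
  assumes "morley_uf S V U A c" "strict_mono f" shows "morley_uf S V U A (\<lambda>i. c (f i))"
  unfolding morley_uf_def
proof
  fix i
  have "realizes_uf S V U (A \<union> (\<Union>j<f i. c j ` V)) (c (f i))" using assms(1)
      unfolding morley_uf_def by simp
  moreover have "(\<Union>j<i. c (f j) ` V) \<subseteq> (\<Union>j<f i. c j ` V)"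
    using strict_monoD[OF assms(2)] by blast
  ultimately show "realizes_uf S V U (A \<union> (\<Union>j<i. c (f j) ` V)) (c (f i))"
    by (elim realizes_uf_mono) auto
qed

lemma morley_uf_push:
  assumes "morley_uf S V U A c" "h ` W \<subseteq> V" shows "morley_uf S W (pushforward h U) A (\<lambda>i. c i \<circ> h)"
  unfolding morley_uf_def
proof
  fix i
  have "realizes_uf S V U (A \<union> (\<Union>j<i. c j ` V)) (c i)" using assms(1) unfolding morley_uf_def
      by simp
  then have "realizes_uf S V U (A \<union> (\<Union>j<i. (c j \<circ> h) ` W)) (c i)"
    by (rule realizes_uf_mono) (use assms(2) in auto)
  from realizes_uf_push[OF this assms(2)]
  show "realizes_uf S W (pushforward h U) (A \<union> (\<Union>j<i. (c j \<circ> h) ` W)) (c i \<circ> h)" .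
qed

section \<open>Correspondence between formulas, types and ultrafilters\<close>

lemma definable_holds: "\<phi> \<in> fms S V W \<Longrightarrow> definable S (V <+> W) A (\<lambda>e. holds S e \<phi>)"
proof -
  assume "\<phi> \<in> fms S V W"
  then have "definable0 S (V <+> W) (\<lambda>e. holds S e \<phi>)" unfolding definable0_def fms_def by auto
  then have "definable0 S ((V <+> W) <+> A) (\<lambda>e. holds S (e \<circ> Inl) \<phi>)" by (rule definable0_map) auto
  then show ?thesis
    unfolding definable_iff_definable0 by (rule exI[of _ "\<lambda>e. holds S
        (e \<circ> Inl) \<phi>", OF conjI]) (simp add: comp_def)
qed

lemma definable_satisfies: "\<phi> \<in> fms S V A \<Longrightarrow> definable S V A (\<lambda>c. satisfies S c \<phi>)"
  unfolding definable_def by blast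

lemma satisfies_inst: "satisfies S c (inst \<phi> b) \<longleftrightarrow> holds S (case_sum c b) \<phi>"
proof -
  have "case_sum c id \<circ> map_sum id b = case_sum c b" by (auto simp: fun_eq_iff split: sum.split)
  then show ?thesis unfolding inst_def holds_map by simp
qed

lemma inst_fms: "\<phi> \<in> fms S V W \<Longrightarrow> b ` W \<subseteq> A \<Longrightarrow> inst \<phi> b \<in> fms S V A"
proof -
  assume \<phi>: "\<phi> \<in> fms S V W" and b: "b ` W \<subseteq> A"
  have "map_sum id b l \<in> V <+> A" if "l \<in> V <+> W" for l using that b by auto
  then show ?thesis using \<phi> unfolding fms_def inst_def by (auto simp: formula_map fm.set_map)
qed

lemma same_type_tp: "tp S V b A = tp S V b' A \<longleftrightarrow> same_type S V A b b'"
proof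
  assume eq: "tp S V b A = tp S V b' A"
  show "same_type S V A b b'"
  proof (rule same_typeI)
    fix G assume "definable S V A G" "G b"
    then obtain \<phi> where \<phi>: "\<phi> \<in> fms S V A" "\<forall>c. G c \<longleftrightarrow> satisfies S c \<phi>" unfolding definable_def
        by blast
    then have "\<phi> \<in> tp S V b A" using \<open>G b\<close> unfolding tp_def by simp
    then have "\<phi> \<in> tp S V b' A" using eq by simp
    then show "G b'" using \<phi>(2) unfolding tp_def by simp
  qed
next
  assume "same_type S V A b b'"
  then show "tp S V b A = tp S V b' A" unfolding tp_def using same_typeD definable_satisfies
      by blast
qed

lemma restr_eq:
  fixes p :: "('f, 'r, 'v + 'm) fm set"
  assumes "p \<subseteq> fms S V UNIV" shows "restr p A = {\<phi>\<in>fms S V A. \<phi> \<in> p}"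
proof -
  have "fm_vars \<phi> \<subseteq> V <+> A \<longleftrightarrow> fm_vars \<phi> \<subseteq> V <+> UNIV \<and> params \<phi> \<subseteq> A" for \<phi> :: "('f, 'r, 'v + 'm) fm"
  proof
    assume "fm_vars \<phi> \<subseteq> V <+> A" then show "fm_vars \<phi> \<subseteq> V <+> UNIV \<and> params \<phi> \<subseteq> A"
      unfolding params_def by auto
  next
    assume *: "fm_vars \<phi> \<subseteq> V <+> UNIV \<and> params \<phi> \<subseteq> A"
    show "fm_vars \<phi> \<subseteq> V <+> A"
    proof
      fix l assume "l \<in> fm_vars \<phi>" with * show "l \<in> V <+> A"
        unfolding params_def by (cases l) auto
    qed
  qed
  then show ?thesis using assms unfolding restr_def fms_def by auto
qed

lemma realizes_restr:
  assumes p: "p \<subseteq> fms S V UNIV" and U: "\<And>\<phi>. \<phi> \<in> fms S V UNIV \<Longrightarrow> \<phi> \<in> p \<longleftrightarrow> {c. satisfies S c \<phi>} \<in> U"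
  shows "realizes S c (restr p A) \<longleftrightarrow> realizes_uf S V U A c"
proof -
  have sub: "fms S V A \<subseteq> fms S V UNIV" unfolding fms_def by auto
  have eq: "{c. G c} = {c. satisfies S c \<phi>}" if "\<forall>c. G c \<longleftrightarrow> satisfies S c \<phi>" for G \<phi>
    using that by simp
  show ?thesis
  proof
    assume c: "realizes S c (restr p A)"
    show "realizes_uf S V U A c" unfolding realizes_uf_def
    proof (intro allI impI)
      fix G assume "definable S V A G" "{x. G x} \<in> U"
      then obtain \<phi> where \<phi>: "\<phi> \<in> fms S V A" "\<forall>c. G c \<longleftrightarrow> satisfies S c \<phi>" unfolding definable_def
          by blast
      then have "\<phi> \<in> p" using U[of \<phi>] sub \<open>{x. G x} \<in> U\<close> by auto
      then have "satisfies S c \<phi>" using c \<phi>(1) unfolding realizes_def restr_eq[OF p] by simp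
      then show "G c" using \<phi>(2) by simp
    qed
  next
    assume c: "realizes_uf S V U A c"
    show "realizes S c (restr p A)" unfolding realizes_def restr_eq[OF p]
    proof
      fix \<phi> assume "\<phi> \<in> {\<phi>\<in>fms S V A. \<phi> \<in> p}"
      then have \<phi>: "\<phi> \<in> fms S V A" "{c. satisfies S c \<phi>} \<in> U" using U[of \<phi>] sub by auto
      show "satisfies S c \<phi>" by (rule realizes_ufD[OF c definable_satisfies[OF \<phi>(1)] \<phi>(2)])
    qed
  qed
qed

lemma morley_seq_morley_uf:
  assumes "p \<subseteq> fms S V UNIV" "\<And>\<phi>. \<phi> \<in> fms S V UNIV \<Longrightarrow> \<phi> \<in> p \<longleftrightarrow> {c. satisfies S c \<phi>} \<in> U"
  shows "morley_seq S V p A c \<longleftrightarrow> morley_uf S V U A c"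
  unfolding morley_seq_def morley_uf_def using realizes_restr[OF assms] by simp

text \<open>The solution sets in \<open>M\<close> of the formulas in \<open>p\<close> form a filter
  base: finite satisfiability makes them nonempty, completeness and consistency make
  \<open>p\<close> closed under conjunction. By completeness, an ultrafilter containing them
  determines exactly \<open>p\<close>.\<close>

lemma type_ultra:
  fixes S :: "('f, 'r, 'm) struct" and p :: "('f, 'r, 'v + 'm) fm set"
  assumes p: "global_type S V p" "fin_sat_over S M p"
  shows "\<exists>U. coheir M U \<and> (\<forall>\<phi>\<in>fms S V UNIV. \<phi> \<in> p \<longleftrightarrow> {c. satisfies S c \<phi>} \<in> U)"
proof -
  have sub: "p \<subseteq> fms S V UNIV" and cons: "consistent S p"
    and compl: "\<And>\<phi>. \<phi> \<in> fms S V UNIV \<Longrightarrow> \<phi> \<in> p \<or> Neg \<phi> \<in> p"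
    using p(1) unfolding complete_type_def by blast+
  have conj: "Conj \<phi> \<psi> \<in> p" if "\<phi> \<in> p" "\<psi> \<in> p" for \<phi> \<psi>
  proof (rule ccontr)
    assume "Conj \<phi> \<psi> \<notin> p"
    moreover have "Conj \<phi> \<psi> \<in> fms S V UNIV" using that sub unfolding fms_def formula_def by auto
    ultimately have "Neg (Conj \<phi> \<psi>) \<in> p" using compl by blast
    then have "{\<phi>, \<psi>, Neg (Conj \<phi> \<psi>)} \<subseteq> p" "finite {\<phi>, \<psi>, Neg (Conj \<phi> \<psi>)}" using that by simp_all
    then obtain c where "realizes S c {\<phi>, \<psi>, Neg (Conj \<phi> \<psi>)}"
      using cons unfolding consistent_def by meson
    then show False unfolding realizes_def holds_in_def by auto
  qed
  define K where "K \<phi> = {c. range c \<subseteq> M \<and> satisfies S c \<phi>}" for \<phi> :: "('f, 'r, 'v + 'm) fm"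
  have "\<exists>U. ultrafilter U \<and> K ` p \<subseteq> U"
  proof (rule ultrafilter_base)
    show "{} \<notin> K ` p" using p(2) unfolding fin_sat_over_def K_def by blast
    fix X Y assume "X \<in> K ` p" "Y \<in> K ` p"
    then obtain \<phi> \<psi> where *: "\<phi> \<in> p" "\<psi> \<in> p" "X = K \<phi>" "Y = K \<psi>" by blast
    have "K (Conj \<phi> \<psi>) \<subseteq> X \<inter> Y" unfolding * K_def holds_in_def by auto
    then show "\<exists>Z\<in>K ` p. Z \<subseteq> X \<inter> Y" using conj[OF *(1,2)] by blast
  qed
  then obtain U where U: "ultrafilter U" "K ` p \<subseteq> U" by blast
  have in_U: "{c. satisfies S c \<phi>} \<in> U" if "\<phi> \<in> p" for \<phi>
    by (rule ultrafilter_mono[OF U(1), of "K \<phi>"]) (use that U(2) in \<open>auto simp: K_def\<close>)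
  \<comment> \<open>Some formula belongs to \<open>p\<close>, and this puts the set of tuples from
    \<open>M\<close> into \<open>U\<close>.\<close>
  obtain \<phi>0 where "\<phi>0 \<in> fms S V (UNIV :: 'm set)"
    using definable_true[of S V UNIV] unfolding definable_def by blast
  then obtain \<phi> where "\<phi> \<in> p" using compl by blast
  then have "K \<phi> \<in> U" using U(2) by blast
  moreover have "K \<phi> \<subseteq> {c. range c \<subseteq> M}" unfolding K_def by blast
  ultimately have "{c. range c \<subseteq> M} \<in> U" by (rule ultrafilter_mono[OF U(1)])
  moreover have "\<phi> \<in> p \<longleftrightarrow> {c. satisfies S c \<phi>} \<in> U" if "\<phi> \<in> fms S V UNIV" for \<phi>
  proof
    assume "{c. satisfies S c \<phi>} \<in> U"
    moreover have "{c. \<not> satisfies S c \<phi>} \<in> U" if "Neg \<phi> \<in> p"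
      using in_U[OF that] unfolding holds_in_def by simp
    ultimately show "\<phi> \<in> p" using compl[OF that] ultrafilter_compl[OF U(1), of "\<lambda>c. satisfies S c
        \<phi>"] by blast
  qed (rule in_U)
  ultimately show ?thesis using U(1) unfolding coheir_def by blast
qed

lemma ultra_type_global:
  fixes S :: "('f, 'r, 'm) struct" and U :: "('v \<Rightarrow> 'm) set set"
  assumes U: "ultrafilter U" shows "global_type S V (ultra_type S V U)"
  unfolding complete_type_def
proof (intro conjI ballI)
  show "ultra_type S V U \<subseteq> fms S V UNIV" unfolding ultra_type_def by blast
  show "consistent S (ultra_type S V U)" unfolding consistent_def
  proof (intro allI impI)
    fix \<Delta> assume \<Delta>: "\<Delta> \<subseteq> ultra_type S V U" "finite \<Delta>"
    have "{c. \<forall>\<phi>\<in>\<Delta>. satisfies S c \<phi>} \<in> U"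
      by (rule ultrafilter_ball[OF U \<Delta>(2)]) (use \<Delta>(1) in \<open>auto simp: ultra_type_def\<close>)
    from ultrafilter_ex[OF U this] show "\<exists>c. realizes S c \<Delta>" unfolding realizes_def by simp
  qed
  fix \<phi> :: "('f, 'r, 'v + 'm) fm" assume \<phi>: "\<phi> \<in> fms S V UNIV"
  then have "Neg \<phi> \<in> fms S V UNIV" unfolding fms_def formula_def by simp
  moreover have "{c. satisfies S c (Neg \<phi>)} = {c. \<not> satisfies S c \<phi>}" unfolding holds_in_def by simp
  ultimately show "\<phi> \<in> ultra_type S V U \<or> Neg \<phi> \<in> ultra_type S V U"
    using \<phi> ultrafilter_compl[OF U, of "\<lambda>c. satisfies S c \<phi>"] unfolding ultra_type_def by auto
qed

text \<open>\<open>U\<close> sees only tuples \<open>x\<close> from \<open>M\<close>, and for such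
  an \<open>x\<close> the condition \<open>P\<close> on \<open>w\<close> is a formula over
  \<open>M\<close>, which \<open>w\<close> and \<open>w'\<close> satisfy alike.\<close>

lemma coheir_invariant:
  assumes U: "coheir M U" and P: "definable S (V <+> W) M P" and eq: "same_type S W M w w'"
  shows "{x. P (case_sum x w)} \<in> U \<longleftrightarrow> {x. P (case_sum x w')} \<in> U"
proof -
  have *: "{x. P (case_sum x v')} \<in> U" if "{x. P (case_sum x v)} \<in> U" "same_type S W M v v'"
      for v v'
  proof -
    have "P (case_sum x v')" if x: "range x \<subseteq> M" "P (case_sum x v)" for x
    proof -
      have "definable S W M (\<lambda>w. P (case_sum x w))"
        by (rule definable_subst[OF P order_refl]) (use x(1) in \<open>auto simp: image_subset_iff
            intro!: coordinate_intros\<close>)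
      from same_typeD[OF \<open>same_type S W M v v'\<close> this] show ?thesis using x(2) by simp
    qed
    then have "{x. P (case_sum x v)} \<inter> {x. range x \<subseteq> M} \<subseteq> {x. P (case_sum x v')}" by blast
    moreover have "{x. P (case_sum x v)} \<inter> {x. range x \<subseteq> M} \<in> U"
      using that(1) U ultrafilter_int unfolding coheir_def by blast
    ultimately show ?thesis using ultrafilter_mono[OF coheir_ultra[OF U]] by blast
  qed
  show ?thesis using *[OF _ eq] *[OF _ same_type_sym[OF eq]] by blast
qed

lemma ultra_type_invariant:
  fixes S :: "('f, 'r, 'm) struct" and U :: "('v \<Rightarrow> 'm) set set"
  assumes U: "coheir M U" shows "invariant_type S V M (ultra_type S V U)"
  unfolding invariant_type_def
proof (intro allI ballI impI, elim conjE)
  fix n :: nat and \<phi> :: "('f, 'r, 'v + nat) fm" and b b' :: "nat \<Rightarrow> 'm"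
  assume \<phi>: "\<phi> \<in> fms S V {..<n}" and b: "inst \<phi> b \<in> ultra_type S V U"
    and "tp S {..<n} b' M = tp S {..<n} b M"
  then have eq: "same_type S {..<n} M b b'" using same_type_tp same_type_sym by metis
  have sat: "{c. satisfies S c (inst \<phi> d)} = {x. holds S (case_sum x d) \<phi>}" for d
    by (rule Collect_cong) (rule satisfies_inst)
  have "{c. satisfies S c (inst \<phi> b)} \<in> U" using b unfolding ultra_type_def by simp
  then have "{c. satisfies S c (inst \<phi> b')} \<in> U"
    unfolding sat using coheir_invariant[OF U definable_holds[OF \<phi>] eq] by simp
  moreover have "inst \<phi> b' \<in> fms S V UNIV" by (rule inst_fms[OF \<phi>]) simp
  ultimately show "inst \<phi> b' \<in> ultra_type S V U" unfolding ultra_type_def by simp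
qed

text \<open>The bridge to Kim- and Conant-dividing: all invariant Morley sequences that the argument
  constructs come from coheirs.\<close>

lemma morley_uf_invariant_morley_seq:
  assumes U: "coheir M U" and c: "morley_uf S V U M c"
  shows "invariant_morley_seq S V M c"
  unfolding invariant_morley_seq_def
proof (intro exI conjI)
  show "global_type S V (ultra_type S V U)" by (rule ultra_type_global[OF coheir_ultra[OF U]])
  show "invariant_type S V M (ultra_type S V U)" by (rule ultra_type_invariant[OF U])
  have "morley_seq S V (ultra_type S V U) M c \<longleftrightarrow> morley_uf S V U M c"
    by (rule morley_seq_morley_uf) (simp_all add: ultra_type_def)
  then show "morley_seq S V (ultra_type S V U) M c" using c by simp
qed

section \<open>Uniqueness of the type of a Morley sequence\<close>

lemma realizes_uf_same_type:
  assumes U: "coheir M U" and eq: "same_type S W M w w'"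
    and c: "realizes_uf S V U (M \<union> w ` W) c" and c': "realizes_uf S V U (M \<union> w' ` W) c'"
  shows "same_type S (W <+> V) M (case_sum w c) (case_sum w' c')"
proof (rule same_typeI)
  fix G assume G: "definable S (W <+> V) M G" "G (case_sum w c)"
  have p: "definable S V (M \<union> v ` W) (\<lambda>x. G (case_sum v x))" for v
    by (rule definable_subst[OF G(1)]) (auto intro!: coordinate_intros)
  have P: "definable S (V <+> W) M (\<lambda>e. G (case_sum (e \<circ> Inr) (e \<circ> Inl)))"
    by (rule definable_subst[OF G(1)]) (auto intro!: coordinate_intros)
  have "{x. G (case_sum w x)} \<in> U"
    using realizes_uf_iff[OF coheir_ultra[OF U] c p] G(2) by simp
  then have "{x. G (case_sum w' x)} \<in> U"
    using coheir_invariant[OF U P eq] by (simp add: comp_def)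
  then show "G (case_sum w' c')"
    using realizes_uf_iff[OF coheir_ultra[OF U] c' p] by simp
qed

text \<open>Invariance fixes the type of the next term over all that precedes it. In the induction
  the terms already treated join the base tuple \<open>w\<close>; finite support then covers the
  whole sequence.\<close>

lemma morley_uf_same_type:
  fixes S :: "('f, 'r, 'm) struct" and U :: "('v \<Rightarrow> 'm) set set" and w w' :: "'w \<Rightarrow> 'm"
  assumes U: "coheir M U" and eq: "same_type S W M w w'"
    and c: "morley_uf S V U (M \<union> w ` W) c" and c': "morley_uf S V U (M \<union> w' ` W) c'"
  shows "same_type S (W <+> UNIV \<times> V) M (case_sum w (case_prod c)) (case_sum w' (case_prod c'))"
proof -
  have fin: "same_type S (W <+> {..<n} \<times> V) M (case_sum w (case_prod c)) (case_sum w'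
      (case_prod c'))" for n
  proof (induction n)
    case 0
    show ?case by (rule same_type_map[OF eq]) auto
  next
    case (Suc n)
    let ?W = "W <+> {..<n} \<times> V"
    have im: "case_sum v (case_prod d) ` ?W = v ` W \<union> (\<Union>j<n. d j ` V)" for v :: "'w \<Rightarrow> 'm"
        and d :: "nat \<Rightarrow> 'v \<Rightarrow> 'm"
      by force
    have "realizes_uf S V U (M \<union> case_sum w (case_prod c) ` ?W) (c n)"
      "realizes_uf S V U (M \<union> case_sum w' (case_prod c') ` ?W) (c' n)"
      unfolding im Un_assoc[symmetric] using c c' unfolding morley_uf_def by simp_all
    from realizes_uf_same_type[OF U Suc this]
    show ?case
    proof (rule same_type_map)
      fix l assume "l \<in> W <+> {..<Suc n} \<times> V"
      then consider x where "x \<in> W" "l = Inl x" | j x where "j < n" "x \<in> V" "l = Inr (j, x)"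
        | x where "x \<in> V" "l = Inr (n, x)" by (auto simp: less_Suc_eq)
      then show "\<exists>v\<in>?W <+> V. case_sum w (case_prod c) l = case_sum (case_sum w (case_prod c))
          (c n) v \<and>
          case_sum w' (case_prod c') l = case_sum (case_sum w' (case_prod c')) (c' n) v"
      proof cases
        case 1 then show ?thesis by (intro bexI[of _ "Inl (Inl x)"]) auto
      next
        case 2 then show ?thesis by (intro bexI[of _ "Inl (Inr (j, x))"]) auto
      next
        case 3 then show ?thesis by (intro bexI[of _ "Inr x"]) auto
      qed
    qed
  qed
  show ?thesis
  proof (rule same_type_finite)
    fix V0 assume V0: "V0 \<subseteq> W <+> (UNIV :: nat set) \<times> V" "finite V0"
    have "finite (fst ` (Inr -` V0))" using V0(2) by (intro finite_imageI finite_vimageI) auto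
    then obtain n where n: "\<forall>i\<in>fst ` (Inr -` V0). i < n" using finite_nat_set_iff_bounded by meson
    have "V0 \<subseteq> W <+> {..<n} \<times> V"
    proof
      fix l assume "l \<in> V0"
      then show "l \<in> W <+> {..<n} \<times> V"
        using V0(1) n by (cases l) force+
    qed
    from same_type_mono[OF fin this order_refl]
    show "same_type S V0 M (case_sum w (case_prod c)) (case_sum w' (case_prod c'))" .
  qed
qed

lemma morley_uf_same_type0:
  assumes U: "coheir M U" and c: "morley_uf S V U M c" and c': "morley_uf S V U M c'"
  shows "same_type S (UNIV \<times> V) M (case_prod c) (case_prod c')"
proof -
  have "same_type S ({} <+> UNIV \<times> V) M (case_sum undefined (case_prod c)) (case_sum undefined
      (case_prod c'))"
    by (rule morley_uf_same_type[OF U]) (use c c' in \<open>auto intro: same_type_refl\<close>)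
  then show ?thesis
  proof (rule same_type_map)
    fix l assume "l \<in> (UNIV :: nat set) \<times> V"
    then show "\<exists>v\<in>{} <+> UNIV \<times> V. case_prod c l = case_sum undefined (case_prod c) v \<and>
        case_prod c' l = case_sum undefined (case_prod c') v"
      by (intro bexI[of _ "Inr l"]) auto
  qed
qed

section \<open>Existence of Morley sequences and coheirs\<close>

context monster_model begin

lemma small_UN: "\<lbrakk>finite I; \<And>i. i \<in> I \<Longrightarrow> small \<kappa> (A i)\<rbrakk> \<Longrightarrow> small \<kappa> (\<Union>i\<in>I. A i)"
  by (induction I rule: finite_induct) (auto intro: small_Un small_finite)

lemma realizes_uf_exists:
  fixes U :: "('v \<Rightarrow> 'm) set set"
  assumes U: "ultrafilter U" and sm: "small \<kappa> V" "small \<kappa> A"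
  shows "\<exists>c. realizes_uf S V U A c"
proof -
  have "\<exists>c. \<forall>G\<in>{G. definable S V A G \<and> {x. G x} \<in> U}. G c"
  proof (rule realize_indexed[OF sm])
    fix J assume J: "J \<subseteq> {G. definable S V A G \<and> {x. G x} \<in> U}" "finite J"
    have "{x. \<forall>G\<in>J. G x} \<in> U" by (rule ultrafilter_ball[OF U J(2)]) (use J(1) in blast)
    from ultrafilter_ex[OF U this] show "\<exists>c. \<forall>G\<in>J. G c" by simp
  qed simp
  then obtain c where "\<forall>G\<in>{G. definable S V A G \<and> {x. G x} \<in> U}. G c" by (rule exE)
  then have "realizes_uf S V U A c" unfolding realizes_uf_def by blast
  then show ?thesis by (intro exI[of _ c])
qed

text \<open>Prescribing \<open>n\<close> terms serves two purposes: starting a Morley sequence with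
  a given tuple, and completing the finite part built so far in a recursion to a full
  sequence.\<close>

lemma morley_uf_extend:
  fixes U :: "('v \<Rightarrow> 'm) set set"
  assumes U: "ultrafilter U" and sm: "small \<kappa> V" "small \<kappa> A"
    and c0: "\<And>i. i < n \<Longrightarrow> realizes_uf S V U (A \<union> (\<Union>j<i. c0 j ` V)) (c0 i)"
  shows "\<exists>c. (\<forall>i<n. c i = c0 i) \<and> morley_uf S V U A c"
proof -
  define P where "P f i r \<longleftrightarrow> realizes_uf S V U (A \<union> (\<Union>j<i. f j ` V)) r \<and> (i < n \<longrightarrow> r = c0 i)"
    for f :: "nat \<Rightarrow> 'v \<Rightarrow> 'm" and i r
  have "\<exists>c. \<forall>i. P c i (c i)"
  proof (rule dependent_wellorder_choice)
    fix r and f g :: "nat \<Rightarrow> 'v \<Rightarrow> 'm" and i :: nat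
    assume "\<And>j. j < i \<Longrightarrow> f j = g j"
    then show "P f i r = P g i r" unfolding P_def by simp
  next
    fix f :: "nat \<Rightarrow> 'v \<Rightarrow> 'm" and i :: nat
    assume IH: "\<And>j. j < i \<Longrightarrow> P f j (f j)"
    have "small \<kappa> (A \<union> (\<Union>j<i. f j ` V))" using sm by (intro small_Un small_UN small_image) auto
    from realizes_uf_exists[OF U sm(1) this] obtain r
        where r: "realizes_uf S V U (A \<union> (\<Union>j<i. f j ` V)) r" by blast
    show "\<exists>r. P f i r"
    proof (cases "i < n")
      case True
      then have "f j = c0 j" if "j < i" for j using IH[OF that] that unfolding P_def by simp
      then have "(\<Union>j<i. f j ` V) = (\<Union>j<i. c0 j ` V)" by simp
      then show ?thesis using c0[OF True] unfolding P_def by (intro exI[of _ "c0 i"]) simp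
    next
      case False then show ?thesis using r unfolding P_def by (intro exI[of _ r]) simp
    qed
  qed
  then obtain c where c: "\<And>i. P c i (c i)" by blast
  have "\<forall>i<n. c i = c0 i" using c unfolding P_def by simp
  moreover have "morley_uf S V U A c" using c unfolding morley_uf_def P_def by simp
  ultimately show ?thesis by blast
qed

lemma morley_uf_exists:
  "\<lbrakk>ultrafilter U; small \<kappa> V; small \<kappa> A; realizes_uf S V U A c0\<rbrakk> \<Longrightarrow> \<exists>c. c 0 = c0 \<and>
      morley_uf S V U A c"
  using morley_uf_extend[of U V A 1 "\<lambda>_. c0"] by auto

lemma morley_uf_exists': "\<lbrakk>ultrafilter U; small \<kappa> V; small \<kappa> A\<rbrakk> \<Longrightarrow> \<exists>c. morley_uf S V U A c"
  using realizes_uf_exists morley_uf_exists by blast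

text \<open>The base consists of sets of tuples from \<open>M\<close> whose first part lies in a
  given member of \<open>U\<close> and which satisfy a given formula of \<open>tp(c d/M)\<close>.
  They are nonempty: with its second part quantified, the formula belongs to \<open>tp(c/M)\<close>,
  so it has solutions from \<open>M\<close> in that member of \<open>U\<close>, and elementarity
  finds a second part in \<open>M\<close> too. The first parts give back \<open>U\<close> itself,
  not just the same type.\<close>

lemma coheir_extend:
  fixes U :: "('v \<Rightarrow> 'm) set set" and d :: "'w \<Rightarrow> 'm"
  assumes U: "coheir M U" and c: "realizes_uf S V U M c"
  shows "\<exists>U'. coheir M U' \<and> pushforward Inl U' = U \<and> realizes_uf S (V <+> W) U' M (case_sum c d)"
proof -
  define K where "K X G = {e. e \<circ> Inl \<in> X \<and> range e \<subseteq> M \<and> G e}" for X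
      and G :: "('v + 'w \<Rightarrow> 'm) \<Rightarrow> bool"
  define F where "F = {K X G | X G. X \<in> U \<and> definable S (V <+> W) M G \<and> G (case_sum c d)}"
  have KF: "K X G \<in> F" if "X \<in> U" "definable S (V <+> W) M G" "G (case_sum c d)" for X G
    using that unfolding F_def by blast
  have "\<exists>U'. ultrafilter U' \<and> F \<subseteq> U'"
  proof (rule ultrafilter_base)
    have "K X G \<noteq> {}" if X: "X \<in> U" and G: "definable S (V <+> W) M G" "G (case_sum c d)" for X G
    proof -
      have "definable S V M (\<lambda>x. \<exists>z. G (case_sum x z))"
        by (rule definable_ex[where W = W], rule definable_subst[OF G(1)]) (auto intro!:
            coordinate_intros)
      from realizes_uf_iff[OF coheir_ultra[OF U] c this] have "{x. \<exists>z. G (case_sum x z)} \<in> U"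
          using G(2) by blast
      then have "{x. \<exists>z. G (case_sum x z)} \<inter> (X \<inter> {x. range x \<subseteq> M}) \<in> U"
        using X U ultrafilter_int unfolding coheir_def by blast
      then obtain x z where x: "G (case_sum x z)" "x \<in> X" "range x \<subseteq> M"
        using ultrafilter_ex[OF coheir_ultra[OF U]] by blast
      have "definable S W M (\<lambda>z. G (case_sum x z))"
        by (rule definable_subst[OF G(1)]) (use x(3) in \<open>auto simp: image_subset_iff intro!:
            coordinate_intros\<close>)
      from elem_witness[OF elemM this x(1)] obtain z where z: "range z \<subseteq> M" "G (case_sum x z)"
          by blast
      have "case_sum x z \<circ> Inl = x" by (simp add: fun_eq_iff)
      moreover have "range (case_sum x z) \<subseteq> M"
      proof
        fix m assume "m \<in> range (case_sum x z)"
        then obtain l where "m = case_sum x z l" by blast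
        then show "m \<in> M" using x(3) z(1) by (cases l) auto
      qed
      ultimately have "case_sum x z \<in> K X G" using x(2) z(2) unfolding K_def by simp
      then show ?thesis by blast
    qed
    then show "{} \<notin> F" unfolding F_def by blast
    fix X Y assume "X \<in> F" "Y \<in> F"
    then obtain X' G Y' H where *: "X = K X' G" "X' \<in> U" "definable S (V <+> W) M G" "G
        (case_sum c d)"
      "Y = K Y' H" "Y' \<in> U" "definable S (V <+> W) M H" "H (case_sum c d)" unfolding F_def by blast
    have "K (X' \<inter> Y') (\<lambda>e. G e \<and> H e) \<in> F"
      by (rule KF) (use * ultrafilter_int[OF coheir_ultra[OF U]] definable_conj in simp_all)
    moreover have "K (X' \<inter> Y') (\<lambda>e. G e \<and> H e) \<subseteq> X \<inter> Y" unfolding *(1,5) K_def by blast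
    ultimately show "\<exists>Z\<in>F. Z \<subseteq> X \<inter> Y" by (rule bexI[rotated])
  qed
  then obtain U' where U': "ultrafilter U'" "F \<subseteq> U'" by blast
  have in_U': "{e. e \<circ> Inl \<in> X \<and> range e \<subseteq> M \<and> G e} \<in> U'"
    if "X \<in> U" "definable S (V <+> W) M G" "G (case_sum c d)" for X G
    using KF[OF that] U'(2) unfolding K_def by blast
  have 1: "{e. e \<circ> Inl \<in> X} \<in> U'" if "X \<in> U" for X
    by (rule ultrafilter_mono[OF U'(1) in_U'[OF that definable_true]]) auto
  have "pushforward Inl U' = U"
  proof (intro equalityI subsetI)
    fix X assume "X \<in> pushforward Inl U'"
    then have X: "{e. e \<circ> Inl \<in> X} \<in> U'" unfolding pushforward_def by simp
    show "X \<in> U"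
    proof (rule ccontr)
      assume "X \<notin> U"
      then have "- X \<in> U" using U unfolding coheir_def ultrafilter_def by blast
      from ultrafilter_int[OF U'(1) X 1[OF this]] have "{} \<in> U'"
        by (simp add: Collect_conj_eq[symmetric])
      then show False using U'(1) unfolding ultrafilter_def by simp
    qed
  qed (use 1 in \<open>simp add: pushforward_def\<close>)
  moreover have "coheir M U'" unfolding coheir_def
  proof
    show "{c. range c \<subseteq> M} \<in> U'"
      by (rule ultrafilter_mono[OF U'(1) in_U'[OF ultrafilter_UNIV[OF coheir_ultra[OF U]]
          definable_true]]) auto
  qed (rule U'(1))
  moreover have "realizes_uf S (V <+> W) U' M (case_sum c d)" unfolding realizes_uf_def
  proof (intro allI impI, rule ccontr)
    fix G assume G: "definable S (V <+> W) M G" "{x. G x} \<in> U'" "\<not> G (case_sum c d)"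
    have "{e. \<not> G e} \<in> U'"
      by (rule ultrafilter_mono[OF U'(1) in_U'[OF ultrafilter_UNIV[OF coheir_ultra[OF U]]
          definable_not[OF G(1)] G(3)]]) auto
    then show False using G(2) ultrafilter_compl[OF U'(1), of G] by simp
  qed
  ultimately show ?thesis by blast
qed

text \<open>The principal ultrafilter at a constant from \<open>M\<close>, for an empty set of
  variables, is extended to a coheir of \<open>d\<close>; the auxiliary labels of type
  \<open>unit\<close> are then dropped.\<close>

lemma coheir_exists: "\<exists>U. coheir M U \<and> realizes_uf S W U M d"
proof -
  obtain m0 where m0: "m0 \<in> M" using elemM unfolding elem_submodel_def by (meson ex_in_conv)
  let ?U = "{X. (\<lambda>_ :: unit. m0) \<in> X}"
  have U: "coheir M ?U" unfolding coheir_def ultrafilter_def using m0 by auto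
  have "realizes_uf S {} ?U M (\<lambda>_. m0)" unfolding realizes_uf_def by simp
  from coheir_extend[OF U this] obtain U' where
    U': "coheir M U'" "realizes_uf S ({} <+> W) U' M (case_sum (\<lambda>_ :: unit. m0) d)" by blast
  have "realizes_uf S W (pushforward Inr U') M (case_sum (\<lambda>_ :: unit. m0) d \<circ> Inr)"
    by (rule realizes_uf_push[OF U'(2)]) auto
  moreover have "case_sum (\<lambda>_ :: unit. m0) d \<circ> Inr = d" by (simp add: fun_eq_iff)
  ultimately show ?thesis using coheir_push[OF U'(1)] by metis
qed

end

subsection \<open>The strict order property from definable relations with parameters\<close>

lemma definable_fms:
  fixes S :: "('f, 'r, 'm) struct" and V :: "'v set" and W :: "'w set"
  assumes "definable S (V <+> W) {} Q"
  shows "\<exists>R\<in>fms S V W. \<forall>e. holds S e R \<longleftrightarrow> Q e"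
proof -
  obtain P where P: "definable0 S ((V <+> W) <+> {}) P" "Q = (\<lambda>c. P (case_sum c id))"
    using assms unfolding definable_iff_definable0 by blast
  let ?f = "case_sum id (\<lambda>_. undefined) :: ('v + 'w) + 'm \<Rightarrow> 'v + 'w"
  have "definable0 S (V <+> W) (\<lambda>e. P (e \<circ> ?f))" by (rule definable0_map[OF P(1)]) auto
  then obtain R where R: "formula S R" "fm_vars R \<subseteq> V <+> W" "\<forall>e. P (e \<circ> ?f) \<longleftrightarrow> holds S e R"
    unfolding definable0_def by blast
  have "P (e \<circ> ?f) \<longleftrightarrow> Q e" for e
    unfolding P(2) by (rule definable0_cong[OF P(1)]) auto
  with R show ?thesis unfolding fms_def by (intro bexI[of _ R]) auto
qed

text \<open>Dividing is defined with numbered parameter tuples, so the finitely many labels of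
  \<open>W\<close> that occur are numbered by \<open>g\<close>. Neither \<open>\<psi>\<close> nor
  \<open>g\<close> depends on \<open>d\<close>, so one formula can be evaluated along a whole
  sequence of tuples.\<close>

lemma definable_inst:
  fixes S :: "('f, 'r, 'm) struct" and V :: "'v set" and W :: "'w set"
  assumes "definable S (V <+> W) {} H" "W \<noteq> {}"
  shows "\<exists>\<psi> n g. \<psi> \<in> fms S V {..<n::nat} \<and> g ` {..<n} \<subseteq> W \<and>
    (\<forall>c d. satisfies S c (inst \<psi> (d \<circ> g)) \<longleftrightarrow> H (case_sum c d))"
proof -
  obtain V0 A0 where V0: "V0 \<subseteq> V <+> W" "finite V0" "A0 \<subseteq> {}" "definable S V0 A0 H"
    using definable_support[OF assms(1)] by blast
  define Y where "Y = Inr -` V0"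
  have "finite Y" unfolding Y_def by (rule finite_vimageI[OF V0(2)]) simp
  then obtain g where g: "bij_betw g {0..<card Y} Y" using ex_bij_betw_nat_finite by blast
  have YW: "Y \<subseteq> W" using V0(1) unfolding Y_def by auto
  define i where "i y = (SOME k. k < card Y \<and> g k = y)" for y
  have i: "i y < card Y \<and> g (i y) = y" if "y \<in> Y" for y
  proof -
    have "y \<in> g ` {0..<card Y}" using g that unfolding bij_betw_def by simp
    then have "\<exists>k. k < card Y \<and> g k = y" by auto
    then show ?thesis unfolding i_def by (rule someI_ex)
  qed
  have V0': "V0 \<subseteq> V <+> Y" using V0(1) unfolding Y_def by auto
  have H: "definable S V0 {} H" using V0 by auto
  have "definable S (V <+> {..<card Y}) {} (\<lambda>e. H (case_sum (e \<circ> Inl) (e \<circ> Inr \<circ> i)))"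
  proof (rule definable_subst[OF H order_refl])
    fix l assume "l \<in> V0"
    then have "l \<in> V <+> Y" using V0' by blast
    then show "coordinate (V <+> {..<card Y}) {} (\<lambda>e. case_sum (e \<circ> Inl) (e \<circ> Inr \<circ> i) l)"
      by (elim PlusE) (use i in \<open>auto intro!: coordinate_intros\<close>)
  qed
  then obtain \<psi> where \<psi>: "\<psi> \<in> fms S V {..<card Y}"
    "\<forall>e. holds S e \<psi> \<longleftrightarrow> H (case_sum (e \<circ> Inl) (e \<circ> Inr \<circ> i))"
    using definable_fms by blast
  have "satisfies S c (inst \<psi> (d \<circ> g)) \<longleftrightarrow> H (case_sum c d)" for c d
    unfolding satisfies_inst
  proof (subst \<psi>(2)[rule_format], rule definable_cong[OF H])
    fix l assume "l \<in> V0"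
    then have "l \<in> V <+> Y" using V0' by blast
    then show "case_sum (case_sum c (d \<circ> g) \<circ> Inl) (case_sum c
        (d \<circ> g) \<circ> Inr \<circ> i) l = case_sum c d l"
      using i by auto
  qed
  moreover have "g ` {..<card Y} \<subseteq> W" using g YW unfolding bij_betw_def
      by (auto simp: lessThan_atLeast0)
  ultimately show ?thesis using \<psi>(1) by blast
qed

text \<open>\<open>SOP\<close> does not allow parameters, so they become coordinates of the tuples; the relation then
  also has to say that these coordinates agree and admit no 3-cycle.\<close>

lemma SOP3I:
  fixes S :: "('f, 'r, 'm) struct" and e :: "nat \<Rightarrow> 'l \<Rightarrow> 'm"
  assumes R: "definable S (V <+> V) UNIV (\<lambda>z. R (z \<circ> Inl) (z \<circ> Inr))"
    and cyc: "\<And>x y z. \<not> (R x y \<and> R y z \<and> R z x)"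
    and chain: "\<And>i j. i < j \<Longrightarrow> R (e i) (e j)"
  shows "SOP 3 S"
proof -
  obtain V0 P where V0: "V0 \<subseteq> V <+> V" "finite V0" "finite P" "definable S V0 P (\<lambda>z. R (z \<circ> Inl)
      (z \<circ> Inr))"
    using definable_support[OF R] by blast
  \<comment> \<open>Both arguments of the relation must have the same finite index set, so a label
    occurring on either side is put into \<open>L\<close>.\<close>
  define L where "L = Inl -` V0 \<union> Inr -` V0"
  have finL: "finite L" unfolding L_def using V0(2) by (auto intro: finite_vimageI)
  have "V0 \<subseteq> L <+> L"
  proof
    fix l assume "l \<in> V0" then show "l \<in> L <+> L" unfolding L_def by (cases l) auto
  qed
  then have "definable S (L <+> L) ({} \<union> id ` P) (\<lambda>z. R (z \<circ> Inl) (z \<circ> Inr))"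
    using definable_mono[OF V0(4)] by simp
  from definable_abs[OF this] obtain H where H: "definable S ((L <+> L) <+> P) {} H"
    "\<And>z. R (z \<circ> Inl) (z \<circ> Inr) \<longleftrightarrow> H (case_sum z id)" by blast
  define rel where "rel p x y \<longleftrightarrow> H (case_sum (case_sum x y) p)" for p and x y :: "'l \<Rightarrow> 'm"
  have rel_id: "rel id x y \<longleftrightarrow> R x y" for x y
    unfolding rel_def using H(2)[of "case_sum x y"] by (simp add: comp_def)
  have rel_cong: "rel p x y \<longleftrightarrow> rel p' x' y'"
    if "\<And>m. m \<in> P \<Longrightarrow> p m = p' m" "\<And>l. l \<in> L \<Longrightarrow> x l = x' l" "\<And>l. l \<in> L \<Longrightarrow> y l = y' l" for p p' x x' y y'
    unfolding rel_def by (rule definable_cong[OF H(1)]) (use that in auto)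
  define ok where "ok p \<longleftrightarrow> (\<forall>z :: 'l + 'l + 'l \<Rightarrow> 'm. \<not> (rel p (z \<circ> Inl) (z \<circ> Inr \<circ> Inl) \<and>
    rel p (z \<circ> Inr \<circ> Inl) (z \<circ> Inr \<circ> Inr) \<and> rel p (z \<circ> Inr \<circ> Inr) (z \<circ> Inl)))" for p
  have okD: "\<not> (rel p x y \<and> rel p y z \<and> rel p z x)" if "ok p" for p x y z
    using that[unfolded ok_def, rule_format, of "case_sum x (case_sum y z)"] by (simp add: comp_def)
  have ok_id: "ok id" unfolding ok_def rel_id using cyc by blast
  have ok: "definable S P {} ok" unfolding ok_def
  proof (rule definable_all[where W = "L <+> L <+> L"], intro definable_not definable_conj)
    show "definable S (P <+> L <+> L <+> L) {} (\<lambda>e. rel (e \<circ> Inl) (e \<circ> Inr \<circ> Inl)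
        (e \<circ> Inr \<circ> Inr \<circ> Inl))"
      unfolding rel_def by (rule definable_subst[OF H(1)]) (auto intro!: coordinate_intros)
    show "definable S (P <+> L <+> L <+> L) {} (\<lambda>e. rel (e \<circ> Inl) (e \<circ> Inr \<circ> Inr \<circ> Inl)
        (e \<circ> Inr \<circ> Inr \<circ> Inr))"
      unfolding rel_def by (rule definable_subst[OF H(1)]) (auto intro!: coordinate_intros)
    show "definable S (P <+> L <+> L <+> L) {} (\<lambda>e. rel (e \<circ> Inl) (e \<circ> Inr \<circ> Inr \<circ> Inr)
        (e \<circ> Inr \<circ> Inl))"
      unfolding rel_def by (rule definable_subst[OF H(1)]) (auto intro!: coordinate_intros)
  qed
  define N where "N = L <+> P"
  have "finite N" unfolding N_def using finL V0(3) by simp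
  then obtain g where g: "bij_betw g N {0..<card N}" using ex_bij_betw_finite_nat by blast
  define k where "k = card N"
  have gk: "g n < k" if "n \<in> N" for n using g that unfolding bij_betw_def k_def by auto
  have inj: "inj_on g N" using g unfolding bij_betw_def by simp
  define tup where "tup u = (\<lambda>l. u (g (Inl l)))" for u :: "nat \<Rightarrow> 'm"
  define par where "par u = (\<lambda>m. u (g (Inr m)))" for u :: "nat \<Rightarrow> 'm"
  \<comment> \<open>Around a cycle, equality of the parameters lets those of \<open>c 0\<close>, for
    which \<open>ok\<close> is known, replace all others.\<close>
  define Q where "Q e \<longleftrightarrow> rel (par (e \<circ> Inl)) (tup (e \<circ> Inl)) (tup (e \<circ> Inr)) \<and> ok (par (e \<circ> Inl)) \<and>
    (\<forall>m\<in>P. e (Inl (g (Inr m))) = e (Inr (g (Inr m))))" for e :: "nat + nat \<Rightarrow> 'm"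
  have "definable S ({..<k} <+> {..<k}) {} Q" unfolding Q_def
  proof (intro definable_conj definable_ball V0(3))
    show "definable S ({..<k} <+> {..<k}) {} (\<lambda>e. rel (par (e \<circ> Inl)) (tup (e \<circ> Inl)) (tup
        (e \<circ> Inr)))"
      unfolding rel_def par_def tup_def
      by (rule definable_subst[OF H(1)]) (auto intro!: coordinate_intros gk simp: N_def)
    show "definable S ({..<k} <+> {..<k}) {} (\<lambda>e. ok (par (e \<circ> Inl)))"
      unfolding par_def by (rule definable_subst[OF ok]) (auto intro!: coordinate_intros gk simp:
          N_def)
    show "definable S ({..<k} <+> {..<k}) {} (\<lambda>e. e (Inl (g (Inr m))) = e (Inr (g (Inr m))))"
        if "m \<in> P" for m
      by (rule definable_eq) (use that in \<open>auto intro!: gk simp: N_def\<close>)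
  qed
  from definable_fms[OF this] obtain \<rho> where \<rho>: "\<rho> \<in> fms S {..<k} {..<k}"
    "\<And>e. holds S e \<rho> \<longleftrightarrow> Q e" by blast
  have Q2: "Q (case_sum u v) \<longleftrightarrow> rel (par u) (tup u) (tup v) \<and> ok (par u) \<and>
      (\<forall>m\<in>P. par u m = par v m)" for u v
    unfolding Q_def by (simp add: comp_def par_def)
  have "\<nexists>c. \<forall>i<3. holds S (case_sum (c i) (c (Suc i mod 3))) \<rho>"
  proof
    assume "\<exists>c. \<forall>i<3. holds S (case_sum (c i) (c (Suc i mod 3))) \<rho>"
    then obtain c where c: "\<And>i. i < 3 \<Longrightarrow> Q (case_sum (c i) (c (Suc i mod 3)))" unfolding \<rho>(2)
        by blast
    have mods: "Suc 0 mod 3 = (1 :: nat)" "Suc 1 mod 3 = (2 :: nat)" "Suc 2 mod 3 = (0 :: nat)"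
        by simp_all
    have "0 < (3::nat)" "1 < (3::nat)" "2 < (3::nat)" by simp_all
    then have "Q (case_sum (c 0) (c 1))" "Q (case_sum (c 1) (c 2))" "Q (case_sum (c 2) (c 0))"
      using c[of 0, unfolded mods(1)] c[of 1, unfolded mods(2)] c[of 2, unfolded mods(3)] by blast+
    then have *: "rel (par (c 0)) (tup (c 0)) (tup (c 1))" "rel (par (c 1)) (tup (c 1)) (tup (c 2))"
      "rel (par (c 2)) (tup (c 2)) (tup (c 0))" "ok (par (c 0))"
      "\<And>m. m \<in> P \<Longrightarrow> par (c 1) m = par (c 0) m" "\<And>m. m \<in> P \<Longrightarrow> par (c 2) m = par (c 0) m"
      unfolding Q2 by auto
    have "rel (par (c 0)) (tup (c 1)) (tup (c 2))" "rel (par (c 0)) (tup (c 2)) (tup (c 0))"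
    proof -
      have "rel (par (c 1)) x y \<longleftrightarrow> rel (par (c 0)) x y" "rel (par (c 2)) x y \<longleftrightarrow> rel (par (c 0)) x y"
          for x y
        by (rule rel_cong; simp only: *(5,6))+
      then show "rel (par (c 0)) (tup (c 1)) (tup (c 2))" "rel (par (c 0)) (tup (c 2)) (tup (c 0))"
        using *(2,3) by simp_all
    qed
    then show False using okD[OF *(4)] *(1) by blast
  qed
  moreover have "\<exists>a. \<forall>i j. i < j \<longrightarrow> holds S (case_sum (a i) (a (j::nat))) \<rho>"
  proof -
    \<comment> \<open>Each \<open>e i\<close> is joined with the original parameters, which are the
      same for all \<open>i\<close>, in the numbering \<open>g\<close>.\<close>
    define a where "a i n = case_sum (e i) id (the_inv_into N g n)" for i n
    have tup: "tup (a i) l = e i l" if "l \<in> L" for i l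
      unfolding tup_def a_def using that the_inv_into_f_f[OF inj] by (simp add: N_def InlI InrI)
    have par: "par (a i) m = id m" if "m \<in> P" for i m
      unfolding par_def a_def using that the_inv_into_f_f[OF inj] by (simp add: N_def InlI InrI)
    have "Q (case_sum (a i) (a j))" if "i < j" for i j
      unfolding Q2
    proof (intro conjI ballI)
      have "rel (par (a i)) (tup (a i)) (tup (a j)) \<longleftrightarrow> rel id (e i) (e j)"
        by (rule rel_cong) (simp_all only: tup par)
      then show "rel (par (a i)) (tup (a i)) (tup (a j))" unfolding rel_id using chain[OF that]
          by simp
      have "ok (par (a i)) \<longleftrightarrow> ok id" by (rule definable_cong[OF ok]) (simp only: par)
      then show "ok (par (a i))" using ok_id by simp
    qed (simp add: par)
    then show ?thesis unfolding \<rho>(2) by blast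
  qed
  ultimately show ?thesis unfolding SOP_def using \<rho>(1) by blast
qed

lemma same_type_swap:
  assumes "same_type S (V <+> W) A (case_sum c d) (case_sum c' d')"
  shows "same_type S (W <+> V) A (case_sum d c) (case_sum d' c')"
proof (rule same_type_map[OF assms])
  fix l assume "l \<in> W <+> V"
  then show "\<exists>v\<in>V <+> W. case_sum d c l = case_sum c d v \<and> case_sum d' c' l = case_sum c' d' v"
    by (elim PlusE) force+
qed

text \<open>Only finitely many terms of a sequence occur in a formula; \<open>N\<close> allows a
  further lower bound on the block length.\<close>

lemma seq_support:
  assumes "definable S ((UNIV :: nat set) \<times> X <+> W) A H"
  shows "\<exists>k\<ge>N. definable S ({..<k} \<times> X <+> W) A H"
proof -
  obtain V0 A0 where V0: "V0 \<subseteq> (UNIV :: nat set) \<times> X <+> W" "A0 \<subseteq> A" "finite V0" "definable S V0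
      A0 H"
    using definable_support[OF assms] by blast
  have "finite (fst ` (Inl -` V0))" using V0(3) by (intro finite_imageI finite_vimageI) auto
  then obtain n where n: "\<forall>i\<in>fst ` (Inl -` V0). i < n" using finite_nat_set_iff_bounded by meson
  have "V0 \<subseteq> {..<max n N} \<times> X <+> W"
  proof
    fix l assume "l \<in> V0"
    then show "l \<in> {..<max n N} \<times> X <+> W"
      using V0(1) n by (cases l) force+
  qed
  from definable_mono[OF V0(4) this V0(2)] show ?thesis by (intro exI[of _ "max n N"]) simp
qed

subsection \<open>A common realization along a Morley sequence\<close>

lemma realizes_uf_same_type0:
  assumes U: "ultrafilter U" and "realizes_uf S V U A c" "realizes_uf S V U A c'" shows "same_type
      S V A c c'"
proof (rule same_typeI)
  fix G assume "definable S V A G" "G c"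
  then show "G c'" using realizes_uf_iff[OF U assms(2)] realizes_uf_iff[OF U assms(3)] by blast
qed

lemma morley_uf_realizes: "morley_uf S V U A c \<Longrightarrow> realizes_uf S V U A (c i)"
  unfolding morley_uf_def by (meson Un_upper1 order_refl realizes_uf_mono)

context monster_model begin

text \<open>Non-dividing is applied to a Morley sequence \<open>B0\<close> of the coheir that starts
  with \<open>b\<close> itself. Having a common solution for \<open>N\<close> terms is a property of
  the type of the sequence over \<open>M\<close>, which \<open>B\<close> shares with
  \<open>B0\<close>.\<close>

lemma kim_common_fin:
  fixes a b :: "'m set"
  assumes b: "M \<subseteq> b" "small \<kappa> b" and kim: "kim_indep_set S M a b"
    and U: "coheir M U" and id: "realizes_uf S b U M id" and B: "morley_uf S b U M B"
    and G: "definable S (a <+> b) M G" "G (case_sum id id)"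
  shows "\<exists>z. \<forall>i<N. G (case_sum z (B i))"
proof -
  obtain B0 where B0: "B0 0 = id" "morley_uf S b U M B0"
    using morley_uf_exists[OF coheir_ultra[OF U] b(2) smallM id] by blast
  \<comment> \<open>Elements of \<open>M\<close> are also entries of the tuple \<open>b\<close>, and
    each term of the sequence keeps them fixed.\<close>
  have fixM: "B0 i m = m" if "m \<in> M" for i m
  proof -
    have p: "definable S b M (\<lambda>x. x m = m)" by (rule definable_eq_param) (use that b(1) in auto)
    show ?thesis
      using same_typeD[OF realizes_uf_same_type0[OF coheir_ultra[OF U] id morley_uf_realizes[OF
          B0(2)]] p, of i] by simp
  qed
  obtain H' where H': "definable S ((a <+> b) <+> M) {} H'" "\<And>c. G c \<longleftrightarrow> H' (case_sum c id)"
    using definable_abs[of S "a <+> b" "{}" id M G] G(1) by auto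
  \<comment> \<open>Dividing admits no parameters outside the tuple. Those from \<open>M\<close> are
    therefore read off the tuple at their own labels, which changes nothing on tuples that fix
    \<open>M\<close>.\<close>
  define H where "H e = H' (case_sum e (e \<circ> Inr))" for e
  have H: "definable S (a <+> b) {} H" unfolding H_def
    by (rule definable_subst[OF H'(1)]) (use b(1) in \<open>auto intro!: coordinate_intros\<close>)
  have GH: "G (case_sum z y) \<longleftrightarrow> H (case_sum z y)" if "\<And>m. m \<in> M \<Longrightarrow> y m = m" for z y
    unfolding H'(2) H_def by (rule definable_cong[OF H'(1)]) (use that in auto)
  have "b \<noteq> {}" using b(1) elemM unfolding elem_submodel_def by blast
  from definable_inst[OF H this] obtain \<psi> n g where \<psi>: "\<psi> \<in> fms S a {..<n::nat}" "g ` {..<n} \<subseteq> b"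
    "\<And>c d. satisfies S c (inst \<psi> (d \<circ> g)) \<longleftrightarrow> H (case_sum c d)" by blast
  have "inst \<psi> (id \<circ> g) \<in> tp S a id (M \<union> b)"
    unfolding tp_def using \<psi>(3)[of id id] G(2) GH[of id id] inst_fms[OF \<psi>(1), of "id \<circ> g" "M \<union> b"]
        \<psi>(2) by auto
  then have "\<not> kim_forks S a M (inst \<psi> (id \<circ> g))" using kim unfolding kim_indep_def by blast
  moreover have "kim_forks S a M (inst \<psi> (id \<circ> g))" if "kim_divides S M \<psi> n (id \<circ> g)"
    unfolding kim_forks_def implies_dividing_def
    by (rule exI[of _ "{(\<psi>, n, id \<circ> g)}"]) (use that \<psi>(1) in auto)
  ultimately have nd: "\<not> kim_divides S M \<psi> n (id \<circ> g)" by blast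
  have "invariant_morley_seq S {..<n} M (\<lambda>i. B0 i \<circ> g)"
    by (rule morley_uf_invariant_morley_seq[OF coheir_push[OF U] morley_uf_push[OF B0(2) \<psi>(2)]])
  moreover have "\<forall>k<n. (B0 0 \<circ> g) k = (id \<circ> g) k" unfolding B0(1) by simp
  ultimately have "consistent S (range (\<lambda>i. inst \<psi> (B0 i \<circ> g)))"
    using nd unfolding kim_divides_def by blast
  moreover have "(\<lambda>i. inst \<psi> (B0 i \<circ> g)) ` {..<N} \<subseteq> range (\<lambda>i. inst \<psi> (B0 i \<circ> g))" by blast
  ultimately obtain z where "realizes S z ((\<lambda>i. inst \<psi> (B0 i \<circ> g)) ` {..<N})"
    unfolding consistent_def by (meson finite_imageI finite_lessThan)
  then have z: "H (case_sum z (B0 i))" if "i < N" for i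
    using that \<psi>(3) unfolding realizes_def by auto
  define Q where "Q y \<longleftrightarrow> (\<exists>z. \<forall>i\<in>{..<N}. G (case_sum z (\<lambda>x. y (i, x))))" for y
  have Q: "definable S (UNIV \<times> b) M Q" unfolding Q_def
  proof (rule definable_ex[where W = a], intro definable_ball finite_lessThan)
    fix i
    show "definable S (UNIV \<times> b <+> a) M (\<lambda>e. G (case_sum (e \<circ> Inr) (\<lambda>x. (e \<circ> Inl) (i, x))))"
      by (rule definable_subst[OF G(1)]) (auto intro!: coordinate_intros)
  qed
  have "Q (case_prod B0)" unfolding Q_def using z GH fixM by (intro exI[of _ z]) auto
  then have "Q (case_prod B)" using same_typeD[OF morley_uf_same_type0[OF U B0(2) B] Q] by simp
  then show ?thesis unfolding Q_def by auto
qed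

text \<open>Compactness over pairs of a formula and an index: finitely many pairs are covered by one
  conjunction and one bound \<open>N\<close>.\<close>

lemma kim_common:
  fixes a b :: "'m set"
  assumes a: "small \<kappa> a" and b: "M \<subseteq> b" "small \<kappa> b" and kim: "kim_indep_set S M a b"
    and U: "coheir M U" and id: "realizes_uf S b U M id" and B: "morley_uf S b U M B"
  shows "\<exists>A. \<forall>i. same_type S (a <+> b) M (case_sum A (B i)) (case_sum id id)"
proof -
  define I :: "((('m + 'm \<Rightarrow> 'm) \<Rightarrow> bool) \<times> nat) set"
    where "I = {(G, i). definable S (a <+> b) M G \<and> G (case_sum id id)}"
  have "\<exists>A. \<forall>x\<in>I. fst x (case_sum A (B (snd x)))"
  proof (rule realize_indexed[OF a])
    show "small \<kappa> (M \<union> case_prod B ` (UNIV \<times> b))"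
      using b(2) smallM by (intro small_Un small_image small_nat_Times)
    show "definable S a (M \<union> case_prod B ` (UNIV \<times> b)) (\<lambda>A. fst x (case_sum A (B (snd x))))"
        if "x \<in> I" for x
    proof (rule definable_subst)
      show "definable S (a <+> b) M (fst x)" using that unfolding I_def by auto
    qed (force intro!: coordinate_intros)+
    fix J assume J: "J \<subseteq> I" "finite J"
    obtain N where N: "\<forall>i\<in>snd ` J. i < N" using J(2) finite_nat_set_iff_bounded
        by (meson finite_imageI)
    have "\<exists>z. \<forall>i<N. \<forall>G\<in>fst ` J. G (case_sum z (B i))"
    proof (rule kim_common_fin[OF b kim U id B])
      show "definable S (a <+> b) M (\<lambda>e. \<forall>G\<in>fst ` J. G e)"
        by (rule definable_ball) (use J in \<open>auto simp: I_def\<close>)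
      show "\<forall>G\<in>fst ` J. G (case_sum id id)" using J(1) unfolding I_def by auto
    qed
    then show "\<exists>A. \<forall>x\<in>J. fst x (case_sum A (B (snd x)))" using N by blast
  qed
  then obtain A where A: "\<forall>x\<in>I. fst x (case_sum A (B (snd x)))" by (rule exE)
  have "same_type S (a <+> b) M (case_sum id id) (case_sum A (B i))" for i
  proof (rule same_typeI)
    fix G assume "definable S (a <+> b) M G" "G (case_sum id id)"
    then have "(G, i) \<in> I" unfolding I_def by simp
    from bspec[OF A this] show "G (case_sum A (B i))" by simp
  qed
  then show ?thesis using same_type_sym by blast
qed

subsection \<open>Amalgamation along Morley sequences\<close>

text \<open>If no such realization exists, the three formulas \<open>G(z,y)\<close>, \<open>F(x,z)\<close>, \<open>H(x,y)\<close> are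
  jointly inconsistent, while triples \<open>(A\<^sub>n,C\<^sub>n,B\<^sub>n)\<close> can be chosen one after the other such that
  each new one is related to the earlier ones by \<open>G(A\<^sub>n,B\<^sub>m)\<close>, \<open>F(C\<^sub>n,A\<^sub>m)\<close>, \<open>H(C\<^sub>m,B\<^sub>n)\<close>.
  Blocks of \<open>k\<close> consecutive terms of the sequences \<open>c\<close>, \<open>B\<close> are needed since \<open>F\<close> and \<open>H\<close> speak
  about several terms.\<close>

lemma amalgam_fin:
  fixes a b :: "'m set" and X :: "'v set" and U :: "('v \<Rightarrow> 'm) set set"
  assumes nsop: "NSOP 3 S" and X: "small \<kappa> X"
    and a: "small \<kappa> a" and b: "M \<subseteq> b" "small \<kappa> b" and kim: "kim_indep_set S M a b"
    and U: "coheir M U" and Ub: "coheir M Ub" and idb: "realizes_uf S b Ub M id"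
    and Ca: "morley_uf S X U (M \<union> a) Ca" and C: "morley_uf S X U M C"
    and B: "morley_uf S b Ub (M \<union> case_prod C ` (UNIV \<times> X)) B"
    and G: "definable S (a <+> b) M G" "G (case_sum id id)"
    and F: "definable S (UNIV \<times> X <+> a) M F" "F (case_sum (case_prod Ca) id)"
    and H: "definable S (UNIV \<times> X <+> UNIV \<times> b) M H" "H (case_sum (case_prod C) (case_prod B))"
  shows "\<exists>A C B. (\<forall>i<N. G (case_sum A (\<lambda>y. B (i, y)))) \<and> F (case_sum C A) \<and> H (case_sum C B)"
proof (rule ccontr)
  assume no: "\<nexists>A C B. (\<forall>i<N. G (case_sum A (\<lambda>y. B (i, y)))) \<and> F (case_sum C A) \<and> H (case_sum C B)"
  note uU = coheir_ultra[OF U] and uUb = coheir_ultra[OF Ub]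
  \<comment> \<open>Within one stage the three choices are independent: \<open>A\<close> is matched
    with the earlier \<open>B\<close>, \<open>C\<close> is generic over the earlier \<open>A\<close>
    and \<open>C\<close>, and \<open>B\<close> over the earlier \<open>C\<close> and
    \<open>B\<close>. No \<open>B\<close> has to be generic over any \<open>A\<close>.\<close>
  define Pr where "Pr f i r \<longleftrightarrow> same_type S a M (fst r) id \<and>
      (\<forall>j<i. same_type S (a <+> b) M (case_sum (fst r) (snd (snd (f j)))) (case_sum id id)) \<and>
      realizes_uf S X U (M \<union> (\<Union>j<i. fst (f j) ` a \<union> fst (snd (f j)) ` X)) (fst (snd r)) \<and>
      realizes_uf S b Ub (M \<union> (\<Union>j<i. fst (snd (f j)) ` X \<union> snd (snd (f j)) ` b)) (snd (snd r))"
    for f :: "nat \<Rightarrow> ('m \<Rightarrow> 'm) \<times> ('v \<Rightarrow> 'm) \<times> ('m \<Rightarrow> 'm)" and i and r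
  have "\<exists>f. \<forall>i. Pr f i (f i)"
  proof (rule dependent_wellorder_choice)
    fix r and f g :: "nat \<Rightarrow> ('m \<Rightarrow> 'm) \<times> ('v \<Rightarrow> 'm) \<times> ('m \<Rightarrow> 'm)" and i :: nat
    assume "\<And>j. j < i \<Longrightarrow> f j = g j"
    then show "Pr f i r = Pr g i r" unfolding Pr_def by simp
  next
    fix f :: "nat \<Rightarrow> ('m \<Rightarrow> 'm) \<times> ('v \<Rightarrow> 'm) \<times> ('m \<Rightarrow> 'm)" and i :: nat
    assume IH: "\<And>j. j < i \<Longrightarrow> Pr f j (f j)"
    \<comment> \<open>The earlier \<open>B\<close> are completed to an infinite Morley sequence
      because \<open>kim_common\<close> needs one; only its first \<open>i\<close> terms matter for
      \<open>A\<close>.\<close>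
    have "realizes_uf S b Ub (M \<union> (\<Union>l<j. snd (snd (f l)) ` b)) (snd (snd (f j)))" if "j < i" for j
      using IH[OF that] unfolding Pr_def by (elim conjE) (erule realizes_uf_mono, auto)
    from morley_uf_extend[OF uUb b(2) smallM, of i "\<lambda>j. snd (snd (f j))", OF this]
    obtain B' where B': "\<And>j. j < i \<Longrightarrow> B' j = snd (snd (f j))" "morley_uf S b Ub M B'" by blast
    obtain A where A: "\<And>j. same_type S (a <+> b) M (case_sum A (B' j)) (case_sum id id)"
      using kim_common[OF a b kim Ub idb B'(2)] by blast
    have A': "same_type S a M A id" by (rule same_type_map[OF A[of 0]]) force
    have "small \<kappa> (M \<union> (\<Union>j<i. fst (f j) ` a \<union> fst (snd (f j)) ` X))"
      using smallM a X by (intro small_Un small_UN small_image) auto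
    then obtain c where c: "realizes_uf S X U (M \<union> (\<Union>j<i. fst (f j) ` a \<union> fst (snd (f j)) ` X)) c"
      using realizes_uf_exists[OF uU X] by blast
    have "small \<kappa> (M \<union> (\<Union>j<i. fst (snd (f j)) ` X \<union> snd (snd (f j)) ` b))"
      using smallM b X by (intro small_Un small_UN small_image) auto
    then obtain B'' where B'': "realizes_uf S b Ub (M \<union> (\<Union>j<i. fst (snd (f j)) ` X \<union> snd (snd
        (f j)) ` b)) B''"
      using realizes_uf_exists[OF uUb b(2)] by blast
    have "Pr f i (A, c, B'')" unfolding Pr_def fst_conv snd_conv
    proof (intro conjI allI impI A' c B'')
      fix j assume "j < i"
      then show "same_type S (a <+> b) M (case_sum A (snd (snd (f j)))) (case_sum id id)"
        using A[of j] B'(1) by simp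
    qed
    then show "\<exists>r. Pr f i r" by (intro exI[of _ "(A, c, B'')"])
  qed
  then obtain f where f: "\<And>i. Pr f i (f i)" by blast
  define As where "As i = fst (f i)" for i
  define cs where "cs i = fst (snd (f i))" for i
  define Bs where "Bs i = snd (snd (f i))" for i
  have As0: "same_type S a M (As i) id" for i
    using f[of i] unfolding Pr_def As_def by blast
  have As: "same_type S (a <+> b) M (case_sum (As i) (Bs j)) (case_sum id id)" if "j < i" for i j
    using f[of i] that unfolding Pr_def As_def Bs_def by blast
  have cs: "realizes_uf S X U (M \<union> (\<Union>j<i. As j ` a \<union> cs j ` X)) (cs i)" for i
    using f[of i] unfolding Pr_def As_def cs_def by blast
  have Bs: "realizes_uf S b Ub (M \<union> (\<Union>j<i. cs j ` X \<union> Bs j ` b)) (Bs i)" for i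
    using f[of i] unfolding Pr_def Bs_def cs_def by blast
  have cs_morley_uf: "morley_uf S X U (M \<union> (\<Union>j<n. As j ` a)) (\<lambda>j. cs (n + j))" for n
    unfolding morley_uf_def by (rule allI, rule realizes_uf_mono[OF cs]) (auto, force+)
  have Bs_morley_uf: "morley_uf S b Ub (M \<union> (\<Union>j<n. cs j ` X)) (\<lambda>j. Bs (n + j))" for n
    unfolding morley_uf_def by (rule allI, rule realizes_uf_mono[OF Bs]) (auto, force+)
  have F': "F (case_sum (\<lambda>(j, x). cs (n + j) x) (As m))" if "m < n" for m n
  proof -
    have "morley_uf S X U (M \<union> As m ` a) (\<lambda>j. cs (n + j))"
      by (rule morley_uf_mono[OF cs_morley_uf]) (use that in auto)
    from morley_uf_same_type[OF U As0 this] Ca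
    have "same_type S (a <+> UNIV \<times> X) M (case_sum (As m) (\<lambda>(j, x). cs (n + j) x)) (case_sum id
        (case_prod Ca))"
      by simp
    from same_typeD[OF same_type_swap[OF this] F(1)] F(2) show ?thesis by simp
  qed
  \<comment> \<open>With \<open>k \<ge> N\<close> a block of \<open>B\<close> contains the terms
    used by \<open>G\<close>, and \<open>k \<ge> 1\<close> separates the starting points of the
    blocks. Only the \<open>C\<close> side of \<open>H\<close> is cut to a block: it must lie before
    the whole tail of \<open>B\<close>.\<close>
  obtain k where k: "k \<ge> max N 1" "definable S ({..<k} \<times> X <+> UNIV \<times> b) M H"
    using seq_support[OF H(1)] by blast
  have lt: "k * m + j < k * n" if "m < n" "j < k" for m n j
  proof -
    have "k * m + j < k * Suc m" using that(2) by simp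
    also have "\<dots> \<le> k * n" using that(1) by (intro mult_le_mono2) simp
    finally show ?thesis .
  qed
  have H': "H (case_sum (\<lambda>(j, x). cs (k * m + j) x) (\<lambda>(j, y). Bs (k * n + j) y))" if "m < n" for m n
  proof -
    let ?c = "\<lambda>(j, x). cs (k * m + j) x"
    have "morley_uf S X U M (\<lambda>j. cs (k * m + j))" by (rule morley_uf_mono[OF cs_morley_uf]) auto
    from morley_uf_same_type0[OF U this C] have eq: "same_type S ({..<k} \<times> X) M ?c (case_prod C)"
      by (rule same_type_mono) auto
    have "morley_uf S b Ub (M \<union> ?c ` ({..<k} \<times> X)) (\<lambda>j. Bs (k * n + j))"
      by (rule morley_uf_mono[OF Bs_morley_uf]) (use lt[OF that] in auto)
    moreover have "morley_uf S b Ub (M \<union> case_prod C ` ({..<k} \<times> X)) B"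
      by (rule morley_uf_mono[OF B]) auto
    ultimately have "same_type S ({..<k} \<times> X <+> UNIV \<times> b) M (case_sum ?c (\<lambda>(j, y). Bs
        (k * n + j) y))
        (case_sum (case_prod C) (case_prod B))"
      by (rule morley_uf_same_type[OF Ub eq])
    from same_typeD[OF this k(2)] H(2) show ?thesis by simp
  qed
  define R where "R e e' \<longleftrightarrow> (\<forall>i\<in>{..<N}. G (case_sum (e' \<circ> Inl) (\<lambda>y. e (Inr (Inr (i, y)))))) \<and>
      F (case_sum (e' \<circ> Inr \<circ> Inl) (e \<circ> Inl)) \<and> H (case_sum (e \<circ> Inr \<circ> Inl) (e' \<circ> Inr \<circ> Inr))"
    for e e' :: "'m + nat \<times> 'v + nat \<times> 'm \<Rightarrow> 'm"
  let ?V = "a <+> (UNIV :: nat set) \<times> X <+> (UNIV :: nat set) \<times> b"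
  have "SOP 3 S"
  proof (rule SOP3I)
    show "definable S (?V <+> ?V) UNIV (\<lambda>z. R (z \<circ> Inl) (z \<circ> Inr))"
      unfolding R_def
    proof (intro definable_conj definable_ball finite_lessThan)
      show "definable S (?V <+> ?V) UNIV (\<lambda>z. G (case_sum (z \<circ> Inr \<circ> Inl) (\<lambda>y. (z \<circ> Inl) (Inr (Inr
          (i, y))))))" for i
        by (rule definable_subst[OF G(1)]) (auto intro!: coordinate_intros)
      show "definable S (?V <+> ?V) UNIV (\<lambda>z. F (case_sum (z \<circ> Inr \<circ> Inr \<circ> Inl) (z \<circ> Inl \<circ> Inl)))"
        by (rule definable_subst[OF F(1)]) (auto intro!: coordinate_intros)
      show "definable S (?V <+> ?V) UNIV (\<lambda>z. H (case_sum (z \<circ> Inl \<circ> Inr \<circ> Inl)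
          (z \<circ> Inr \<circ> Inr \<circ> Inr)))"
        by (rule definable_subst[OF H(1)]) (auto intro!: coordinate_intros)
    qed
    show "\<not> (R x y \<and> R y z \<and> R z x)" for x y z
    proof
      assume "R x y \<and> R y z \<and> R z x"
      \<comment> \<open>\<open>A\<close> is taken from \<open>y\<close>, \<open>C\<close> from
        \<open>z\<close> and \<open>B\<close> from \<open>x\<close>: the triple that was assumed not
        to exist.\<close>
      then have "(\<forall>i<N. G (case_sum (y \<circ> Inl) (\<lambda>y. (x \<circ> Inr \<circ> Inr) (i, y)))) \<and>
          F (case_sum (z \<circ> Inr \<circ> Inl) (y \<circ> Inl)) \<and> H (case_sum (z \<circ> Inr \<circ> Inl) (x \<circ> Inr \<circ> Inr))"
        unfolding R_def by simp
      with no show False by blast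
    qed
    \<comment> \<open>The index \<open>k * n\<close> places \<open>A\<close> after all earlier
      blocks of \<open>B\<close> and before all later blocks of \<open>C\<close>.\<close>
    define e where "e n = case_sum (As (k * n)) (case_sum (\<lambda>(j, x). cs (k * n + j) x) (\<lambda>(j, y). Bs
        (k * n + j) y))" for n
    have e: "e n \<circ> Inl = As (k * n)" "e n \<circ> Inr \<circ> Inl = (\<lambda>(j, x). cs (k * n + j) x)"
      "e n \<circ> Inr \<circ> Inr = (\<lambda>(j, y). Bs (k * n + j) y)" "(\<lambda>y. e n (Inr (Inr (i, y)))) = Bs
          (k * n + i)" for n i
      unfolding e_def by (auto simp: fun_eq_iff)
    show "R (e m) (e n)" if "m < n" for m n
      unfolding R_def e
    proof (intro conjI ballI)
      fix i assume "i \<in> {..<N}"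
      then have "k * m + i < k * n" using lt[OF that] k(1) by simp
      from same_typeD[OF As[OF this] G(1)] show "G (case_sum (As (k * n)) (Bs (k * m + i)))"
          using G(2) by simp
    next
      show "F (case_sum (\<lambda>(j, x). cs (k * n + j) x) (As (k * m)))"
        by (rule F') (use lt[OF that, of 0] k(1) in simp)
      show "H (case_sum (\<lambda>(j, x). cs (k * m + j) x) (\<lambda>(j, y). Bs (k * n + j) y))"
          by (rule H'[OF that])
    qed
  qed
  with nsop show False by blast
qed

text \<open>Compactness applied to the finite version. The index set is a sum because the three
  families of formulas constrain different pairs of parts of a single assignment
  \<open>e\<close>.\<close>

lemma amalgam:
  fixes a b :: "'m set" and X :: "'v set" and U :: "('v \<Rightarrow> 'm) set set"
  assumes nsop: "NSOP 3 S" and X: "small \<kappa> X"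
    and a: "small \<kappa> a" and b: "M \<subseteq> b" "small \<kappa> b" and kim: "kim_indep_set S M a b"
    and U: "coheir M U" and Ub: "coheir M Ub" and idb: "realizes_uf S b Ub M id"
    and Ca: "morley_uf S X U (M \<union> a) Ca" and C: "morley_uf S X U M C"
    and B: "morley_uf S b Ub (M \<union> case_prod C ` (UNIV \<times> X)) B"
  shows "\<exists>A C' B'. (\<forall>i. same_type S (a <+> b) M (case_sum id id) (case_sum A (\<lambda>y. B' (i, y)))) \<and>
    same_type S (UNIV \<times> X <+> a) M (case_sum (case_prod Ca) id) (case_sum C' A) \<and>
    same_type S (UNIV \<times> X <+> UNIV \<times> b) M (case_sum (case_prod C) (case_prod B)) (case_sum C' B')"
proof -
  define IG where "IG = {G. definable S (a <+> b) M G \<and> G (case_sum id id)} \<times> (UNIV :: nat set)"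
  define IF where "IF = {F. definable S (UNIV \<times> X <+> a) M F \<and> F (case_sum (case_prod Ca) id)}"
  define IH where "IH = {H. definable S (UNIV \<times> X <+> UNIV \<times> b) M H \<and>
      H (case_sum (case_prod C) (case_prod B))}"
  define D where "D t e \<longleftrightarrow> (case t of Inl x \<Rightarrow> fst x (case_sum (e \<circ> Inl) (\<lambda>y. e (Inr (Inr
      (snd x, y)))))
      | Inr (Inl F) \<Rightarrow> F (case_sum (e \<circ> Inr \<circ> Inl) (e \<circ> Inl))
      | Inr (Inr H) \<Rightarrow> H (case_sum (e \<circ> Inr \<circ> Inl) (e \<circ> Inr \<circ> Inr)))"
    for t and e :: "'m + nat \<times> 'v + nat \<times> 'm \<Rightarrow> 'm"
  let ?V = "a <+> (UNIV :: nat set) \<times> X <+> (UNIV :: nat set) \<times> b"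
  have "\<exists>e. \<forall>t\<in>IG <+> IF <+> IH. D t e"
  proof (rule realize_indexed)
    show "small \<kappa> ?V" using a b X by (intro small_Plus small_nat_Times)
    show "small \<kappa> M" by (rule smallM)
    show "definable S ?V M (D t)" if "t \<in> IG <+> IF <+> IH" for t
    proof -
      consider x where "x \<in> IG" "t = Inl x" | F where "F \<in> IF" "t = Inr (Inl F)" | H
          where "H \<in> IH" "t = Inr (Inr H)"
        using \<open>t \<in> IG <+> IF <+> IH\<close> by blast
      then show ?thesis
      proof cases
        case 1
        then have "definable S (a <+> b) M (fst x)" unfolding IG_def by auto
        then show ?thesis unfolding D_def 1(2) sum.case
          by (rule definable_subst) (auto intro!: coordinate_intros)
      next
        case 2
        then have "definable S (UNIV \<times> X <+> a) M F" unfolding IF_def by auto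
        then show ?thesis unfolding D_def 2(2) sum.case
          by (rule definable_subst) (auto intro!: coordinate_intros)
      next
        case 3
        then have "definable S (UNIV \<times> X <+> UNIV \<times> b) M H" unfolding IH_def by auto
        then show ?thesis unfolding D_def 3(2) sum.case
          by (rule definable_subst) (auto intro!: coordinate_intros)
      qed
    qed
    fix J assume J: "J \<subseteq> IG <+> IF <+> IH" "finite J"
    define JG where "JG = Inl -` J"
    define JF where "JF = Inl -` Inr -` J"
    define JH where "JH = Inr -` Inr -` J"
    have fin: "finite JG" "finite JF" "finite JH"
      unfolding JG_def JF_def JH_def using J(2) by (auto intro!: finite_vimageI)
    have sub: "JG \<subseteq> IG" "JF \<subseteq> IF" "JH \<subseteq> IH" unfolding JG_def JF_def JH_def using J(1) by auto
    obtain N where N: "\<forall>i\<in>snd ` JG. i < N" using fin(1) finite_nat_set_iff_bounded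
        by (meson finite_imageI)
    have "\<exists>A C B. (\<forall>i<N. \<forall>G\<in>fst ` JG. G (case_sum A (\<lambda>y. B (i, y)))) \<and> (\<forall>F\<in>JF. F (case_sum C A)) \<and>
        (\<forall>H\<in>JH. H (case_sum C B))"
    proof (rule amalgam_fin[OF nsop X a b kim U Ub idb Ca C B])
      show "definable S (a <+> b) M (\<lambda>e. \<forall>G\<in>fst ` JG. G e)"
        by (rule definable_ball) (use fin(1) sub(1) in \<open>auto simp: IG_def\<close>)
      show "\<forall>G\<in>fst ` JG. G (case_sum id id)" using sub(1) unfolding IG_def by auto
      show "definable S (UNIV \<times> X <+> a) M (\<lambda>e. \<forall>F\<in>JF. F e)"
        by (rule definable_ball) (use fin(2) sub(2) in \<open>auto simp: IF_def\<close>)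
      show "\<forall>F\<in>JF. F (case_sum (case_prod Ca) id)" using sub(2) unfolding IF_def by auto
      show "definable S (UNIV \<times> X <+> UNIV \<times> b) M (\<lambda>e. \<forall>H\<in>JH. H e)"
        by (rule definable_ball) (use fin(3) sub(3) in \<open>auto simp: IH_def\<close>)
      show "\<forall>H\<in>JH. H (case_sum (case_prod C) (case_prod B))" using sub(3) unfolding IH_def by auto
    qed
    then obtain A C' B' where "\<forall>i<N. \<forall>G\<in>fst ` JG. G (case_sum A (\<lambda>y. B' (i, y)))"
      "\<forall>F\<in>JF. F (case_sum C' A)" "\<forall>H\<in>JH. H (case_sum C' B')" by (elim exE conjE)
    note ACB = this[rule_format]
    define e where "e = case_sum A (case_sum C' B')"
    have e: "e \<circ> Inl = A" "e \<circ> Inr \<circ> Inl = C'" "e \<circ> Inr \<circ> Inr = B'" "(\<lambda>y. e (Inr (Inr (i, y)))) =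
        (\<lambda>y. B' (i, y))" for i
      unfolding e_def by (auto simp: fun_eq_iff)
    have "D t e" if "t \<in> J" for t
    proof -
      have "(\<exists>x\<in>JG. t = Inl x) \<or> (\<exists>F\<in>JF. t = Inr (Inl F)) \<or> (\<exists>H\<in>JH. t = Inr (Inr H))"
      proof (cases t)
        case (Inl x)
        then have "x \<in> JG" using that unfolding JG_def by simp
        then show ?thesis using Inl by blast
      next
        case t: (Inr y)
        show ?thesis
        proof (cases y)
          case (Inl F)
          then have "F \<in> JF" using that t unfolding JF_def by simp
          then show ?thesis using Inl t by blast
        next
          case (Inr H)
          then have "H \<in> JH" using that t unfolding JH_def by simp
          then show ?thesis using Inr t by blast
        qed
      qed
      then consider x where "x \<in> JG" "t = Inl x" | F where "F \<in> JF" "t = Inr (Inl F)" | H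
          where "H \<in> JH" "t = Inr (Inr H)"
        by blast
      then show ?thesis
      proof cases
        case 1
        have "snd x < N" "fst x \<in> fst ` JG" using 1(1) N by auto
        then have "fst x (case_sum A (\<lambda>y. B' (snd x, y)))" by (rule ACB(1)[of "snd x" "fst x"])
        then show ?thesis unfolding D_def 1(2) sum.case e .
      next
        case 2
        then show ?thesis unfolding D_def 2(2) sum.case e by (intro ACB(2)[of F])
      next
        case 3
        then show ?thesis unfolding D_def 3(2) sum.case e by (intro ACB(3)[of H])
      qed
    qed
    then show "\<exists>e. \<forall>t\<in>J. D t e" by (intro exI[of _ e] ballI)
  qed
  then obtain e where e: "\<forall>t\<in>IG <+> IF <+> IH. D t e" by (rule exE)
  have "same_type S (a <+> b) M (case_sum id id) (case_sum (e \<circ> Inl) (\<lambda>y. (e \<circ> Inr \<circ> Inr)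
      (i, y)))" for i
  proof (rule same_typeI)
    fix G assume "definable S (a <+> b) M G" "G (case_sum id id)"
    then have "Inl (G, i) \<in> IG <+> IF <+> IH" unfolding IG_def by auto
    from bspec[OF e this] show "G (case_sum (e \<circ> Inl) (\<lambda>y. (e \<circ> Inr \<circ> Inr) (i, y)))"
      unfolding D_def by simp
  qed
  moreover have "same_type S (UNIV \<times> X <+> a) M (case_sum (case_prod Ca) id) (case_sum
      (e \<circ> Inr \<circ> Inl) (e \<circ> Inl))"
  proof (rule same_typeI)
    fix F assume "definable S (UNIV \<times> X <+> a) M F" "F (case_sum (case_prod Ca) id)"
    then have "Inr (Inl F) \<in> IG <+> IF <+> IH" unfolding IF_def by auto
    from bspec[OF e this] show "F (case_sum (e \<circ> Inr \<circ> Inl) (e \<circ> Inl))" unfolding D_def by simp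
  qed
  moreover have "same_type S (UNIV \<times> X <+> UNIV \<times> b) M (case_sum (case_prod C) (case_prod B))
      (case_sum (e \<circ> Inr \<circ> Inl) (e \<circ> Inr \<circ> Inr))"
  proof (rule same_typeI)
    fix H assume "definable S (UNIV \<times> X <+> UNIV \<times> b) M H" "H (case_sum (case_prod C)
        (case_prod B))"
    then have "Inr (Inr H) \<in> IG <+> IF <+> IH" unfolding IH_def by auto
    from bspec[OF e this] show "H (case_sum (e \<circ> Inr \<circ> Inl) (e \<circ> Inr \<circ> Inr))" unfolding D_def
        by simp
  qed
  ultimately show ?thesis
    by (intro exI[of _ "e \<circ> Inl"] exI[of _ "e \<circ> Inr \<circ> Inl"] exI[of _ "e \<circ> Inr \<circ> Inr"]) simp
qed

text \<open>Here \<open>C\<^sub>n\<close> is chosen along the second type; \<open>A\<^sub>n\<close> comes from the previous lemma, since over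
  \<open>M\<close> the earlier blocks \<open>C\<^sub>m\<close> also look like a Morley sequence of the first type.\<close>

lemma common_morley_fin:
  fixes a b :: "'m set" and X :: "'v set" and U V :: "('v \<Rightarrow> 'm) set set"
  assumes nsop: "NSOP 3 S" and X: "small \<kappa> X"
    and a: "M \<subseteq> a" "small \<kappa> a" and b: "M \<subseteq> b" "small \<kappa> b" and kim: "kim_indep_set S M a b"
    and U: "coheir M U" and V: "coheir M V"
    and UV: "\<And>c c'. \<lbrakk>morley_uf S X U M c; morley_uf S X V M c'\<rbrakk> \<Longrightarrow>
        same_type S (UNIV \<times> X) M (case_prod c) (case_prod c')"
    and Ca: "morley_uf S X U a Ca" and Cb: "morley_uf S X V b Cb"
    and F: "definable S (UNIV \<times> X) a F" "F (case_prod Ca)"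
    and H: "definable S (UNIV \<times> X) b H" "H (case_prod Cb)"
  shows "\<exists>C. F C \<and> H C"
proof (rule ccontr)
  assume no: "\<nexists>C. F C \<and> H C"
  note uU = coheir_ultra[OF U] and uV = coheir_ultra[OF V]
  obtain F' where F': "definable S (UNIV \<times> X <+> a) {} F'" "\<And>C. F C \<longleftrightarrow> F' (case_sum C id)"
    using definable_abs[of S "UNIV \<times> X" "{}" id a F] F(1) by auto
  obtain H' where H': "definable S (UNIV \<times> X <+> b) {} H'" "\<And>C. H C \<longleftrightarrow> H' (case_sum C id)"
    using definable_abs[of S "UNIV \<times> X" "{}" id b H] H(1) by auto
  \<comment> \<open>The assumed failure is itself first-order once \<open>a\<close> and
    \<open>b\<close> are variables, so it passes to every pair with the type of
    \<open>a b\<close>.\<close>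
  define G where "G e \<longleftrightarrow> (\<forall>C. \<not> (F' (case_sum C (e \<circ> Inl)) \<and> H' (case_sum C (e \<circ> Inr))))"
      for e :: "'m + 'm \<Rightarrow> 'm"
  have G: "definable S (a <+> b) {} G" unfolding G_def
  proof (rule definable_all[where W = "UNIV \<times> X"], intro definable_not definable_conj)
    show "definable S ((a <+> b) <+> UNIV \<times> X) {} (\<lambda>e. F' (case_sum (e \<circ> Inr) (e \<circ> Inl \<circ> Inl)))"
      by (rule definable_subst[OF F'(1)]) (auto intro!: coordinate_intros)
    show "definable S ((a <+> b) <+> UNIV \<times> X) {} (\<lambda>e. H' (case_sum (e \<circ> Inr) (e \<circ> Inl \<circ> Inr)))"
      by (rule definable_subst[OF H'(1)]) (auto intro!: coordinate_intros)
  qed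
  have G_id: "G (case_sum id id)"
  proof -
    have "case_sum id id \<circ> Inl = (id :: 'm \<Rightarrow> 'm)" "case_sum id id \<circ> Inr = (id :: 'm \<Rightarrow> 'm)" by auto
    then show ?thesis unfolding G_def using no F'(2) H'(2) by auto
  qed
  obtain Ub where Ub: "coheir M Ub" and idb: "realizes_uf S b Ub M id" using coheir_exists by blast
  note uUb = coheir_ultra[OF Ub]
  obtain C where C: "morley_uf S X U M C" using morley_uf_exists'[OF uU X smallM] by blast
  have "small \<kappa> (M \<union> case_prod C ` (UNIV \<times> X))"
    using smallM X by (intro small_Un small_image small_nat_Times)
  then obtain B where B: "morley_uf S b Ub (M \<union> case_prod C ` (UNIV \<times> X)) B"
    using morley_uf_exists'[OF uUb b(2)] by blast
  have Ca': "morley_uf S X U (M \<union> a) Ca" using Ca a(1) by (simp add: Un_absorb1)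
  from amalgam[OF nsop X a(2) b kim U Ub idb Ca' C B] obtain A C' B' where
    A: "\<And>i. same_type S (a <+> b) M (case_sum id id) (case_sum A (\<lambda>y. B' (i, y)))"
    and CA: "same_type S (UNIV \<times> X <+> a) M (case_sum (case_prod Ca) id) (case_sum C' A)"
    and CB: "same_type S (UNIV \<times> X <+> UNIV \<times> b) M (case_sum (case_prod C) (case_prod B))
        (case_sum C' B')"
    by blast
  \<comment> \<open>Each tuple is generic over all earlier ones of both kinds: tails of
    \<open>C\<close> over an earlier \<open>B\<close> serve for \<open>H'\<close>, tails of
    \<open>B\<close> over the earlier \<open>C\<close> for the transfer of \<open>A\<close>.\<close>
  define Pr where "Pr f i r \<longleftrightarrow>
      realizes_uf S X V (M \<union> (\<Union>j<i. fst (f j) ` X \<union> snd (f j) ` b)) (fst r) \<and>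
      realizes_uf S b Ub (M \<union> (\<Union>j<i. fst (f j) ` X \<union> snd (f j) ` b)) (snd r)"
    for f :: "nat \<Rightarrow> ('v \<Rightarrow> 'm) \<times> ('m \<Rightarrow> 'm)" and i and r
  have "\<exists>f. \<forall>i. Pr f i (f i)"
  proof (rule dependent_wellorder_choice)
    fix r and f g :: "nat \<Rightarrow> ('v \<Rightarrow> 'm) \<times> ('m \<Rightarrow> 'm)" and i :: nat
    assume "\<And>j. j < i \<Longrightarrow> f j = g j"
    then show "Pr f i r = Pr g i r" unfolding Pr_def by simp
  next
    fix f :: "nat \<Rightarrow> ('v \<Rightarrow> 'm) \<times> ('m \<Rightarrow> 'm)" and i :: nat
    have sm: "small \<kappa> (M \<union> (\<Union>j<i. fst (f j) ` X \<union> snd (f j) ` b))"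
      using smallM b X by (intro small_Un small_UN small_image) auto
    obtain c where c: "realizes_uf S X V (M \<union> (\<Union>j<i. fst (f j) ` X \<union> snd (f j) ` b)) c"
      using realizes_uf_exists[OF uV X sm] by blast
    obtain d where d: "realizes_uf S b Ub (M \<union> (\<Union>j<i. fst (f j) ` X \<union> snd (f j) ` b)) d"
      using realizes_uf_exists[OF uUb b(2) sm] by blast
    show "\<exists>r. Pr f i r" unfolding Pr_def by (intro exI[of _ "(c, d)"]) (simp add: c d)
  qed
  then obtain f where f: "\<And>i. Pr f i (f i)" by blast
  define cs where "cs i = fst (f i)" for i
  define Bs where "Bs i = snd (f i)" for i
  have cs: "realizes_uf S X V (M \<union> (\<Union>j<i. cs j ` X \<union> Bs j ` b)) (cs i)"
    and Bs: "realizes_uf S b Ub (M \<union> (\<Union>j<i. cs j ` X \<union> Bs j ` b)) (Bs i)" for i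
    using f[of i] unfolding Pr_def cs_def Bs_def by blast+
  have cs_morley_uf: "morley_uf S X V (M \<union> (\<Union>j<n. Bs j ` b)) (\<lambda>j. cs (n + j))" for n
    unfolding morley_uf_def by (rule allI, rule realizes_uf_mono[OF cs]) (auto, force+)
  have Bs_morley_uf: "morley_uf S b Ub (M \<union> (\<Union>j<n. cs j ` X)) (\<lambda>j. Bs (n + j))" for n
    unfolding morley_uf_def by (rule allI, rule realizes_uf_mono[OF Bs]) (auto, force+)
  \<comment> \<open>Only \<open>F'\<close> needs blocks: its \<open>C\<close> entries must precede
    \<open>A\<^sub>n\<close>, while for \<open>H'\<close> the entire tail of \<open>C\<close> after
    \<open>B\<^sub>m\<close> is available.\<close>
  obtain k where k: "k \<ge> 1" "definable S ({..<k} \<times> X <+> a) {} F'"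
    using seq_support[OF F'(1)] by blast
  have lt: "k * m + j < k * n" if "m < n" "j < k" for m n j
  proof -
    have "k * m + j < k * Suc m" using that(2) by simp
    also have "\<dots> \<le> k * n" using that(1) by (intro mult_le_mono2) simp
    finally show ?thesis .
  qed
  have H_cs: "H' (case_sum (\<lambda>(j, x). cs (n + j) x) (Bs m))" if "m < n" for m n
  proof -
    have "morley_uf S X V (M \<union> Bs m ` b) (\<lambda>j. cs (n + j))"
      by (rule morley_uf_mono[OF cs_morley_uf]) (use that in auto)
    moreover have "same_type S b M (Bs m) id"
      by (rule realizes_uf_same_type0[OF uUb realizes_uf_mono[OF Bs] idb]) auto
    moreover have "morley_uf S X V (M \<union> id ` b) Cb" using Cb b(1) by (simp add: Un_absorb1)
    ultimately have "same_type S (b <+> UNIV \<times> X) M (case_sum (Bs m) (\<lambda>(j, x). cs (n + j) x))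
        (case_sum id (case_prod Cb))"
      by (intro morley_uf_same_type[OF V])
    from same_typeD[OF same_type_swap[OF this] definable_mono[OF H'(1) order_refl empty_subsetI]]
        show ?thesis
      using H(2) H'(2) by simp
  qed
  \<comment> \<open>A tail of a Morley sequence over \<open>a\<close> is again one; this makes
    \<open>F'\<close> available for blocks that start at any position.\<close>
  have F_Ca: "F' (case_sum (\<lambda>(j, x). Ca (n + j) x) id)" for n
  proof -
    have "morley_uf S X U (M \<union> id ` a) (\<lambda>j. Ca (n + j))"
      using morley_uf_subseq[OF Ca', of "\<lambda>j. n + j"] by (simp add: strict_mono_def)
    moreover have "morley_uf S X U (M \<union> id ` a) Ca" using Ca' by simp
    ultimately have "same_type S (a <+> UNIV \<times> X) M (case_sum id (\<lambda>(j, x). Ca (n + j) x))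
        (case_sum id (case_prod Ca))"
      by (rule morley_uf_same_type[OF U same_type_refl])
    from same_typeD[OF same_type_swap[OF this] definable_mono[OF F'(1) order_refl empty_subsetI]]
        show ?thesis
      using F(2) F'(2) by simp
  qed
  \<comment> \<open>The \<open>C\<close> before \<open>k * n\<close> together with the tail of
    \<open>B\<close> from there on have the type over \<open>M\<close> of the corresponding part of
    \<open>C'\<close> and \<open>B'\<close>: the first part by \<open>UV\<close>, the rest because
    the tail is Morley over it. Homogeneity then moves \<open>A\<close> to
    \<open>An\<close>.\<close>
  have "\<exists>An. (\<forall>m>n. G (case_sum An (Bs (k * m)))) \<and>
      (\<forall>m<n. F' (case_sum (\<lambda>(j, x). cs (k * m + j) x) An))" for n
  proof -
    let ?W = "{..<k * n} \<times> X"
    let ?V = "?W <+> (UNIV :: nat set) \<times> b"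
    let ?u = "case_sum (case_prod cs) (\<lambda>(j, y). Bs (k * n + j) y)"
    have csV: "morley_uf S X V M cs" using cs_morley_uf[of 0] by simp
    have eq: "same_type S ?W M (case_prod C) (case_prod cs)"
      by (rule same_type_mono[OF UV[OF C csV]]) auto
    have "morley_uf S b Ub (M \<union> case_prod C ` ?W) B"
      by (rule morley_uf_mono[OF B]) auto
    moreover have "morley_uf S b Ub (M \<union> case_prod cs ` ?W) (\<lambda>j. Bs (k * n + j))"
      by (rule morley_uf_mono[OF Bs_morley_uf]) auto
    ultimately have "same_type S ?V M (case_sum (case_prod C) (case_prod B)) ?u"
      by (rule morley_uf_same_type[OF Ub eq])
    moreover have "same_type S ?V M (case_sum C' B') (case_sum (case_prod C) (case_prod B))"
      by (rule same_type_sym, rule same_type_mono[OF CB]) auto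
    ultimately have "same_type S ?V M (case_sum C' B') ?u" by (rule same_type_trans[rotated])
    moreover have "small \<kappa> ?V"
      using small_subset[OF small_nat_Times[OF X], of ?W] small_nat_Times[OF b(2)]
      by (intro small_Plus) auto
    ultimately obtain An where An: "same_type S (?V <+> a) M (case_sum (case_sum C' B') A)
        (case_sum ?u An)"
      using homogeneous[OF _ a(2) smallM] by blast
    have "G (case_sum An (Bs (k * m)))" if "n < m" for m
    proof -
      \<comment> \<open>The term of \<open>B\<close> with index \<open>k * m\<close> is term
        \<open>?j\<close> of the tail that starts at \<open>k * n\<close>.\<close>
      let ?j = "k * m - k * n"
      have j: "k * n + ?j = k * m" using that by simp
      have "same_type S (a <+> b) M (case_sum A (\<lambda>y. B' (?j, y))) (case_sum An (Bs (k * m)))"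
      proof (rule same_type_map[OF An])
        fix l assume "l \<in> a <+> b"
        then show "\<exists>v\<in>?V <+> a. case_sum A (\<lambda>y. B' (?j, y)) l = case_sum (case_sum C' B') A v \<and>
            case_sum An (Bs (k * m)) l = case_sum ?u An v"
        proof (elim PlusE)
          fix x assume "x \<in> a" "l = Inl x"
          then show ?thesis by (intro bexI[of _ "Inr x"]) auto
        next
          fix y assume "y \<in> b" "l = Inr y"
          then show ?thesis by (intro bexI[of _ "Inl (Inr (?j, y))"]) (auto simp: j)
        qed
      qed
      from same_typeD[OF same_type_trans[OF A this] definable_mono[OF G order_refl empty_subsetI]]
          show ?thesis using G_id by simp
    qed
    moreover have "F' (case_sum (\<lambda>(j, x). cs (k * m + j) x) An)" if "m < n" for m
    proof -
      have "same_type S ({..<k} \<times> X <+> a) M (case_sum (\<lambda>(j, x). Ca (k * m + j) x) id) (case_sum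
          (\<lambda>(j, x). C' (k * m + j, x)) A)"
      proof (rule same_type_map[OF CA])
        fix l assume "l \<in> {..<k} \<times> X <+> a"
        then show "\<exists>v\<in>UNIV \<times> X <+> a. case_sum (\<lambda>(j, x). Ca (k * m + j) x) id l = case_sum
            (case_prod Ca) id v \<and>
            case_sum (\<lambda>(j, x). C' (k * m + j, x)) A l = case_sum C' A v"
        proof (elim PlusE)
          fix z assume "z \<in> {..<k} \<times> X" "l = Inl z"
          then show ?thesis by (intro bexI[of _ "Inl
              (k * m + fst z, snd z)"]) (auto split: prod.split)
        next
          fix x assume "x \<in> a" "l = Inr x"
          then show ?thesis by (intro bexI[of _ "Inr x"]) auto
        qed
      qed
      moreover have "same_type S ({..<k} \<times> X <+> a) M (case_sum (\<lambda>(j, x). C' (k * m + j, x)) A)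
          (case_sum (\<lambda>(j, x). cs (k * m + j) x) An)"
      proof (rule same_type_map[OF An])
        fix l assume "l \<in> {..<k} \<times> X <+> a"
        then show "\<exists>v\<in>?V <+> a. case_sum (\<lambda>(j, x). C' (k * m + j, x)) A l = case_sum
            (case_sum C' B') A v \<and>
            case_sum (\<lambda>(j, x). cs (k * m + j) x) An l = case_sum ?u An v"
        proof (elim PlusE)
          fix z assume z: "z \<in> {..<k} \<times> X" "l = Inl z"
          have "(k * m + fst z, snd z) \<in> ?W" using z(1) lt[OF that] by auto
          then show ?thesis using z(2)
            by (intro bexI[of _ "Inl (Inl (k * m + fst z, snd z))"]) (auto split: prod.split)
        next
          fix x assume "x \<in> a" "l = Inr x"
          then show ?thesis by (intro bexI[of _ "Inr x"]) auto
        qed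
      qed
      ultimately have "same_type S ({..<k} \<times> X <+> a) M (case_sum (\<lambda>(j, x). Ca (k * m + j) x) id)
          (case_sum (\<lambda>(j, x). cs (k * m + j) x) An)" by (rule same_type_trans)
      from same_typeD[OF this definable_mono[OF k(2) order_refl empty_subsetI]] F_Ca show ?thesis
          by blast
    qed
    ultimately show ?thesis by blast
  qed
  then obtain As where As: "\<And>m n. n < m \<Longrightarrow> G (case_sum (As n) (Bs (k * m)))"
    "\<And>m n. m < n \<Longrightarrow> F' (case_sum (\<lambda>(j, x). cs (k * m + j) x) (As n))" by metis
  define R where "R e e' \<longleftrightarrow> G (case_sum (e \<circ> Inl) (e' \<circ> Inr \<circ> Inr)) \<and>
      F' (case_sum (e \<circ> Inr \<circ> Inl) (e' \<circ> Inl)) \<and> H' (case_sum (e' \<circ> Inr \<circ> Inl) (e \<circ> Inr \<circ> Inr))"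
    for e e' :: "'m + nat \<times> 'v + 'm \<Rightarrow> 'm"
  let ?V = "a <+> (UNIV :: nat set) \<times> X <+> b"
  have "SOP 3 S"
  proof (rule SOP3I)
    show "definable S (?V <+> ?V) UNIV (\<lambda>z. R (z \<circ> Inl) (z \<circ> Inr))"
      unfolding R_def
    proof (intro definable_conj)
      show "definable S (?V <+> ?V) UNIV (\<lambda>z. G (case_sum (z \<circ> Inl \<circ> Inl) (z \<circ> Inr \<circ> Inr \<circ> Inr)))"
        by (rule definable_subst[OF G]) (auto intro!: coordinate_intros)
      show "definable S (?V <+> ?V) UNIV (\<lambda>z. F' (case_sum (z \<circ> Inl \<circ> Inr \<circ> Inl) (z \<circ> Inr \<circ> Inl)))"
        by (rule definable_subst[OF F'(1)]) (auto intro!: coordinate_intros)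
      show "definable S (?V <+> ?V) UNIV (\<lambda>z. H' (case_sum (z \<circ> Inr \<circ> Inr \<circ> Inl)
          (z \<circ> Inl \<circ> Inr \<circ> Inr)))"
        by (rule definable_subst[OF H'(1)]) (auto intro!: coordinate_intros)
    qed
    show "\<not> (R x y \<and> R y z \<and> R z x)" for x y z
    proof
      assume "R x y \<and> R y z \<and> R z x"
      \<comment> \<open>\<open>A\<close> comes from \<open>z\<close>, \<open>C\<close> from
        \<open>y\<close> and \<open>B\<close> from \<open>x\<close>; this \<open>C\<close> is what
        \<open>G\<close> excludes for \<open>A\<close> and \<open>B\<close>.\<close>
      then have "G (case_sum (z \<circ> Inl) (x \<circ> Inr \<circ> Inr))" "F' (case_sum (y \<circ> Inr \<circ> Inl) (z \<circ> Inl))"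
        "H' (case_sum (y \<circ> Inr \<circ> Inl) (x \<circ> Inr \<circ> Inr))" unfolding R_def by blast+
      then show False unfolding G_def by (simp add: comp_def)
    qed
    define e where "e n = case_sum (As n) (case_sum (\<lambda>(j, x). cs (k * n + j) x) (Bs (k * n)))" for n
    have e: "e n \<circ> Inl = As n" "e n \<circ> Inr \<circ> Inl = (\<lambda>(j, x). cs
        (k * n + j) x)" "e n \<circ> Inr \<circ> Inr = Bs (k * n)" for n
      unfolding e_def by (auto simp: fun_eq_iff)
    show "R (e m) (e n)" if "m < n" for m n
      unfolding R_def e using As that H_cs lt[OF that, of 0] k(1) by simp
  qed
  with nsop show False by blast
qed

lemma common_morley:
  fixes a b :: "'m set" and X :: "'v set" and U V :: "('v \<Rightarrow> 'm) set set"
  assumes nsop: "NSOP 3 S" and X: "small \<kappa> X"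
    and a: "M \<subseteq> a" "small \<kappa> a" and b: "M \<subseteq> b" "small \<kappa> b" and kim: "kim_indep_set S M a b"
    and U: "coheir M U" and V: "coheir M V"
    and UV: "\<And>c c'. \<lbrakk>morley_uf S X U M c; morley_uf S X V M c'\<rbrakk> \<Longrightarrow>
        same_type S (UNIV \<times> X) M (case_prod c) (case_prod c')"
    and Ca: "morley_uf S X U a Ca" and Cb: "morley_uf S X V b Cb"
  shows "\<exists>C. same_type S (UNIV \<times> X) a (case_prod Ca) C \<and> same_type S (UNIV \<times> X) b (case_prod Cb) C"
proof -
  define IF where "IF = {F. definable S (UNIV \<times> X) a F \<and> F (case_prod Ca)}"
  define IH where "IH = {H. definable S (UNIV \<times> X) b H \<and> H (case_prod Cb)}"
  have "\<exists>C. \<forall>G\<in>IF \<union> IH. G C"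
  proof (rule realize)
    show "small \<kappa> ((UNIV :: nat set) \<times> X)" "small \<kappa> (a \<union> b)"
      using small_nat_Times[OF X] small_Un[OF a(2) b(2)] by blast+
    show "definable S (UNIV \<times> X) (a \<union> b) G" if "G \<in> IF \<union> IH" for G
      using that unfolding IF_def IH_def
      by (elim UnE) (auto elim!: definable_mono)
    fix J assume J: "J \<subseteq> IF \<union> IH" "finite J"
    have "\<exists>C. (\<forall>G\<in>J \<inter> IF. G C) \<and> (\<forall>G\<in>J \<inter> IH. G C)"
    proof (rule common_morley_fin[OF nsop X a b kim U V UV Ca Cb])
      show "definable S (UNIV \<times> X) a (\<lambda>C. \<forall>G\<in>J \<inter> IF. G C)"
        by (rule definable_ball) (use J(2) in \<open>auto simp: IF_def\<close>)
      show "definable S (UNIV \<times> X) b (\<lambda>C. \<forall>G\<in>J \<inter> IH. G C)"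
        by (rule definable_ball) (use J(2) in \<open>auto simp: IH_def\<close>)
    qed (simp_all add: IF_def IH_def)
    then obtain C where "(\<forall>G\<in>J \<inter> IF. G C) \<and> (\<forall>G\<in>J \<inter> IH. G C)" by (rule exE)
    then have "\<forall>G\<in>J. G C" using J(1) by auto
    then show "\<exists>C. \<forall>G\<in>J. G C" by (intro exI[of _ C])
  qed
  then obtain C where C: "\<forall>G\<in>IF \<union> IH. G C" by (rule exE)
  have "same_type S (UNIV \<times> X) a (case_prod Ca) C"
  proof (rule same_typeI)
    fix G assume "definable S (UNIV \<times> X) a G" "G (case_prod Ca)"
    then have "G \<in> IF \<union> IH" unfolding IF_def by blast
    from bspec[OF C this] show "G C" .
  qed
  moreover have "same_type S (UNIV \<times> X) b (case_prod Cb) C"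
  proof (rule same_typeI)
    fix G assume "definable S (UNIV \<times> X) b G" "G (case_prod Cb)"
    then have "G \<in> IF \<union> IH" unfolding IH_def by blast
    from bspec[OF C this] show "G C" .
  qed
  ultimately show ?thesis by blast
qed

end

subsection \<open>Conant-independence\<close>

context monster_model begin

text \<open>A formula in \<open>tp(D/M c)\<close> is satisfied simultaneously along a whole Morley sequence starting
  with \<open>c\<close>. If it implies a finite disjunction with further parameters \<open>E\<close>, the sequence is chosen
  to be the restriction of a Morley sequence starting with \<open>(c,E)\<close>, and one disjunct holds
  infinitely often along it.\<close>

lemma conant_indep_from_sequence:
  fixes D :: "'m set" and X :: "'v set" and U :: "('v \<Rightarrow> 'm) set set"
  assumes X: "small \<kappa> X" and D: "small \<kappa> D" and U: "coheir M U"
    and cU: "realizes_uf S X U M c" and C0: "morley_uf S X U M C0"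
    and C: "same_type S (UNIV \<times> X) M (case_prod C0) C"
    and lim: "\<And>\<Theta>. \<lbrakk>definable S (D <+> X) M \<Theta>; \<Theta> (case_sum id c)\<rbrakk>
      \<Longrightarrow> infinite {i. \<Theta> (case_sum id (\<lambda>x. C (i, x)))}"
  shows "conant_indep_set S M D (c ` X)"
  unfolding conant_indep_def
proof (intro ballI notI)
  fix \<theta> assume \<theta>: "\<theta> \<in> tp S D id (M \<union> c ` X)" and fork: "conant_forks S D M \<theta>"
  from fork obtain F where F0: "finite F \<and> (\<forall>(\<psi>, n, d)\<in>F. \<psi> \<in> fms S D {..<n} \<and>
      conant_divides S M \<psi> n d) \<and>
      (\<forall>z. satisfies S z \<theta> \<longrightarrow> (\<exists>(\<psi>, n, d)\<in>F. satisfies S z (inst \<psi> d)))"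
    unfolding conant_forks_def implies_dividing_def by (rule exE)
  have F1: "finite F" by (rule conjunct1[OF F0])
  have F2: "\<psi> \<in> fms S D {..<n} \<and> conant_divides S M \<psi> n d" if "(\<psi>, n, d) \<in> F" for \<psi> n d
    using bspec[OF conjunct1[OF conjunct2[OF F0]] that] by simp
  note F3 = conjunct2[OF conjunct2[OF F0], rule_format]
  have "definable S D (M \<union> c ` X) (\<lambda>z. satisfies S z \<theta>)"
    by (rule definable_satisfies) (use \<theta> in \<open>simp add: tp_def\<close>)
  from definable_abs[OF this] obtain \<Theta> where \<Theta>: "definable S (D <+> X) M \<Theta>"
    "\<And>z. satisfies S z \<theta> \<longleftrightarrow> \<Theta> (case_sum z c)" by blast
  have \<Theta>_id: "\<Theta> (case_sum id c)" using \<theta> \<Theta>(2) unfolding tp_def by simp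
  \<comment> \<open>The disjuncts may have parameters outside \<open>M\<close> and the tuple
    \<open>c\<close>; these have to move along with \<open>c\<close>.\<close>
  define E where "E = (\<Union>(\<psi>, n, d)\<in>F. d ` {..<n})"
  have E: "d ` {..<n} \<subseteq> E" if "(\<psi>, n, d) \<in> F" for \<psi> n d using that unfolding E_def by blast
  have "small \<kappa> E" unfolding E_def using F1 by (intro small_finite) auto
  then have smV: "small \<kappa> (X <+> E)" using X by (intro small_Plus)
  obtain U' where U': "coheir M U'" "pushforward Inl U' = U" "realizes_uf S (X <+> E) U' M
      (case_sum c id)"
    using coheir_extend[OF U cU, of E id] by blast
  obtain e where e: "e 0 = case_sum c id" "morley_uf S (X <+> E) U' M e"
    using morley_uf_exists[OF coheir_ultra[OF U'(1)] smV smallM U'(3)] by blast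
  have e_C: "morley_uf S X U M (\<lambda>i. e i \<circ> Inl)"
    using morley_uf_push[OF e(2), of Inl X] unfolding U'(2) by auto

  \<comment> \<open>By \<open>lim\<close>, the formula \<open>\<Theta>\<close> holds for
    \<open>id\<close> along some subsequence of \<open>C\<close>. That subsequence and the
    restriction of \<open>e\<close> both have the type of a Morley sequence of \<open>U\<close>, so
    finite consistency moves to the latter.\<close>
  have "\<exists>z. \<forall>i\<in>UNIV. \<Theta> (case_sum z (e i \<circ> Inl))"
  proof (rule realize_indexed[OF D])
    show "small \<kappa> (M \<union> (\<lambda>(i, l). e i l) ` (UNIV \<times> (X <+> E)))"
      using smallM smV by (intro small_Un small_image small_nat_Times)
    show "definable S D (M \<union> (\<lambda>(i, l). e i l) ` (UNIV \<times> (X <+> E))) (\<lambda>z. \<Theta> (case_sum z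
        (e i \<circ> Inl)))" for i
      by (rule definable_subst[OF \<Theta>(1)]) (force intro!: coordinate_intros)+
    fix J :: "nat set" assume "finite J"
    then obtain N where N: "\<forall>i\<in>J. i < N" using finite_nat_set_iff_bounded by meson
    obtain r where "strict_mono r \<and> (\<forall>n :: nat. r n \<in> {i. \<Theta> (case_sum id (\<lambda>x. C (i, x)))})"
      using infinite_enumerate[OF lim[OF \<Theta>(1) \<Theta>_id]] by (rule exE)
    then have r: "strict_mono r" "\<And>i. \<Theta> (case_sum id (\<lambda>x. C (r i, x)))" by simp_all
    define Q where "Q y \<longleftrightarrow> (\<exists>z. \<forall>i\<in>{..<N}. \<Theta> (case_sum z (\<lambda>x. y (i, x))))" for y
    have Q: "definable S (UNIV \<times> X) M Q" unfolding Q_def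
    proof (rule definable_ex[where W = D], intro definable_ball finite_lessThan)
      show "definable S (UNIV \<times> X <+> D) M (\<lambda>e. \<Theta> (case_sum (e \<circ> Inr) (\<lambda>x. (e \<circ> Inl) (i, x))))"
          for i
        by (rule definable_subst[OF \<Theta>(1)]) (auto intro!: coordinate_intros)
    qed
    have "same_type S (UNIV \<times> X) M (\<lambda>(i, x). C0 (r i) x) (\<lambda>(i, x). C (r i, x))"
      by (rule same_type_map[OF C]) force
    from same_typeD[OF same_type_trans[OF morley_uf_same_type0[OF U e_C morley_uf_subseq[OF C0
        r(1)]] this] Q]
    have "Q (\<lambda>(i, x). (e i \<circ> Inl) x)" using r(2) unfolding Q_def by auto
    then obtain z where "\<And>i. i < N \<Longrightarrow> \<Theta> (case_sum z (e i \<circ> Inl))" unfolding Q_def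
        by (auto simp: comp_def)
    then show "\<exists>z. \<forall>i\<in>J. \<Theta> (case_sum z (e i \<circ> Inl))" using N by blast
  qed
  then obtain z where z: "\<And>i. \<Theta> (case_sum z (e i \<circ> Inl))" by blast

  \<comment> \<open>That \<open>\<Theta>\<close> implies the disjunction is a property of the tuple
    \<open>(c, E)\<close> over \<open>M\<close>, hence shared by every term
    \<open>e i\<close>.\<close>
  define K where "K y \<longleftrightarrow> (\<forall>z. \<Theta> (case_sum z (y \<circ> Inl)) \<longrightarrow>
      (\<exists>t\<in>F. holds S (case_sum z (y \<circ> Inr \<circ> snd (snd t))) (fst t)))" for y
  have K: "definable S (X <+> E) M K" unfolding K_def
  proof (rule definable_all[where W = D], intro definable_imp definable_bex F1)
    show "definable S ((X <+> E) <+> D) M (\<lambda>e. \<Theta> (case_sum (e \<circ> Inr) (e \<circ> Inl \<circ> Inl)))"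
      by (rule definable_subst[OF \<Theta>(1)]) (auto intro!: coordinate_intros)
    fix t assume t: "t \<in> F"
    obtain \<psi> n d where td: "t = (\<psi>, n, d)" by (cases t)
    have \<psi>: "\<psi> \<in> fms S D {..<n}" and "d ` {..<n} \<subseteq> E" using F2 E t td by blast+
    then have dE: "d k \<in> E" if "k < n" for k using that by blast
    show "definable S ((X <+> E) <+> D) M (\<lambda>e. holds S (case_sum (e \<circ> Inr) (e \<circ> Inl \<circ> Inr \<circ> snd
        (snd t))) (fst t))"
      unfolding td fst_conv snd_conv
      by (rule definable_subst[OF definable_holds[OF \<psi>] order_refl]) (auto intro!:
          coordinate_intros dE)
  qed
  have "K (case_sum c id)" unfolding K_def
  proof (intro allI impI)
    fix z assume "\<Theta> (case_sum z (case_sum c id \<circ> Inl))"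
    then have "satisfies S z \<theta>" unfolding \<Theta>(2) by (simp add: comp_def)
    from F3[OF this] obtain \<psi> n d where "(\<psi>, n, d) \<in> F" "satisfies S z (inst \<psi> d)" by blast
    then show "\<exists>t\<in>F. holds S (case_sum z (case_sum c id \<circ> Inr \<circ> snd (snd t))) (fst t)"
      unfolding satisfies_inst by (intro bexI[of _ "(\<psi>, n, d)"]) (simp_all add: comp_def)
  qed
  then have Ke: "K (e i)" for i
    using same_typeD[OF realizes_uf_same_type0[OF coheir_ultra[OF U'(1)] U'(3)
        morley_uf_realizes[OF e(2)]] K] by blast
  have "\<exists>t\<in>F. infinite {i\<in>UNIV. holds S (case_sum z (e i \<circ> Inr \<circ> snd (snd t))) (fst t)}"
    by (rule pigeonhole_infinite_rel[OF infinite_UNIV_nat F1]) (use Ke z in \<open>auto simp: K_def\<close>)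
  then obtain \<psi> n d where t: "(\<psi>, n, d) \<in> F" "infinite {i. holds S (case_sum z (e i \<circ> Inr \<circ> d)) \<psi>}"
    by fastforce
  \<comment> \<open>The parameters of the chosen disjunct, moved along \<open>e\<close>: a Morley
    sequence for the image of \<open>U'\<close>, starting with \<open>d\<close> because
    \<open>e 0\<close> is the identity on \<open>E\<close>.\<close>
  define bs where "bs i = e i \<circ> (Inr \<circ> d)" for i
  obtain r where "strict_mono r \<and> (\<forall>n :: nat. r n \<in> {i. holds S (case_sum z (e i \<circ> Inr \<circ> d)) \<psi>})"
    using infinite_enumerate[OF t(2)] by (rule exE)
  then have r: "strict_mono r" "\<And>i. holds S (case_sum z (bs (r i))) \<psi>"
    unfolding bs_def by (simp_all add: comp_assoc)
  have bs: "morley_uf S {..<n} (pushforward (Inr \<circ> d) U') M bs"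
    unfolding bs_def by (rule morley_uf_push[OF e(2)]) (use E[OF t(1)] in auto)
  have cU': "coheir M (pushforward (Inr \<circ> d) U')" by (rule coheir_push[OF U'(1)])
  have \<psi>: "\<psi> \<in> fms S D {..<n}" and div: "conant_divides S M \<psi> n d" using F2[OF t(1)] by blast+
  \<comment> \<open>The pigeonhole principle gives a common solution along \<open>r\<close> only,
    but a subsequence of a Morley sequence has the type over \<open>M\<close> of the whole. One
    consistent sequence refutes Conant-dividing.\<close>
  have "consistent S (range (\<lambda>i. inst \<psi> (bs i)))" unfolding consistent_def
  proof (intro allI impI)
    fix \<Delta> assume \<Delta>: "\<Delta> \<subseteq> range (\<lambda>i. inst \<psi> (bs i))" "finite \<Delta>"
    then obtain I where I: "finite I" "\<Delta> = (\<lambda>i. inst \<psi> (bs i)) ` I"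
      using finite_subset_image by (metis (no_types, lifting))
    then obtain N where N: "\<forall>i\<in>I. i < N" using finite_nat_set_iff_bounded by meson
    define Q where "Q y \<longleftrightarrow> (\<exists>z. \<forall>i\<in>{..<N}. holds S (case_sum z (\<lambda>x. y (i, x))) \<psi>)" for y
    have Q: "definable S (UNIV \<times> {..<n}) M Q" unfolding Q_def
    proof (rule definable_ex[where W = D], intro definable_ball finite_lessThan)
      show "definable S (UNIV \<times> {..<n} <+> D) M (\<lambda>e. holds S (case_sum (e \<circ> Inr) (\<lambda>x. (e \<circ> Inl)
          (i, x))) \<psi>)" for i
        by (rule definable_subst[OF definable_holds[OF \<psi>] order_refl]) (auto intro!:
            coordinate_intros)
    qed
    have "Q (\<lambda>(i, x). bs (r i) x)" unfolding Q_def using r(2) by (auto simp: comp_def)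
    then have "Q (case_prod bs)" using same_typeD[OF morley_uf_same_type0[OF cU' bs
        morley_uf_subseq[OF bs r(1)]] Q] by blast
    then obtain w where "\<And>i. i < N \<Longrightarrow> holds S (case_sum w (bs i)) \<psi>" unfolding Q_def by auto
    then have "realizes S w \<Delta>" unfolding realizes_def I(2) using N by (auto simp: satisfies_inst)
    then show "\<exists>w. realizes S w \<Delta>" by (intro exI[of _ w])
  qed
  moreover have "invariant_morley_seq S {..<n} M bs"
      by (rule morley_uf_invariant_morley_seq[OF cU' bs])
  moreover have "\<forall>k<n. bs 0 k = d k" unfolding bs_def e(1) by simp
  ultimately show False using div unfolding conant_divides_def by blast
qed

end

section \<open>From the set of entries to the tuple\<close>

lemma rename_fms: "\<phi> \<in> fms S X A \<Longrightarrow> map_fm id id (map_sum c id) \<phi> \<in> fms S (c ` X) A"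
proof -
  assume \<phi>: "\<phi> \<in> fms S X A"
  have "map_sum c id l \<in> c ` X <+> A" if "l \<in> X <+> A" for l using that by auto
  then show ?thesis using \<phi> unfolding fms_def by (auto simp: formula_map fm.set_map)
qed

text \<open>Symmetry is stated for sets indexed by their own elements, while \<open>c\<close> may
  repeat entries. Renaming variables along \<open>c\<close> preserves forking, since a solution
  \<open>z\<close> of the renamed formula gives the solution \<open>z \<circ> c\<close> of the
  original one.\<close>

lemma conant_indep_tuple:
  fixes c :: "'v \<Rightarrow> 'm"
  assumes "conant_indep_set S M (c ` X) D" shows "conant_indep S M X c D"
  unfolding conant_indep_def
proof (intro ballI notI)
  fix \<theta> assume \<theta>: "\<theta> \<in> tp S X c (M \<union> D)" and fork: "conant_forks S X M \<theta>"
  from fork obtain F where F0: "finite F \<and> (\<forall>(\<psi>, n, d)\<in>F. \<psi> \<in> fms S X {..<n} \<and>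
      conant_divides S M \<psi> n d) \<and>
      (\<forall>z. satisfies S z \<theta> \<longrightarrow> (\<exists>(\<psi>, n, d)\<in>F. satisfies S z (inst \<psi> d)))"
    unfolding conant_forks_def implies_dividing_def by (rule exE)
  have F1: "finite F" by (rule conjunct1[OF F0])
  have F2: "\<psi> \<in> fms S X {..<n} \<and> conant_divides S M \<psi> n d" if "(\<psi>, n, d) \<in> F" for \<psi> n d
    using bspec[OF conjunct1[OF conjunct2[OF F0]] that] by simp
  note F3 = conjunct2[OF conjunct2[OF F0], rule_format]
  define ren :: "('a, 'b, 'v + 'm) fm \<Rightarrow> ('a, 'b, 'm + 'm) fm"
      where "ren = map_fm id id (map_sum c id)"
  define ren' :: "('a, 'b, 'v + nat) fm \<Rightarrow> ('a, 'b, 'm + nat) fm"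
      where "ren' = map_fm id id (map_sum c id)"
  have comp: "case_sum z f \<circ> map_sum c id = case_sum (z \<circ> c) f" for z and f :: "'w \<Rightarrow> 'm"
    by (auto simp: fun_eq_iff split: sum.split)
  have ren: "satisfies S z (ren \<phi>) \<longleftrightarrow> satisfies S (z \<circ> c) \<phi>" for z \<phi>
    unfolding ren_def holds_map comp ..
  have ren': "satisfies S z (inst (ren' \<psi>) d) \<longleftrightarrow> satisfies S (z \<circ> c) (inst \<psi> d)" for z \<psi> d
    unfolding ren'_def satisfies_inst holds_map comp ..
  have "ren \<theta> \<in> tp S (c ` X) id (M \<union> D)"
    using \<theta> rename_fms[of \<theta> S X "M \<union> D" c] unfolding tp_def by (simp add: ren) (simp add: ren_def)
  moreover have "conant_forks S (c ` X) M (ren \<theta>)"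
    unfolding conant_forks_def implies_dividing_def
  proof (intro exI[of _ "(\<lambda>(\<psi>, n, d). (ren' \<psi>, n, d)) ` F"] conjI allI impI ballI)
    show "finite ((\<lambda>(\<psi>, n, d). (ren' \<psi>, n, d)) ` F)" using F1 by simp
    fix t assume "t \<in> (\<lambda>(\<psi>, n, d). (ren' \<psi>, n, d)) ` F"
    then obtain \<psi> n d where t: "t = (ren' \<psi>, n, d)" "(\<psi>, n, d) \<in> F" by auto
    have "ren' \<psi> \<in> fms S (c ` X) {..<n}"
      unfolding ren'_def using F2[OF t(2)] by (intro rename_fms) simp
    moreover have "conant_divides S M (ren' \<psi>) n d"
      unfolding conant_divides_def
    proof (intro allI impI notI)
      fix bs assume bs: "invariant_morley_seq S {..<n} M bs \<and> (\<forall>k<n. bs 0 k = d k)"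
        and cons: "consistent S (range (\<lambda>i. inst (ren' \<psi>) (bs i)))"
      have "consistent S (range (\<lambda>i. inst \<psi> (bs i)))" unfolding consistent_def
      proof (intro allI impI)
        fix \<Delta> assume \<Delta>: "\<Delta> \<subseteq> range (\<lambda>i. inst \<psi> (bs i))" "finite \<Delta>"
        then obtain I where I: "finite I" "\<Delta> = (\<lambda>i. inst \<psi> (bs i)) ` I"
          using finite_subset_image by (metis (no_types, lifting))
        have "(\<lambda>i. inst (ren' \<psi>) (bs i)) ` I \<subseteq> range (\<lambda>i. inst (ren' \<psi>) (bs i))" by blast
        then obtain z where "realizes S z ((\<lambda>i. inst (ren' \<psi>) (bs i)) ` I)"
          using cons I(1) unfolding consistent_def by (meson finite_imageI)
        then have "realizes S (z \<circ> c) \<Delta>" unfolding realizes_def I(2) by (simp add: ren')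
        then show "\<exists>z. realizes S z \<Delta>" by (intro exI[of _ "z \<circ> c"])
      qed
      then show False using F2[OF t(2)] bs unfolding conant_divides_def by blast
    qed
    ultimately show "case t of (\<psi>, n, d) \<Rightarrow> \<psi> \<in> fms S (c ` X) {..<n} \<and> conant_divides S M \<psi> n d"
      unfolding t(1) by simp
  next
    fix z assume "satisfies S z (ren \<theta>)"
    then have "\<exists>(\<psi>, n, d)\<in>F. satisfies S (z \<circ> c) (inst \<psi> d)" unfolding ren by (rule F3)
    then show "\<exists>(\<psi>, n, d)\<in>(\<lambda>(\<psi>, n, d). (ren' \<psi>, n, d)) ` F. satisfies S z (inst \<psi> d)"
      using ren' by fastforce
  qed
  ultimately show False using assms unfolding conant_indep_def by blast
qed

context monster_model begin

text \<open>A formula over \<open>M\<close> lies in the power of a type iff one, equivalently every,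
  Morley sequence over \<open>M\<close> satisfies it: adding its parameters to \<open>M\<close>
  changes nothing. Agreement of the powers over \<open>M\<close> thus becomes agreement of the
  sequences.\<close>

lemma morley_power_same_type:
  fixes p q :: "('f, 'r, 'v + 'm) fm set"
  assumes U: "coheir M U" and V: "coheir M V"
    and p: "p \<subseteq> fms S X UNIV" "\<And>\<phi>. \<phi> \<in> fms S X UNIV \<Longrightarrow> \<phi> \<in> p \<longleftrightarrow> {c. satisfies S c \<phi>} \<in> U"
    and q: "q \<subseteq> fms S X UNIV" "\<And>\<phi>. \<phi> \<in> fms S X UNIV \<Longrightarrow> \<phi> \<in> q \<longleftrightarrow> {c. satisfies S c \<phi>} \<in> V"
    and eq: "restr (morley_power S X M p) M = restr (morley_power S X M q) M"
    and c: "morley_uf S X U M c" and c': "morley_uf S X V M c'"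
  shows "same_type S (UNIV \<times> X) M (case_prod c) (case_prod c')"
proof (rule same_typeI)
  fix G assume "definable S (UNIV \<times> X) M G" "G (case_prod c)"
  then obtain \<phi> where \<phi>: "\<phi> \<in> fms S (UNIV \<times> X) M" "\<And>e. G e \<longleftrightarrow> satisfies S e \<phi>"
    "satisfies S (case_prod c) \<phi>" unfolding definable_def by blast
  have par: "params \<phi> \<subseteq> M" "M \<union> params \<phi> = M" using \<phi>(1) unfolding params_def fms_def by auto
  have "\<phi> \<in> fms S (UNIV \<times> X) UNIV" using \<phi>(1) unfolding fms_def by auto
  then have "\<phi> \<in> restr (morley_power S X M p) M"
    using par \<phi>(3) iffD2[OF morley_seq_morley_uf[OF p] c] unfolding restr_def morley_power_def
        by auto
  then have "\<phi> \<in> restr (morley_power S X M q) M" using eq by simp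
  then obtain d where "morley_uf S X V M d" "satisfies S (case_prod d) \<phi>"
    unfolding restr_def morley_power_def par(2) using iffD1[OF morley_seq_morley_uf[OF q]] par(2)
        by auto
  then show "G (case_prod c')"
    using same_typeD[OF morley_uf_same_type0[OF V _ c'] definable_satisfies[OF \<phi>(1)]] \<phi>(2) by blast
qed

end

theorem theorem1p3:
  fixes MM :: "('f, 'r, 'm) struct"
    and \<kappa> :: "'k rel"
    and T :: "('f, 'r, nat) fm set"
    and M a b :: "'m set"
    and X :: "'v set"
    and p q :: "('f, 'r, 'v + 'm) fm set"
  assumes "complete_theory MM T" and "is_model MM T" and "monster \<kappa> MM"
    and "NSOP 3 MM"
    and "conant_symmetric \<kappa> MM"
    and "elem_submodel M MM" and "small \<kappa> M"
    and "small \<kappa> X"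
    and "global_type MM X p" and "fin_sat_over MM M p"
    and "global_type MM X q" and "fin_sat_over MM M q"
    and "restr (morley_power MM X M p) M = restr (morley_power MM X M q) M"
    and "M \<subseteq> a" and "small \<kappa> a"
    and "M \<subseteq> b" and "small \<kappa> b"
    and "kim_indep_set MM M a b"
  shows "\<exists>c. realizes MM c (restr p a \<union> restr q b) \<and> conant_indep MM M X c (a \<union> b)"
proof -
  note symm = assms(5) and M = assms(6,7) and X = assms(8) and a = assms(14,15) and b = assms(16,17)
  interpret monster_model \<kappa> MM M by unfold_locales (rule assms(3,6,7))+
  obtain U where U: "coheir M U" "\<And>\<phi>. \<phi> \<in> fms MM X UNIV \<Longrightarrow> \<phi> \<in> p \<longleftrightarrow> {c. satisfies MM c \<phi>} \<in> U"
    using type_ultra[OF assms(9,10)] by blast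
  obtain V where V: "coheir M V" "\<And>\<phi>. \<phi> \<in> fms MM X UNIV \<Longrightarrow> \<phi> \<in> q \<longleftrightarrow> {c. satisfies MM c \<phi>} \<in> V"
    using type_ultra[OF assms(11,12)] by blast
  have p: "p \<subseteq> fms MM X UNIV" and q: "q \<subseteq> fms MM X UNIV"
    using assms(9,11) unfolding complete_type_def by blast+
  obtain Ca where Ca: "morley_uf MM X U a Ca"
      using morley_uf_exists'[OF coheir_ultra[OF U(1)] X a(2)] by blast
  obtain Cb where Cb: "morley_uf MM X V b Cb"
      using morley_uf_exists'[OF coheir_ultra[OF V(1)] X b(2)] by blast
  have UV: "same_type MM (UNIV \<times> X) M (case_prod c) (case_prod c')"
      if "morley_uf MM X U M c" "morley_uf MM X V M c'" for c c'
    by (rule morley_power_same_type[OF U(1) V(1) p U(2) q V(2) assms(13) that])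
  obtain C where C: "same_type MM (UNIV \<times> X) a (case_prod Ca) C" "same_type MM (UNIV \<times> X) b
      (case_prod Cb) C"
    using common_morley[OF assms(4) X a b assms(18) U(1) V(1) UV Ca Cb] by blast
  \<comment> \<open>An ultrafilter that contains all final segments has only infinite
    members.\<close>
  have "\<exists>N. ultrafilter N \<and> range (\<lambda>n :: nat. {n..}) \<subseteq> N"
  proof (rule ultrafilter_base)
    fix Y Z assume "Y \<in> range (\<lambda>n :: nat. {n..})" "Z \<in> range (\<lambda>n :: nat. {n..})"
    then obtain m n :: nat where "Y = {m..}" "Z = {n..}" by blast
    then show "\<exists>W\<in>range (\<lambda>n :: nat. {n..}). W \<subseteq> Y \<inter> Z" by (intro bexI[of _ "{max m n..}"]) auto
  qed auto
  then obtain N where N: "ultrafilter N" "\<And>n :: nat. {n..} \<in> N" by blast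
  have N_inf: "infinite Y" if "Y \<in> N" for Y
  proof
    assume "finite Y"
    then obtain n where "Y \<inter> {n..} = {}" using finite_nat_set_iff_bounded
        by (metis disjoint_iff_not_equal atLeast_iff not_le)
    then show False using ultrafilter_int[OF N(1) that N(2)[of n]] N(1) unfolding ultrafilter_def
        by simp
  qed
  \<comment> \<open>\<open>N\<close> decides every formula: one that fails at
    \<open>N\<close>-almost all indices would have its negation in \<open>I\<close> and hence fail
    at \<open>c\<close>. So a formula true of \<open>c\<close> holds on a member of
    \<open>N\<close>.\<close>
  define I where "I = {G. definable MM X (a \<union> b) G \<and> {i. G (\<lambda>x. C (i, x))} \<in> N}"
  have "\<exists>c. \<forall>G\<in>I. G c"
  proof (rule realize[OF X small_Un[OF a(2) b(2)]])
    show "definable MM X (a \<union> b) G" if "G \<in> I" for G using that unfolding I_def by blast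
    fix J assume J: "J \<subseteq> I" "finite J"
    have "{i. \<forall>G\<in>J. G (\<lambda>x. C (i, x))} \<in> N"
        by (rule ultrafilter_ball[OF N(1) J(2)]) (use J(1) in \<open>auto simp: I_def\<close>)
    from ultrafilter_ex[OF N(1) this] obtain i where "\<forall>G\<in>J. G (\<lambda>x. C (i, x))" by blast
    then show "\<exists>c. \<forall>G\<in>J. G c" by (intro exI[of _ "\<lambda>x. C (i, x)"])
  qed
  then obtain c where c: "\<forall>G\<in>I. G c" by (rule exE)
  have real: "realizes_uf MM X W A c" if W: "morley_uf MM X W A Cw"
      and eq: "same_type MM (UNIV \<times> X) A (case_prod Cw) C"
    and A: "A \<subseteq> a \<union> b" for W A Cw
    unfolding realizes_uf_def
  proof (intro allI impI)
    fix G assume G: "definable MM X A G" "{x. G x} \<in> W"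
    have "G (\<lambda>x. C (i, x))" for i
    proof -
      have "same_type MM X A (Cw i) (\<lambda>x. C (i, x))" by (rule same_type_map[OF eq]) force
      moreover have "G (Cw i)" by (rule realizes_ufD[OF morley_uf_realizes[OF W] G])
      ultimately show ?thesis using same_typeD G(1) by blast
    qed
    then have "G \<in> I" using definable_mono[OF G(1) order_refl A] ultrafilter_UNIV[OF N(1)]
        unfolding I_def by simp
    then show "G c" by (rule bspec[OF c])
  qed
  have ca: "realizes_uf MM X U a c" by (rule real[OF Ca C(1)]) simp
  have cb: "realizes_uf MM X V b c" by (rule real[OF Cb C(2)]) simp
  have "realizes MM c (restr p a)" "realizes MM c (restr q b)"
    using ca cb realizes_restr[OF p U(2)] realizes_restr[OF q V(2)] by blast+
  then have "realizes MM c (restr p a \<union> restr q b)" unfolding realizes_def by blast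
  moreover have "conant_indep_set MM M (a \<union> b) (c ` X)"
  proof (rule conant_indep_from_sequence[OF X small_Un[OF a(2) b(2)] U(1)])
    show "realizes_uf MM X U M c" by (rule realizes_uf_mono[OF ca order_refl a(1)])
    show "morley_uf MM X U M Ca" by (rule morley_uf_mono[OF Ca a(1)])
    show "same_type MM (UNIV \<times> X) M (case_prod Ca) C"
        by (rule same_type_mono[OF C(1) order_refl a(1)])
    fix \<Theta> assume \<Theta>: "definable MM ((a \<union> b) <+> X) M \<Theta>" "\<Theta> (case_sum id c)"
    have pd: "definable MM X (a \<union> b) (\<lambda>x. \<Theta> (case_sum id x))"
      by (rule definable_subst[OF \<Theta>(1)]) (use a(1) in \<open>auto intro!: coordinate_intros\<close>)
    have "{i. \<Theta> (case_sum id (\<lambda>x. C (i, x)))} \<in> N"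
    proof (rule ccontr)
      assume "{i. \<Theta> (case_sum id (\<lambda>x. C (i, x)))} \<notin> N"
      then have "(\<lambda>x. \<not> \<Theta> (case_sum id x)) \<in> I"
        unfolding I_def using definable_not[OF pd] ultrafilter_compl[OF N(1), of "\<lambda>i. \<Theta>
            (case_sum id (\<lambda>x. C (i, x)))"] by simp
      from bspec[OF c this] show False using \<Theta>(2) by simp
    qed
    then show "infinite {i. \<Theta> (case_sum id (\<lambda>x. C (i, x)))}" by (rule N_inf)
  qed
  then have "conant_indep_set MM M (c ` X) (a \<union> b)"
    using symm M small_Un[OF a(2) b(2)] small_image[OF X] unfolding conant_symmetric_def by blast
  then have "conant_indep MM M X c (a \<union> b)" by (rule conant_indep_tuple)
  ultimately show ?thesis by blast
qed

end
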